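(* Let $G$ be an abelian group with a faithful and liftable action on a smooth quartic surface $X=V(F)\subseteq\mathbb{P}^3$. Choose a coordinate system $x_1,\dots,x_4$ for $\mathbb{P}^3$ such that the action of $G$ is diagonal, and let $I=(G,\lambda,\lambda_1,\dots,\lambda_4)$ be the associated data. Suppose $[I]$ is maximal in the poset $\mathcal{P}_{4,4}$. Then either $S=S_I$ is simple, or, up to a permutation of the coordinates $x_1,\dots,x_4$, the pair $(G,S)$ is one of the following (where $C_n=\mathbb{Z}/n\mathbb{Z}$): (1) $G=\{\mathrm{diag}[1:\omega:\omega^4:\omega^3]\mid\omega^6=1\}\cong C_6$, $S=\{x_1^3x_2,\,x_1^2x_3x_4,\,x_1x_2x_4^2,\,x_2^3x_3,\,x_3^3x_2,\,x_4^3x_3\}$; (2) $G=\{\mathrm{diag}[1:\omega:\omega^4:\omega^5]\mid\omega^6=1\}\cong C_6$, $S=\{x_1^3x_2,\,x_1x_2^2x_4,\,x_1x_3^2x_4,\,x_2^3x_3,\,x_3^3x_2,\,x_4^3x_3\}$; (3) $G=\{\mathrm{diag}[\omega:\omega^6:1:\omega^4]\mid\omega^9=1\}\cong C_9$, $S=\{x_1^3x_2,\,x_2^3x_3,\,x_3^4,\,x_4^3x_2,\,x_1x_3x_4^2\}$; (4) $G=\{\mathrm{diag}[\omega:\omega^6:1:\omega^3]\mid\omega^9=1\}\cong C_9$, $S=\{x_1^3x_2,\,x_2^3x_3,\,x_3^4,\,x_4^3x_3,\,x_2^2x_4^2,\,x_2x_3^2x_4\}$; (5) $G=\{\mathrm{diag}[\omega^4:1:\omega^8:\omega^3]\mid\omega^{12}=1\}\cong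 C_{12}$, $S=\{x_1^3x_2,\,x_1^2x_3^2,\,x_1x_2^2x_3,\,x_2^4,\,x_3^3x_2,\,x_4^4\}$.
   Context: Everything is over $\mathbb{C}$. In general fix integers $d\ge 3$, $N\ge 3$ (here $d=4$, $N=4$). A homogeneous polynomial $F(x_1,\dots,x_N)$ is called smooth if $\partial F/\partial x_1=\dots=\partial F/\partial x_N=0$ has only the solution $(0,\dots,0)$. For $F$ homogeneous of degree $d$, $V(F)\subseteq\mathbb{P}^{N-1}$ is its zero locus and $\mathrm{Lin}(V(F))\le \mathrm{PGL}(N,\mathbb{C})$ is the group of linear automorphisms of $\mathbb{P}^{N-1}$ preserving $V(F)$ (finite when $V(F)$ is smooth). Liftable action: the action of a subgroup $G\le\mathrm{Lin}(V(F))\le\mathrm{PGL}(N)$ on $V(F)$ is liftable if the inclusion $G\hookrightarrow\mathrm{PGL}(N)$ factors as a group homomorphism through $\mathrm{GL}(N)\to\mathrm{PGL}(N)$; a resulting $G\hookrightarrow\mathrm{GL}(N)$ is called a lifting. $\mathrm{diag}[\lambda_1:\dots:\lambda_N]$ denotes the class in $\mathrm{PGL}(N)$ of the diagonal matrix $\mathrm{diag}(\lambda_1,\dots,\lambda_N)$. Associated data: given a liftable action of a finite abelian group $G$ on a smooth $V(F)$ of degree $d$, choose a lifting and coordinates $x_1,\dots,x_N$ in which $G$ acts diagonally, $g(x_1,\dots,x_N)=(\lambda_1(g)x_1,\dots,\lambda_N(g)x_N)$ with characters $\lambda_i:G\to\mathbb{C}^\times$; there is a character $\lambda:G\to\mathbb{C}^\times$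 with $F(\lambda_1(g)x_1,\dots,\lambda_N(g)x_N)=\lambda(g)F(x_1,\dots,x_N)$ for all $g\in G$. Put $I=(G,\lambda,\lambda_1,\dots,\lambda_N)$ and $$S_I=\Big\{\prod_{i=1}^N x_i^{\alpha_i}\ \Big|\ \sum_i\alpha_i=d,\ \lambda=\prod_i\lambda_i^{\alpha_i}\Big\}.$$ Two data $I=(G,\lambda,\lambda_1,\dots,\lambda_N)$ and $I'=(G,\lambda',\lambda_1',\dots,\lambda_N')$ are equivalent if there is a character $\xi:G\to\mathbb{C}^\times$ with $\lambda_i'=\lambda_i\xi$ for all $i$ and $\lambda'=\lambda\xi^d$ (this corresponds to changing the lifting; $S_I$ depends only on the equivalence class $[I]$). Poset: $\mathcal{P}_{d,N}$ is the set of equivalence classes $[I]$ of all data $I=(G,\lambda,\lambda_1,\dots,\lambda_N)$ associated with liftable actions of finite abelian groups $G$ on smooth hypersurfaces $V(F)$ of degree $d$ in $\mathbb{P}^{N-1}$, where $\lambda_1,\dots,\lambda_N$ are the characters by which $G$ acts on diagonalizing coordinates for some lifting and $\lambda$ is the character by which $G$ acts on $F$. If $H\le G$ is a subgroup and $J=(H,\lambda|_H,\lambda_1|_H,\dots,\lambda_N|_H)$, write $[J]\le[I]$, and $[J]<[I]$ if $H\subsetneq G$. Maximal means maximal for this partial order. Types of polynomials (each up to a permutation of coordinates): type $K$: $x_1^{d-1}x_2+x_2^{d-1}x_3+\dots+x_k^{d-1}x_1$; type $T$: $x_1^{d-1}x_2+\dots+x_{k-1}^{d-1}x_k+x_k^d$.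 For $d\ne3$, a smooth homogeneous polynomial is simple if it is a sum of finitely many polynomials of type $K$ or $T$ in independent (pairwise disjoint sets of) variables. A set $S$ of monomials of degree $d$ in $x_1,\dots,x_N$ is simple if the sum of certain elements of $S$ is a simple polynomial in $x_1,\dots,x_N$ (all $N$ variables being used). *)

theory Defs
  imports
    "HOL-Analysis.Analysis"
    "HOL-Algebra.Coset"
    "HOL-Algebra.Elementary_Groups"
    "HOL-Library.Poly_Mapping"
    "HOL-Library.Numeral_Type"
    "HOL-Combinatorics.Permutations"
begin

type_synonym 'n cpoly = "('n \<Rightarrow>\<^sub>0 nat) \<Rightarrow>\<^sub>0 complex"

definition X :: "'n \<Rightarrow> 'n cpoly" where
  "X i = Poly_Mapping.single (Poly_Mapping.single i 1) 1"

definition Const :: "complex \<Rightarrow> 'n cpoly" where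
  "Const c = Poly_Mapping.single 0 c"

definition homogeneous :: "nat \<Rightarrow> ('n::finite) cpoly \<Rightarrow> bool" where
  "homogeneous d p \<longleftrightarrow> (\<forall>m\<in>Poly_Mapping.keys p. (\<Sum>i\<in>UNIV. Poly_Mapping.lookup m i) = d)"

definition poly_eval :: "('n::finite) cpoly \<Rightarrow> complex^'n \<Rightarrow> complex" where
  "poly_eval p v =
     (\<Sum>m\<in>Poly_Mapping.keys p. Poly_Mapping.lookup p m * (\<Prod>i\<in>UNIV. (v $ i) ^ Poly_Mapping.lookup m i))"

definition partial_deriv :: "'n \<Rightarrow> 'n cpoly \<Rightarrow> 'n cpoly" where
  "partial_deriv i p =
     (\<Sum>m\<in>Poly_Mapping.keys p.
        Poly_Mapping.single (m - Poly_Mapping.single i 1)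
          (of_nat (Poly_Mapping.lookup m i) * Poly_Mapping.lookup p m))"

text \<open>The polynomial \<open>p(A x)\<close>: the \<open>i\<close>-th variable is replaced by the \<open>i\<close>-th entry of \<open>A x\<close>.\<close>

definition lin_subst :: "complex^'n^'n \<Rightarrow> ('n::finite) cpoly \<Rightarrow> 'n cpoly" where
  "lin_subst A p =
     (\<Sum>m\<in>Poly_Mapping.keys p. Const (Poly_Mapping.lookup p m) *
        (\<Prod>i\<in>UNIV. (\<Sum>j\<in>UNIV. Const (A $ i $ j) * X j) ^ Poly_Mapping.lookup m i))"

definition smooth_poly :: "('n::finite) cpoly \<Rightarrow> bool" where
  "smooth_poly p \<longleftrightarrow> (\<forall>v. (\<forall>i. poly_eval (partial_deriv i p) v = 0) \<longleftrightarrow> v = 0)"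

definition GL :: "(complex^'n^'n) monoid" where
  "GL = \<lparr>carrier = {A. invertible A}, mult = (**), one = mat 1\<rparr>"

definition scalars :: "(complex^'n^'n) set" where
  "scalars = {mat c | c. c \<noteq> 0}"

type_synonym 'n pgl = "(complex^'n^'n) set"

definition PGL :: "('n::finite) pgl monoid" where
  "PGL = GL Mod scalars"

definition pgl_class :: "complex^'n^'n \<Rightarrow> ('n::finite) pgl" where
  "pgl_class A = scalars #>\<^bsub>GL\<^esub> A"

definition diag_mat :: "complex^'n \<Rightarrow> complex^'n^'n" where
  "diag_mat v = (\<chi> i j. if i = j then v $ i else 0)"

text \<open>Points of projective space are one-dimensional complex subspaces, so that a
  hypersurface is a set of lines through the origin.\<close>

definition hypersurface :: "('n::finite) cpoly \<Rightarrow> (complex^'n) set set" where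
  "hypersurface p = {vec.span {v} | v. v \<noteq> 0 \<and> poly_eval p v = 0}"

definition pgl_act :: "('n::finite) pgl \<Rightarrow> (complex^'n) set \<Rightarrow> (complex^'n) set" where
  "pgl_act g L = (\<Union>A\<in>g. (*v) A ` L)"

definition Lin :: "(complex^'n) set set \<Rightarrow> ('n::finite) pgl set" where
  "Lin V = {g \<in> carrier PGL. pgl_act g ` V = V}"

abbreviation subgrp :: "('n::finite) pgl set \<Rightarrow> 'n pgl monoid" where
  "subgrp G \<equiv> PGL\<lparr>carrier := G\<rparr>"

definition is_lifting :: "('n::finite) pgl set \<Rightarrow> ('n pgl \<Rightarrow> complex^'n^'n) \<Rightarrow> bool" where
  "is_lifting G \<phi> \<longleftrightarrow> \<phi> \<in> hom (subgrp G) GL \<and> (\<forall>g\<in>G. pgl_class (\<phi> g) = g)"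

definition liftable :: "('n::finite) pgl set \<Rightarrow> bool" where
  "liftable G \<longleftrightarrow> (\<exists>\<phi>. is_lifting G \<phi>)"

definition Cstar :: "complex monoid" where
  "Cstar = \<lparr>carrier = - {0}, mult = (*), one = 1\<rparr>"

definition characters :: "('n::finite) pgl set \<Rightarrow> ('n pgl \<Rightarrow> complex) set" where
  "characters G = hom (subgrp G) Cstar"

text \<open>Characters are functions on the whole type; only their values on \<open>grp I\<close> are meaningful.\<close>

record ('n::finite) datum =
  grp :: "'n pgl set"
  chr :: "'n pgl \<Rightarrow> complex"
  chrs :: "'n \<Rightarrow> 'n pgl \<Rightarrow> complex"

text \<open>The columns of \<open>P\<close> are the basis belonging to the coordinates \<open>x\<close>: the standard coordinates
  are \<open>y = P x\<close>. Thus \<open>lin_subst P F\<close> is \<open>F\<close> written in the coordinates \<open>x\<close>, and \<open>g\<close>, lifted to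
  \<open>\<phi> g\<close>, acts on them by the inverse of \<open>P\<close> times \<open>\<phi> g\<close> times \<open>P\<close>.\<close>

definition associated_datum :: "('n::finite) cpoly \<Rightarrow> complex^'n^'n \<Rightarrow> 'n datum \<Rightarrow> bool" where
  "associated_datum F P I \<longleftrightarrow>
     invertible P \<and>
     chr I \<in> characters (grp I) \<and> (\<forall>i. chrs I i \<in> characters (grp I)) \<and>
     (\<exists>\<phi>. is_lifting (grp I) \<phi> \<and>
        (\<forall>g\<in>grp I. matrix_inv P ** \<phi> g ** P = diag_mat (\<chi> i. chrs I i g))) \<and>
     (\<forall>g\<in>grp I. lin_subst (diag_mat (\<chi> i. chrs I i g)) (lin_subst P F)
                  = Const (chr I g) * lin_subst P F)"

definition S_of :: "nat \<Rightarrow> ('n::finite) datum \<Rightarrow> 'n cpoly set" where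
  "S_of d I = {\<Prod>i\<in>UNIV. X i ^ \<alpha> i | \<alpha>.
     (\<Sum>i\<in>UNIV. \<alpha> i) = d \<and> (\<forall>g\<in>grp I. chr I g = (\<Prod>i\<in>UNIV. chrs I i g ^ \<alpha> i))}"

definition data_equiv :: "nat \<Rightarrow> (('n::finite) datum \<times> 'n datum) set" where
  "data_equiv d = {(I, I'). grp I' = grp I \<and> (\<exists>\<xi>\<in>characters (grp I). \<forall>g\<in>grp I.
     (\<forall>i. chrs I' i g = chrs I i g * \<xi> g) \<and> chr I' g = chr I g * \<xi> g ^ d)}"

definition data_class :: "nat \<Rightarrow> ('n::finite) datum \<Rightarrow> 'n datum set" where
  "data_class d I = data_equiv d `` {I}"

definition data_poset :: "nat \<Rightarrow> ('n::finite) datum set set" where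
  "data_poset d = {data_class d I | I F P.
     homogeneous d F \<and> smooth_poly F \<and>
     subgroup (grp I) PGL \<and> grp I \<subseteq> Lin (hypersurface F) \<and>
     finite (grp I) \<and> comm_group (subgrp (grp I)) \<and> liftable (grp I) \<and>
     associated_datum F P I}"

text \<open>As functions are compared only on the group of a datum, restricting the characters amounts
  to shrinking the group.\<close>

definition restrict_datum :: "('n::finite) pgl set \<Rightarrow> 'n datum \<Rightarrow> 'n datum" where
  "restrict_datum H I = I\<lparr>grp := H\<rparr>"

definition class_le :: "nat \<Rightarrow> ('n::finite) datum set \<Rightarrow> 'n datum set \<Rightarrow> bool" where
  "class_le d \<J> \<I> \<longleftrightarrow> (\<exists>I H. subgroup H (subgrp (grp I)) \<and>
     \<I> = data_class d I \<and> \<J> = data_class d (restrict_datum H I))"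

definition class_less :: "nat \<Rightarrow> ('n::finite) datum set \<Rightarrow> 'n datum set \<Rightarrow> bool" where
  "class_less d \<J> \<I> \<longleftrightarrow> (\<exists>I H. subgroup H (subgrp (grp I)) \<and> H \<subset> grp I \<and>
     \<I> = data_class d I \<and> \<J> = data_class d (restrict_datum H I))"

definition maximal_class :: "nat \<Rightarrow> ('n::finite) datum set \<Rightarrow> bool" where
  "maximal_class d \<I> \<longleftrightarrow> \<I> \<in> data_poset d \<and> (\<forall>\<J>\<in>data_poset d. \<not> class_less d \<I> \<J>)"

text \<open>The datum in the reordered coordinates \<open>x'\<^sub>i = x\<^bsub>\<sigma> i\<^esub>\<close>.\<close>

definition permute_datum :: "('n \<Rightarrow> 'n) \<Rightarrow> ('n::finite) datum \<Rightarrow> 'n datum" where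
  "permute_datum \<sigma> I = I\<lparr>chrs := (\<lambda>i. chrs I (\<sigma> i))\<rparr>"

text \<open>The group of a datum, written in its own diagonalizing coordinates.\<close>

definition diag_group :: "('n::finite) datum \<Rightarrow> 'n pgl set" where
  "diag_group I = {pgl_class (diag_mat (\<chi> i. chrs I i g)) | g. g \<in> grp I}"

definition K_poly :: "nat \<Rightarrow> 'n list \<Rightarrow> 'n cpoly" where
  "K_poly d xs = (\<Sum>i<length xs. X (xs ! i) ^ (d - 1) * X (xs ! (Suc i mod length xs)))"

definition T_poly :: "nat \<Rightarrow> 'n list \<Rightarrow> 'n cpoly" where
  "T_poly d xs = (\<Sum>i<length xs - 1. X (xs ! i) ^ (d - 1) * X (xs ! Suc i)) + X (last xs) ^ d"

text \<open>The lists in \<open>Ks\<close> and \<open>Ts\<close> are the blocks of variables; together they use each variable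
  exactly once. This is the notion of a simple polynomial for \<open>d \<noteq> 3\<close>.\<close>

definition simple_poly :: "nat \<Rightarrow> ('n::finite) cpoly \<Rightarrow> bool" where
  "simple_poly d p \<longleftrightarrow> homogeneous d p \<and> smooth_poly p \<and>
     (\<exists>Ks Ts. [] \<notin> set (Ks @ Ts) \<and> distinct (concat (Ks @ Ts)) \<and> set (concat (Ks @ Ts)) = UNIV \<and>
        p = (\<Sum>xs\<leftarrow>Ks. K_poly d xs) + (\<Sum>xs\<leftarrow>Ts. T_poly d xs))"

definition simple_set :: "nat \<Rightarrow> ('n::finite) cpoly set \<Rightarrow> bool" where
  "simple_set d S \<longleftrightarrow> (\<exists>M\<subseteq>S. finite M \<and> simple_poly d (\<Sum>M))"

end

theory Submission
  imports
    Defs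
    "HOL-Combinatorics.Cycles"
    "HOL-Computational_Algebra.Fundamental_Theorem_Algebra"
    "HOL-Library.Function_Algebras"
begin

text \<open>
  A datum determines a set \<open>S\<close> of quartic monomials that is closed under integral affine combinations
  of exponents. Smoothness forces a monomial \<open>x\<^sub>i\<^sup>3 x\<^bsub>f i\<^esub>\<close> for every \<open>i\<close>, and for every coordinate line
  it forces either a monomial on that line or both possible normal directions. If some choice of
  \<open>f\<close> has a graph consisting of cycles and of chains ending in a loop, then \<open>S\<close> is simple. Otherwise a
  short computation in the character group leaves five configurations of monomials. Each of them
  supports a smooth quartic, so by maximality \<open>G\<close> is the group of all diagonal matrices acting by a
  scalar on that quartic; this is a cyclic group of roots of unity, from which \<open>S\<close> is read off.
\<close>

section \<open>Polynomials, substitutions and gradients\<close>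

text \<open>The obstacle is a pair of coordinates i, j for which x_k is the only partner of both
  x_i^3 and x_j^3: then every choice of \<open>f\<close> merges i and j at k and none is tame. No
  cube is left for the line through the coordinate points i and j, so smoothness there forces x_i^2
  x_j^2, x_i^2 x_j x_l or x_j^2 x_i x_l. Each exceptional configuration contains such a monomial, up
  to the names of i and j. Maximality is applied to a quartic other than the given one: any smooth
  quartic with monomials in S and a finite diagonal stabiliser in PGL will do. The group lies in
  that stabiliser, and the stabiliser is itself the group of a datum in the poset, so the two agree.
  The quartics chosen have five or six monomials, few enough to solve for the stabiliser by hand.
  For most of them critical points are excluded by one scheme: each derivative times its variable is
  a linear equation between values of monomials, and a multiplicative relation between the same
  monomials is incompatible with these equations unless the values vanish.\<close>

lemma poly_mapping_induct_single [case_names zero single add]: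
  fixes P :: "('a \<Rightarrow>\<^sub>0 'b::comm_monoid_add) \<Rightarrow> bool"
  assumes "P 0" and "\<And>k c. P (Poly_Mapping.single k c)" and "\<And>p q. P p \<Longrightarrow> P q \<Longrightarrow> P (p + q)"
  shows "P p"
proof (induction p rule: update_induct)
  case const
  show ?case by fact
next
  case (update f a b)
  have "Poly_Mapping.update a b f = f + Poly_Mapping.single a b"
    using update(1) by (intro poly_mapping_eqI) (auto simp: lookup_update lookup_add lookup_single when_def in_keys_iff)
  thus ?case using assms update by simp
qed

lemma Const_0 [simp]: "Const 0 = 0"
  and Const_1 [simp]: "Const 1 = 1"
  and Const_add: "Const (a + b) = Const a + Const b"
  and Const_mult: "Const (a * b) = Const a * Const b"
  by (simp_all add: Const_def single_add mult_single)

lemma Const_prod: "Const (\<Prod>i\<in>A. f i) = (\<Prod>i\<in>A. Const (f i))"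
  by (induction A rule: infinite_finite_induct) (simp_all add: Const_mult)

lemma Const_power: "Const (a ^ n) = Const a ^ n"
  by (induction n) (simp_all add: Const_mult)

lemma lookup_Const_mult: "Poly_Mapping.lookup (Const c * p) m = c * Poly_Mapping.lookup p m"
proof (induction p rule: poly_mapping_induct_single)
  case (single k c')
  show ?case by (simp add: Const_def mult_single lookup_single when_def)
qed (simp_all add: lookup_add distrib_left)

lemma X_power: "X i ^ k = Poly_Mapping.single (Poly_Mapping.single i k) 1"
  by (induction k) (simp_all add: X_def mult_single flip: single_add)

lemma prod_single:
  "(\<Prod>i\<in>A. Poly_Mapping.single (f i) (c i)) = Poly_Mapping.single (\<Sum>i\<in>A. f i) (\<Prod>i\<in>A. c i :: 'b::comm_semiring_1)"
  by (induction A rule: infinite_finite_induct) (simp_all add: mult_single)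

lemma sum_single_lookup:
  fixes m :: "'n::finite \<Rightarrow>\<^sub>0 'b::comm_monoid_add"
  shows "(\<Sum>i\<in>UNIV. Poly_Mapping.single i (Poly_Mapping.lookup m i)) = m"
  by (intro poly_mapping_eqI) (simp add: lookup_sum lookup_single when_def)

lemma prod_X_power:
  "(\<Prod>i\<in>UNIV. X i ^ Poly_Mapping.lookup m i) = Poly_Mapping.single (m :: 'n::finite \<Rightarrow>\<^sub>0 nat) 1"
  by (simp add: X_power prod_single sum_single_lookup)

lemma single_eq_monomial:
  "Poly_Mapping.single (m :: 'n::finite \<Rightarrow>\<^sub>0 nat) c = Const c * (\<Prod>i\<in>UNIV. X i ^ Poly_Mapping.lookup m i)"
  by (simp add: prod_X_power Const_def mult_single)

text \<open>For identities between ring homomorphisms: only constants and variables remain to be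
  checked.\<close>

lemma cpoly_induct [case_names const var add mult]:
  fixes p :: "('n::finite) cpoly"
  assumes const: "\<And>c. P (Const c)" and var: "\<And>i. P (X i)"
    and add: "\<And>p q. P p \<Longrightarrow> P q \<Longrightarrow> P (p + q)" and mult: "\<And>p q. P p \<Longrightarrow> P q \<Longrightarrow> P (p * q)"
  shows "P p"
proof (induction p rule: poly_mapping_induct_single)
  case zero
  show ?case using const[of 0] by simp
next
  case (single m c)
  have pow: "P (X i ^ k)" for i k
    by (induction k) (use const[of 1] var mult in auto)
  have "P (\<Prod>i\<in>A. X i ^ Poly_Mapping.lookup m i)" for A
    by (induction A rule: infinite_finite_induct) (use const[of 1] mult pow in auto)
  thus ?case by (simp add: single_eq_monomial const mult)
qed (rule add)

lemma poly_eval_add: "poly_eval (p + q) v = poly_eval p v + poly_eval q v"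
  unfolding poly_eval_def by (rule setsum_keys_plus_distrib) (simp_all add: distrib_right)

lemma poly_eval_single: "poly_eval (Poly_Mapping.single m c) v = c * (\<Prod>i\<in>UNIV. (v $ i) ^ Poly_Mapping.lookup m i)"
  unfolding poly_eval_def by (cases "c = 0") auto

lemma poly_eval_0 [simp]: "poly_eval 0 v = 0"
  by (simp add: poly_eval_def)

lemma poly_eval_Const [simp]: "poly_eval (Const c) v = c"
  by (simp add: Const_def poly_eval_single)

lemma poly_eval_1 [simp]: "poly_eval 1 v = 1"
  using poly_eval_Const[of 1 v] by simp

lemma poly_eval_mult: "poly_eval (p * q) v = poly_eval p v * poly_eval q v"
proof (induction p rule: poly_mapping_induct_single)
  case (single k c)
  show ?case
  proof (induction q rule: poly_mapping_induct_single)
    case (single l d)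
    show ?case by (simp add: mult_single poly_eval_single lookup_add power_add prod.distrib)
  qed (simp_all add: poly_eval_add distrib_left)
qed (simp_all add: poly_eval_add distrib_right)

lemma poly_eval_X [simp]: "poly_eval (X i) v = v $ i"
proof -
  have "(\<Prod>j\<in>UNIV. (v $ j) ^ Poly_Mapping.lookup (Poly_Mapping.single i 1 :: 'a \<Rightarrow>\<^sub>0 nat) j) = (\<Prod>j\<in>UNIV. if j = i then v $ j else 1)"
    by (rule prod.cong) (auto simp: lookup_single when_def)
  thus ?thesis by (simp add: X_def poly_eval_single)
qed

lemma poly_eval_power: "poly_eval (p ^ k) v = poly_eval p v ^ k"
  by (induction k) (simp_all add: poly_eval_mult)

lemma poly_eval_sum: "poly_eval (\<Sum>i\<in>A. f i) v = (\<Sum>i\<in>A. poly_eval (f i) v)"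
  by (induction A rule: infinite_finite_induct) (simp_all add: poly_eval_add)

section \<open>Linear substitutions\<close>

lemma lin_subst_add: "lin_subst A (p + q) = lin_subst A p + lin_subst A q"
  unfolding lin_subst_def by (rule setsum_keys_plus_distrib) (simp_all add: Const_add distrib_right)

lemma lin_subst_single:
  "lin_subst A (Poly_Mapping.single m c) =
     Const c * (\<Prod>i\<in>UNIV. (\<Sum>j\<in>UNIV. Const (A $ i $ j) * X j) ^ Poly_Mapping.lookup m i)"
  unfolding lin_subst_def by (cases "c = 0") auto

lemma lin_subst_0 [simp]: "lin_subst A 0 = 0"
  by (simp add: lin_subst_def)

lemma lin_subst_Const [simp]: "lin_subst A (Const c) = Const c"
  by (subst (1) Const_def) (simp add: lin_subst_single)

lemma lin_subst_mult: "lin_subst A (p * q) = lin_subst A p * lin_subst A q"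
proof (induction p rule: poly_mapping_induct_single)
  case (single k c)
  show ?case
  proof (induction q rule: poly_mapping_induct_single)
    case (single l d)
    show ?case
      by (simp add: mult_single lin_subst_single lookup_add power_add prod.distrib Const_mult mult_ac)
  qed (simp_all add: lin_subst_add distrib_left)
qed (simp_all add: lin_subst_add distrib_right)

lemma lin_subst_X [simp]: "lin_subst A (X i) = (\<Sum>j\<in>UNIV. Const (A $ i $ j) * X j)"
proof -
  have "(\<Prod>k\<in>UNIV. (\<Sum>j\<in>UNIV. Const (A $ k $ j) * X j) ^ Poly_Mapping.lookup (Poly_Mapping.single i 1 :: 'a \<Rightarrow>\<^sub>0 nat) k)
     = (\<Prod>k\<in>UNIV. if k = i then \<Sum>j\<in>UNIV. Const (A $ k $ j) * X j else 1)"
    by (rule prod.cong) (auto simp: lookup_single when_def)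
  thus ?thesis by (simp add: X_def[of i] lin_subst_single)
qed

lemma lin_subst_sum: "lin_subst A (\<Sum>i\<in>I. f i) = (\<Sum>i\<in>I. lin_subst A (f i))"
  by (induction I rule: infinite_finite_induct) (simp_all add: lin_subst_add)

lemma Const_sum: "Const (\<Sum>i\<in>A. f i) = (\<Sum>i\<in>A. Const (f i))"
  by (induction A rule: infinite_finite_induct) (simp_all add: Const_add)

lemma lin_subst_lin_subst: "lin_subst A (lin_subst B p) = lin_subst (B ** A) p"
proof (induction p rule: cpoly_induct)
  case (var i)
  have "lin_subst A (lin_subst B (X i)) = (\<Sum>j\<in>UNIV. \<Sum>k\<in>UNIV. Const (B $ i $ j * A $ j $ k) * X k)"
    by (simp add: lin_subst_sum lin_subst_mult sum_distrib_left Const_mult mult_ac)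
  also have "\<dots> = (\<Sum>k\<in>UNIV. \<Sum>j\<in>UNIV. Const (B $ i $ j * A $ j $ k) * X k)"
    by (rule sum.swap)
  finally show ?case by (simp add: matrix_matrix_mult_def Const_sum sum_distrib_right)
qed (simp_all add: lin_subst_add lin_subst_mult)

lemma lin_subst_mat_1 [simp]: "lin_subst (mat 1) p = p"
proof (induction p rule: cpoly_induct)
  case (var i)
  have "(\<Sum>j\<in>UNIV. Const (mat 1 $ i $ j) * X j) = (\<Sum>j\<in>UNIV. if j = i then X j else 0)"
    by (rule sum.cong) (auto simp: mat_def)
  thus ?case by simp
qed (simp_all add: lin_subst_add lin_subst_mult)

lemma poly_eval_lin_subst: "poly_eval (lin_subst A p) v = poly_eval p (A *v v)"
  by (induction p rule: cpoly_induct)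
    (simp_all add: lin_subst_add lin_subst_mult poly_eval_add poly_eval_mult poly_eval_sum matrix_vector_mult_def)

text \<open>A diagonal substitution does not mix monomials. Hence a polynomial is an eigenvector iff
  all its monomials take the same value at \<open>t\<close>, which turns
  \<open>associated_datum\<close> into a statement about characters.\<close>

lemma lookup_lin_subst_diag:
  "Poly_Mapping.lookup (lin_subst (diag_mat t) p) m = (\<Prod>i\<in>UNIV. (t $ i) ^ Poly_Mapping.lookup m i) * Poly_Mapping.lookup p m"
proof (induction p rule: poly_mapping_induct_single)
  case (single k c)
  have "(\<Sum>j\<in>UNIV. Const (diag_mat t $ i $ j) * X j) = (\<Sum>j\<in>UNIV. if j = i then Const (t $ i) * X j else 0)" for i
    by (rule sum.cong) (auto simp: diag_mat_def)
  hence "lin_subst (diag_mat t) (Poly_Mapping.single k c)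
     = Const (c * (\<Prod>i\<in>UNIV. (t $ i) ^ Poly_Mapping.lookup k i)) * Poly_Mapping.single k 1"
    by (simp add: lin_subst_single power_mult_distrib prod.distrib prod_X_power Const_power[symmetric]
        Const_prod[symmetric] Const_mult mult_ac)
  thus ?case by (simp add: lookup_Const_mult lookup_single when_def)
qed (simp_all add: lin_subst_add lookup_add distrib_left)

section \<open>Homogeneity\<close>

lemma homogeneous_add: "homogeneous d p \<Longrightarrow> homogeneous d q \<Longrightarrow> homogeneous d (p + q)"
  unfolding homogeneous_def using keys_add[of p q] by blast

lemma homogeneous_0 [simp]: "homogeneous d 0"
  by (simp add: homogeneous_def)

lemma homogeneous_sum: "(\<And>i. i \<in> A \<Longrightarrow> homogeneous d (f i)) \<Longrightarrow> homogeneous d (\<Sum>i\<in>A. f i)"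
  by (induction A rule: infinite_finite_induct) (simp_all add: homogeneous_add)

lemma homogeneous_mult:
  assumes "homogeneous d p" "homogeneous e q"
  shows "homogeneous (d + e) (p * q)"
  unfolding homogeneous_def
proof
  fix m assume "m \<in> Poly_Mapping.keys (p * q)"
  then obtain a b where "a \<in> Poly_Mapping.keys p" "b \<in> Poly_Mapping.keys q" "m = a + b"
    using keys_mult[of p q] by blast
  thus "(\<Sum>i\<in>UNIV. Poly_Mapping.lookup m i) = d + e"
    using assms by (simp add: homogeneous_def lookup_add sum.distrib)
qed

lemma homogeneous_Const [simp]: "homogeneous 0 (Const c)"
  by (simp add: homogeneous_def Const_def)

lemma homogeneous_X [simp]: "homogeneous (Suc 0) (X i)"
  by (simp add: homogeneous_def X_def lookup_single when_def)

lemma homogeneous_Const_mult: "homogeneous d p \<Longrightarrow> homogeneous d (Const c * p)"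
  using homogeneous_mult[OF homogeneous_Const] by fastforce

lemma homogeneous_power: "homogeneous d p \<Longrightarrow> homogeneous (k * d) (p ^ k)"
  by (induction k) (use homogeneous_Const[of 1] in \<open>auto intro: homogeneous_mult\<close>)

lemma homogeneous_prod:
  "finite A \<Longrightarrow> (\<And>i. i \<in> A \<Longrightarrow> homogeneous (e i) (f i)) \<Longrightarrow> homogeneous (\<Sum>i\<in>A. e i) (\<Prod>i\<in>A. f i)"
  by (induction A rule: finite_induct) (use homogeneous_Const[of 1] in \<open>auto intro: homogeneous_mult\<close>)

lemma homogeneous_lin_subst:
  assumes "homogeneous d p"
  shows "homogeneous d (lin_subst A p)"
  unfolding lin_subst_def
proof (intro homogeneous_sum homogeneous_Const_mult)
  fix m assume "m \<in> Poly_Mapping.keys p"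
  hence "(\<Sum>i\<in>UNIV. Poly_Mapping.lookup m i * 1) = d"
    using assms by (simp add: homogeneous_def)
  moreover have "homogeneous (\<Sum>i\<in>UNIV. Poly_Mapping.lookup m i * 1)
     (\<Prod>i\<in>UNIV. (\<Sum>j\<in>UNIV. Const (A $ i $ j) * X j) ^ Poly_Mapping.lookup m i)"
    unfolding One_nat_def
    by (intro homogeneous_prod homogeneous_power homogeneous_sum homogeneous_Const_mult) simp_all
  ultimately show "homogeneous d (\<Prod>i\<in>UNIV. (\<Sum>j\<in>UNIV. Const (A $ i $ j) * X j) ^ Poly_Mapping.lookup m i)"
    by simp
qed

section \<open>Partial derivatives and gradients\<close>

lemma partial_deriv_add: "partial_deriv i (p + q) = partial_deriv i p + partial_deriv i q"
  unfolding partial_deriv_def by (rule setsum_keys_plus_distrib) (simp_all add: distrib_left single_add)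

lemma partial_deriv_single:
  "partial_deriv i (Poly_Mapping.single m c) = Poly_Mapping.single (m - Poly_Mapping.single i 1) (of_nat (Poly_Mapping.lookup m i) * c)"
  unfolding partial_deriv_def by (cases "c = 0") auto

lemma partial_deriv_0 [simp]: "partial_deriv i 0 = 0"
  by (simp add: partial_deriv_def)

lemma poly_eval_has_derivative:
  "(poly_eval p has_derivative (\<lambda>h. \<Sum>i\<in>UNIV. h $ i * poly_eval (partial_deriv i p) v)) (at v)"
proof (induction p rule: poly_mapping_induct_single)
  case zero
  show ?case by (simp add: poly_eval_def)
next
  case (add p q)
  have "poly_eval (p + q) = (\<lambda>v. poly_eval p v + poly_eval q v)"
    by (simp add: poly_eval_add fun_eq_iff)
  thus ?case using has_derivative_add[OF add]
    by (simp add: partial_deriv_add poly_eval_add distrib_left sum.distrib)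
next
  case (single m c)
  let ?l = "Poly_Mapping.lookup m"
  have mono: "((\<lambda>v. \<Prod>i\<in>UNIV. (v $ i) ^ ?l i) has_derivative
     (\<lambda>h. \<Sum>i\<in>UNIV. (of_nat (?l i) * (h $ i) * (v $ i) ^ (?l i - 1)) * (\<Prod>j\<in>UNIV - {i}. (v $ j) ^ ?l j))) (at v)"
    by (auto intro!: derivative_eq_intros bounded_linear_imp_has_derivative bounded_linear_vec_nth)
  \<comment> \<open>Truncated subtraction is harmless: if x_i does not occur in \<open>m\<close>,
    the factor \<open>of_nat (?l i)\<close> kills the term.\<close>
  have "(\<Prod>j\<in>UNIV. (v $ j) ^ Poly_Mapping.lookup (m - Poly_Mapping.single i 1) j)
      = (v $ i) ^ (?l i - 1) * (\<Prod>j\<in>UNIV - {i}. (v $ j) ^ ?l j)" for i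
    by (subst prod.remove[of _ i]) (auto simp: lookup_minus lookup_single when_def intro!: prod.cong)
  hence "h $ i * poly_eval (partial_deriv i (Poly_Mapping.single m c)) v =
     c * ((of_nat (?l i) * (h $ i) * (v $ i) ^ (?l i - 1)) * (\<Prod>j\<in>UNIV - {i}. (v $ j) ^ ?l j))" for h i
    by (simp add: partial_deriv_single poly_eval_single mult_ac)
  moreover have "poly_eval (Poly_Mapping.single m c) = (\<lambda>v. c * (\<Prod>i\<in>UNIV. (v $ i) ^ ?l i))"
    by (simp add: poly_eval_single fun_eq_iff)
  ultimately show ?case
    using has_derivative_mult_right[OF mono, of c] by (simp only: sum_distrib_left)
qed

text \<open>Values instead of formal derivatives: by uniqueness of the Frechet derivative
  (\<open>grad_eqI\<close>) the product and chain rules come from analysis, and critical points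
  depend on values only.\<close>

definition grad :: "'n::finite \<Rightarrow> 'n cpoly \<Rightarrow> complex^'n \<Rightarrow> complex" where
  "grad i p v = poly_eval (partial_deriv i p) v"

lemma grad_eqI:
  assumes "(poly_eval p has_derivative D) (at v)"
  shows "grad i p v = D (axis i 1)"
proof -
  have "D = (\<lambda>h. \<Sum>j\<in>UNIV. h $ j * poly_eval (partial_deriv j p) v)"
    by (rule has_derivative_unique[OF assms poly_eval_has_derivative])
  thus ?thesis by (simp add: grad_def axis_def if_distrib[of "\<lambda>x. x * _"] sum.delta cong: if_cong)
qed

lemma poly_eval_has_derivative_grad:
  "(poly_eval p has_derivative (\<lambda>h. \<Sum>i\<in>UNIV. h $ i * grad i p v)) (at v)"
  unfolding grad_def by (rule poly_eval_has_derivative)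

lemma smooth_poly_iff: "smooth_poly p \<longleftrightarrow> (\<forall>v. (\<forall>i. grad i p v = 0) \<longleftrightarrow> v = 0)"
  by (simp add: smooth_poly_def grad_def)

lemma grad_add: "grad i (p + q) v = grad i p v + grad i q v"
  by (simp add: grad_def partial_deriv_add poly_eval_add)

lemma grad_0 [simp]: "grad i 0 v = 0"
  by (simp add: grad_def)

lemma grad_sum: "grad i (\<Sum>a\<in>A. f a) v = (\<Sum>a\<in>A. grad i (f a) v)"
  by (induction A rule: infinite_finite_induct) (simp_all add: grad_add)

lemma grad_mult: "grad i (p * q) v = grad i p v * poly_eval q v + poly_eval p v * grad i q v"
proof -
  have "poly_eval (p * q) = (\<lambda>v. poly_eval p v * poly_eval q v)"
    by (simp add: poly_eval_mult fun_eq_iff)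
  with has_derivative_mult[OF poly_eval_has_derivative_grad[of p v] poly_eval_has_derivative_grad[of q v]]
  show ?thesis
    by (subst grad_eqI, simp) (simp add: axis_def if_distrib[of "\<lambda>x. x * _"] sum.delta cong: if_cong)
qed

lemma grad_Const [simp]: "grad i (Const c) v = 0"
  by (simp add: grad_def Const_def partial_deriv_single poly_eval_single)

lemma grad_X: "grad i (X j) v = (if i = j then 1 else 0)"
proof -
  have "poly_eval (X j) = (\<lambda>v. v $ j)"
    by (simp add: fun_eq_iff)
  hence "(poly_eval (X j) has_derivative (\<lambda>h. h $ j)) (at v)"
    by (simp add: bounded_linear_imp_has_derivative bounded_linear_vec_nth)
  from grad_eqI[OF this] show ?thesis by (auto simp: axis_def)
qed

lemma grad_power: "grad i (p ^ k) v = of_nat k * poly_eval p v ^ (k - 1) * grad i p v"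
proof (induction k)
  case 0
  show ?case using grad_Const[of i 1 v] by simp
next
  case (Suc k)
  have "grad i (p ^ Suc k) v = grad i p v * poly_eval p v ^ k + poly_eval p v * grad i (p ^ k) v"
    by (simp add: grad_mult poly_eval_power)
  thus ?case unfolding Suc by (cases k) (simp_all add: algebra_simps)
qed

lemma grad_lin_subst: "grad i (lin_subst A p) v = (\<Sum>j\<in>UNIV. A $ j $ i * grad j p (A *v v))"
proof -
  have eq: "poly_eval (lin_subst A p) = poly_eval p \<circ> (*v) A"
    by (simp add: poly_eval_lin_subst fun_eq_iff)
  have "bounded_linear ((*v) A)"
    by (rule matrix_vector_mul_bounded_linear)
  hence "((*v) A has_derivative (*v) A) (at v)"
    by (rule bounded_linear_imp_has_derivative)
  from diff_chain_at[OF this poly_eval_has_derivative_grad, of p] show ?thesis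
    unfolding eq[symmetric]
    by (subst grad_eqI) (assumption, simp add: o_def matrix_vector_mult_def axis_def if_distrib[of "\<lambda>x. _ * x"] sum.delta cong: if_cong)
qed

text \<open>By the chain rule the gradient of p(Av) is the transpose of \<open>A\<close> applied to
  the gradient of \<open>p\<close> at Av; \<open>A\<close> and its transpose both have trivial
  kernel.\<close>

lemma smooth_poly_lin_subst:
  fixes A :: "complex^'n^'n"
  assumes "invertible A" "smooth_poly p"
  shows "smooth_poly (lin_subst A p)"
proof -
  have nz: "A *v v = 0 \<longleftrightarrow> v = 0" for v
    using assms(1) by (metis invertible_def matrix_left_invertible_ker matrix_vector_mult_0_right)
  have "(\<forall>i. grad i (lin_subst A p) v = 0) \<longleftrightarrow> v = 0" for v
  proof
    assume g: "\<forall>i. grad i (lin_subst A p) v = 0"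
    let ?w = "\<chi> j. grad j p (A *v v)"
    have "transpose A *v ?w = 0"
      using g by (simp add: vec_eq_iff grad_lin_subst matrix_vector_mult_def transpose_def)
    moreover have "invertible (transpose A)"
      using assms(1) by (metis invertible_def matrix_transpose_mul transpose_mat)
    ultimately have "?w = 0"
      by (metis invertible_def matrix_left_invertible_ker)
    hence "\<forall>j. grad j p (A *v v) = 0"
      by (simp add: vec_eq_iff)
    thus "v = 0" using assms(2) nz by (simp add: smooth_poly_iff)
  next
    assume "v = 0"
    hence "\<forall>j. grad j p (A *v v) = 0" using assms(2) nz by (simp add: smooth_poly_iff)
    thus "\<forall>i. grad i (lin_subst A p) v = 0" by (simp add: grad_lin_subst)
  qed
  thus ?thesis by (simp add: smooth_poly_iff)
qed

section \<open>Simple polynomials\<close>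

text \<open>With \<open>f\<close> naming the second variable of each monomial x_i^(d-1) x_(f i), a
  cycle of \<open>f\<close> is a block of type K, and a chain into a loop (\<open>chain_on\<close>)
  is a block of type T, the loop giving its pure power.\<close>

definition cyclic_on :: "('a \<Rightarrow> 'a) \<Rightarrow> 'a list \<Rightarrow> bool" where
  "cyclic_on f xs \<longleftrightarrow> (\<forall>i<length xs. f (xs ! i) = xs ! (Suc i mod length xs))"

definition chain_on :: "('a \<Rightarrow> 'a) \<Rightarrow> 'a list \<Rightarrow> bool" where
  "chain_on f xs \<longleftrightarrow> (\<forall>i<length xs - 1. f (xs ! i) = xs ! Suc i) \<and> f (last xs) = last xs"

text \<open>The functional graphs whose components are cycles and chains ending in a loop.\<close>

definition tame_on :: "'a set \<Rightarrow> ('a \<Rightarrow> 'a) \<Rightarrow> bool" where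
  "tame_on U f \<longleftrightarrow> f ` U \<subseteq> U \<and> (\<forall>i\<in>U. \<forall>j\<in>U. i \<noteq> j \<longrightarrow> f i = f j \<longrightarrow> f i = i \<or> f j = j)"

lemma tame_onD: "tame_on U f \<Longrightarrow> i \<in> U \<Longrightarrow> j \<in> U \<Longrightarrow> i \<noteq> j \<Longrightarrow> f i = f j \<Longrightarrow> f i = i \<or> f j = j"
  by (simp add: tame_on_def)

lemma cyclic_on_cong: "(\<And>x. x \<in> set xs \<Longrightarrow> f x = g x) \<Longrightarrow> cyclic_on f xs \<Longrightarrow> cyclic_on g xs"
  by (simp add: cyclic_on_def)

lemma chain_on_cong:
  "(\<And>x. x \<in> set xs \<Longrightarrow> f x = g x) \<Longrightarrow> xs \<noteq> [] \<Longrightarrow> chain_on f xs \<Longrightarrow> chain_on g xs"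
  by (auto simp: chain_on_def)

lemma bij_cycle_exists:
  assumes "finite U" "inj_on f U" "f ` U \<subseteq> U" "x \<in> U"
  obtains xs where "xs \<noteq> []" "distinct xs" "set xs \<subseteq> U" "cyclic_on f xs"
    "f ` (U - set xs) \<subseteq> U - set xs"
proof -
  \<comment> \<open>Extended by the identity, \<open>f\<close> becomes a permutation of the whole
    type, to which \<open>least_power\<close> and \<open>support\<close> apply.\<close>
  define g where "g = (\<lambda>y. if y \<in> U then f y else y)"
  have fU: "f ` U = U"
    using assms by (simp add: endo_inj_surj)
  have "bij_betw f U U"
    using assms(2) fU by (simp add: bij_betw_def)
  hence "g permutes U"
    by (intro bij_imp_permutes) (auto simp: g_def cong: bij_betw_cong)
  hence perm: "permutation g"
    using assms(1) permutation_permutes by blast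
  define n where "n = least_power g x"
  define xs where "xs = support g x"
  have n: "(g ^^ n) x = x" "n > 0"
    using least_power_of_permutation[OF perm] by (simp_all add: n_def)
  have len: "length xs = n" and nth: "xs ! i = (g ^^ i) x" if "i < n" for i
    using that by (simp_all add: xs_def n_def)
  have len: "length xs = n"
    by (simp add: xs_def n_def)
  have gU: "(g ^^ i) x \<in> U" for i
    by (induction i) (use assms(3,4) in \<open>auto simp: g_def\<close>)
  have sub: "set xs \<subseteq> U"
    using gU nth len by (force simp: in_set_conv_nth)
  have cyc: "f (xs ! i) = xs ! (Suc i mod n)" if "i < n" for i
  proof -
    have "f (xs ! i) = (g ^^ Suc i) x"
      using gU[of i] by (simp add: nth that g_def)
    also have "\<dots> = xs ! (Suc i mod n)"
      using that n by (cases "Suc i = n") (simp_all add: nth)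
    finally show ?thesis .
  qed
  have "f ` (U - set xs) \<subseteq> U - set xs"
  proof (rule image_subsetI)
    fix a assume a: "a \<in> U - set xs"
    have "f a \<notin> set xs"
    proof
      assume "f a \<in> set xs"
      then obtain k where k: "k < n" "f a = xs ! k"
        by (auto simp: in_set_conv_nth len)
      \<comment> \<open>The cyclic predecessor of position \<open>k\<close>; by injectivity
        \<open>a\<close> must be this entry of the cycle.\<close>
      define i where "i = (if k = 0 then n - 1 else k - 1)"
      have "i < n" "Suc i mod n = k"
        using k n by (auto simp: i_def)
      hence "f a = f (xs ! i)" "xs ! i \<in> set xs"
        using cyc k len by auto
      hence "a = xs ! i"
        using a sub assms(2) by (auto dest: inj_onD)
      thus False using a \<open>xs ! i \<in> set xs\<close> by simp
    qed
    thus "f a \<in> U - set xs" using a assms(3) by auto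
  qed
  moreover have "distinct xs"
    using cycle_of_permutation[OF perm] by (simp add: xs_def)
  moreover have "xs \<noteq> []" using len n by auto
  moreover have "cyclic_on f xs" using cyc len by (simp add: cyclic_on_def)
  ultimately show ?thesis using that sub by blast
qed

text \<open>The induction removes one loop \<open>p\<close> or one cycle. Tameness leaves at most
  one other vertex \<open>j\<close> over \<open>p\<close>; turning \<open>j\<close> into a loop
  keeps the rest tame, and the chain that then ends in \<open>j\<close> is prolonged by
  \<open>p\<close>. Without loops, tameness is injectivity and a cycle splits off. The cycles are
  required to be free of loops so that \<open>j\<close> is known to lie in a chain.\<close>

lemma tame_decomposition:
  assumes "finite U" "tame_on U f"
  shows "\<exists>Ks Ts. [] \<notin> set (Ks @ Ts) \<and> distinct (concat (Ks @ Ts)) \<and> set (concat (Ks @ Ts)) = U \<and>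
    (\<forall>xs\<in>set Ks. cyclic_on f xs \<and> (\<forall>x\<in>set xs. f x \<noteq> x)) \<and> (\<forall>xs\<in>set Ts. chain_on f xs)"
  using assms
proof (induction "card U" arbitrary: U f rule: less_induct)
  case less
  note tame = tame_onD[OF less.prems(2)]
  have fU: "f ` U \<subseteq> U" using less.prems(2) by (simp add: tame_on_def)
  consider "U = {}" | p where "p \<in> U" "f p = p" | "U \<noteq> {}" "\<forall>p\<in>U. f p \<noteq> p" by blast
  thus ?case
  proof cases
    case 1
    show ?thesis by (rule exI[of _ "[]"], rule exI[of _ "[]"]) (simp add: 1)
  next
    case 2
    define U' where "U' = U - {p}"
    have U': "card U' < card U" "finite U'"
      using card_Diff1_less[OF less.prems(1), of p] 2 less.prems(1) by (simp_all add: U'_def)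
    show ?thesis
    proof (cases "\<exists>j\<in>U. j \<noteq> p \<and> f j = p")
      case False
      have "tame_on U' f"
        using fU False tame by (auto simp: U'_def tame_on_def)
      from less.hyps[OF U' this] obtain Ks Ts where IH: "[] \<notin> set (Ks @ Ts)" "distinct (concat (Ks @ Ts))"
        "set (concat (Ks @ Ts)) = U'" "\<forall>xs\<in>set Ks. cyclic_on f xs \<and> (\<forall>x\<in>set xs. f x \<noteq> x)"
        "\<forall>xs\<in>set Ts. chain_on f xs"
        by blast
      have "set (concat (Ks @ [p] # Ts)) = insert p (set (concat (Ks @ Ts)))" by auto
      moreover have "insert p U' = U" using 2 by (auto simp: U'_def)
      ultimately have "set (concat (Ks @ [p] # Ts)) = U" by (simp only: IH(3))
      moreover have "p \<notin> set (concat (Ks @ Ts))" unfolding IH(3) U'_def by simp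
      hence "distinct (concat (Ks @ [p] # Ts))" using IH(2) by auto
      moreover have "chain_on f [p]" using 2 by (simp add: chain_on_def)
      ultimately show ?thesis
        using IH(1,4,5) by (intro exI[of _ Ks] exI[of _ "[p] # Ts"] conjI) simp_all
    next
      case True
      then obtain j where j: "j \<in> U" "j \<noteq> p" "f j = p" by blast
      define f' where "f' = f(j := j)"
      have "tame_on U' f'"
        unfolding tame_on_def
      proof (intro conjI ballI impI)
        show "f' ` U' \<subseteq> U'"
          using fU tame[OF _ j(1)] j 2 by (auto simp: U'_def f'_def)
      next
        fix a b assume "a \<in> U'" "b \<in> U'" "a \<noteq> b" "f' a = f' b"
        thus "f' a = a \<or> f' b = b"
          using tame[of a b] by (auto simp: U'_def f'_def split: if_splits)
      qed
      from less.hyps[OF U' this] obtain Ks Ts where IH: "[] \<notin> set (Ks @ Ts)" "distinct (concat (Ks @ Ts))"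
        "set (concat (Ks @ Ts)) = U'" "\<forall>xs\<in>set Ks. cyclic_on f' xs \<and> (\<forall>x\<in>set xs. f' x \<noteq> x)"
        "\<forall>xs\<in>set Ts. chain_on f' xs"
        by blast
      have "j \<in> set (concat (Ks @ Ts))" unfolding IH(3) U'_def using j by simp
      moreover have jK: "j \<notin> set xs" if "xs \<in> set Ks" for xs
        using IH(4) that by (metis f'_def fun_upd_same)
      ultimately obtain ys where ys: "ys \<in> set Ts" "j \<in> set ys" by auto
      then obtain T1 T2 where T: "Ts = T1 @ ys # T2" by (meson split_list)
      have dys: "distinct ys" and jT: "\<And>zs. zs \<in> set T1 \<union> set T2 \<Longrightarrow> j \<notin> set zs"
        using IH(2) ys(2) by (auto simp: T)
      have chys: "chain_on f' ys" using IH(5) ys by simp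
      have ne: "ys \<noteq> []" using ys by auto
      \<comment> \<open>A loop of \<open>f'\<close> cannot sit before the end of a chain with
        distinct entries.\<close>
      have last: "last ys = j"
      proof -
        obtain i where i: "i < length ys" "ys ! i = j" using ys by (auto simp: in_set_conv_nth)
        have "\<not> i < length ys - 1"
        proof
          assume "i < length ys - 1"
          hence "ys ! Suc i = ys ! i" "Suc i < length ys"
            using chys i by (auto simp: chain_on_def f'_def)
          thus False using i nth_eq_iff_index_eq[OF dys, of "Suc i" i] by simp
        qed
        hence "i = length ys - 1" using i by simp
        thus ?thesis using i ne by (simp add: last_conv_nth)
      qed
      have "chain_on f (ys @ [p])"
        unfolding chain_on_def
      proof (intro conjI allI impI)
        show "f (last (ys @ [p])) = last (ys @ [p])" using 2 by simp
        fix i assume i: "i < length (ys @ [p]) - 1"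
        show "f ((ys @ [p]) ! i) = (ys @ [p]) ! Suc i"
        proof (cases "i = length ys - 1")
          case True
          thus ?thesis using ne last j by (simp add: nth_append last_conv_nth)
        next
          case False
          hence i': "i < length ys - 1" using i by simp
          hence "ys ! i \<noteq> j"
            using last dys ne by (auto simp: last_conv_nth nth_eq_iff_index_eq)
          thus ?thesis using chys i' by (auto simp: chain_on_def f'_def nth_append)
        qed
      qed
      moreover have "cyclic_on f xs \<and> (\<forall>x\<in>set xs. f x \<noteq> x)" if "xs \<in> set Ks" for xs
      proof -
        have same: "f' x = f x" if "x \<in> set xs" for x
          using that jK[OF \<open>xs \<in> set Ks\<close>] by (auto simp: f'_def)
        moreover have "cyclic_on f' xs" "\<forall>x\<in>set xs. f' x \<noteq> x" using IH(4) that by auto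
        ultimately show ?thesis using cyclic_on_cong[of xs f' f] by auto
      qed
      moreover have "chain_on f zs" if "zs \<in> set T1 \<union> set T2" for zs
      proof (rule chain_on_cong[of zs f'])
        show "f' x = f x" if "x \<in> set zs" for x
          using that jT[OF \<open>zs \<in> set T1 \<union> set T2\<close>] by (auto simp: f'_def)
        show "zs \<noteq> []" using IH(1) that by (auto simp: T)
        show "chain_on f' zs" using IH(5) that by (auto simp: T)
      qed
      moreover have "set (concat (Ks @ T1 @ (ys @ [p]) # T2)) = U"
      proof -
        have "set (concat (Ks @ T1 @ (ys @ [p]) # T2)) = insert p (set (concat (Ks @ Ts)))" by (auto simp: T)
        moreover have "insert p U' = U" using 2 by (auto simp: U'_def)
        ultimately show ?thesis by (simp only: IH(3))
      qed
      moreover have "p \<notin> set (concat (Ks @ Ts))" unfolding IH(3) U'_def by simp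
      hence "distinct (concat (Ks @ T1 @ (ys @ [p]) # T2))" using IH(2) by (auto simp: T)
      moreover have "[] \<notin> set (Ks @ T1 @ (ys @ [p]) # T2)" using IH(1) by (simp add: T)
      ultimately show ?thesis
        by (intro exI[of _ Ks] exI[of _ "T1 @ (ys @ [p]) # T2"] conjI) auto
    qed
  next
    case 3
    have "inj_on f U" using tame 3 by (intro inj_onI) blast
    moreover obtain x where "x \<in> U" using 3 by blast
    ultimately obtain xs where xs: "xs \<noteq> []" "distinct xs" "set xs \<subseteq> U" "cyclic_on f xs"
      "f ` (U - set xs) \<subseteq> U - set xs"
      using bij_cycle_exists less.prems(1) fU by metis
    have "card (U - set xs) < card U" "finite (U - set xs)"
      using xs less.prems(1) by (auto intro!: psubset_card_mono simp: neq_Nil_conv)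
    moreover have "tame_on (U - set xs) f" using xs(5) tame by (auto simp: tame_on_def)
    ultimately obtain Ks Ts where IH: "[] \<notin> set (Ks @ Ts)" "distinct (concat (Ks @ Ts))"
        "set (concat (Ks @ Ts)) = U - set xs" "\<forall>xs\<in>set Ks. cyclic_on f xs \<and> (\<forall>x\<in>set xs. f x \<noteq> x)"
        "\<forall>xs\<in>set Ts. chain_on f xs"
      using less.hyps by blast
    have "set (concat ((xs # Ks) @ Ts)) = set xs \<union> set (concat (Ks @ Ts))" by simp
    hence "set (concat ((xs # Ks) @ Ts)) = U"
      unfolding IH(3) using xs(3) by blast
    moreover have "set xs \<inter> set (concat (Ks @ Ts)) = {}" unfolding IH(3) by blast
    hence "distinct (concat ((xs # Ks) @ Ts))" using IH(2) xs(2) by auto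
    moreover have "\<forall>x\<in>set xs. f x \<noteq> x" using xs(3) 3 by blast
    ultimately show ?thesis
      using IH(1,4,5) xs(1,4) by (intro exI[of _ "xs # Ks"] exI[of _ Ts] conjI) simp_all
  qed
qed

definition graph_poly :: "nat \<Rightarrow> ('n::finite \<Rightarrow> 'n) \<Rightarrow> 'n cpoly" where
  "graph_poly d f = (\<Sum>i\<in>UNIV. X i ^ (d - 1) * X (f i))"

lemma K_poly_cyclic: "cyclic_on f xs \<Longrightarrow> K_poly d xs = (\<Sum>x\<leftarrow>xs. X x ^ (d - 1) * X (f x))"
  by (simp add: K_poly_def cyclic_on_def sum_list_sum_nth atLeast0LessThan)

lemma T_poly_chain:
  assumes "chain_on f xs" "xs \<noteq> []" "d > 0"
  shows "T_poly d xs = (\<Sum>x\<leftarrow>xs. X x ^ (d - 1) * X (f x))"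
proof -
  obtain n where n: "length xs = Suc n" using assms(2) by (cases xs) auto
  have "X (xs ! n) ^ (d - 1) * X (f (xs ! n)) = X (last xs) ^ d"
    using assms n by (simp add: chain_on_def last_conv_nth power_eq_if mult.commute)
  thus ?thesis
    using assms n by (simp add: T_poly_def chain_on_def sum_list_sum_nth atLeast0LessThan)
qed

lemma grad_graph_poly:
  "grad i (graph_poly d f) v =
     of_nat (d - 1) * (v $ i) ^ (d - 2) * v $ (f i) + (\<Sum>j | f j = i. (v $ j) ^ (d - 1))"
proof -
  have "grad i (X j ^ (d - 1) * X (f j)) v =
      (if i = j then of_nat (d - 1) * (v $ i) ^ (d - 2) * v $ (f i) else 0) + (if f j = i then (v $ j) ^ (d - 1) else 0)" for j
    by (auto simp: grad_mult grad_power grad_X poly_eval_power numeral_2_eq_2)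
  thus ?thesis
    by (simp add: graph_poly_def grad_sum sum.distrib sum.If_cases)
qed

text \<open>At a critical point the values \<open>a\<^sub>i\<close> of the monomials satisfy \<open>(d - 1) a\<^sub>i + (\<Sum>j | f j = i. a\<^sub>j) = 0\<close>;
  summing the norms over \<open>i\<close> shows that all of them vanish.\<close>

lemma smooth_graph_poly:
  assumes "d \<ge> 3" "tame_on UNIV f"
  shows "smooth_poly (graph_poly d f)"
  unfolding smooth_poly_iff
proof (intro allI iffI)
  fix v :: "complex^'a" and i
  assume "v = 0"
  thus "grad i (graph_poly d f) v = 0" using assms(1) by (simp add: grad_graph_poly)
next
  fix v :: "complex^'a"
  assume g: "\<forall>i. grad i (graph_poly d f) v = 0"
  define a where "a i = (v $ i) ^ (d - 1) * v $ (f i)" for i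
  have pow: "(v $ i) ^ (d - 2) * v $ i = (v $ i) ^ (d - 1)" for i
    using assms(1) by (simp flip: power_Suc2 add: Suc_diff_Suc numeral_2_eq_2)
  have lin: "of_nat (d - 1) * a i + (\<Sum>j | f j = i. a j) = 0" for i
  proof -
    have "(\<Sum>j | f j = i. a j) = (\<Sum>j | f j = i. (v $ j) ^ (d - 1)) * v $ i"
      by (simp add: a_def sum_distrib_right)
    moreover have "a i = (v $ i) ^ (d - 2) * v $ f i * v $ i"
      unfolding a_def pow[symmetric] by (simp add: mult_ac)
    ultimately have "of_nat (d - 1) * a i + (\<Sum>j | f j = i. a j) = grad i (graph_poly d f) v * v $ i"
      by (simp add: grad_graph_poly distrib_left distrib_right mult_ac)
    thus ?thesis using g by simp
  qed
  have "(d - 1) * (\<Sum>i\<in>UNIV. norm (a i)) = (\<Sum>i\<in>UNIV. norm (\<Sum>j | f j = i. a j))"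
    unfolding sum_distrib_left
  proof (rule sum.cong)
    fix i
    have "norm (\<Sum>j | f j = i. a j) = norm (of_nat (d - 1) * a i)"
      using lin[of i] by (metis add_eq_0_iff norm_minus_cancel)
    thus "real (d - 1) * norm (a i) = norm (\<Sum>j | f j = i. a j)"
      by (simp only: norm_mult norm_of_nat)
  qed simp
  also have "\<dots> \<le> (\<Sum>i\<in>UNIV. \<Sum>j | f j = i. norm (a j))"
    by (intro sum_mono norm_sum)
  also have "\<dots> = (\<Sum>j\<in>UNIV. norm (a j))"
    using sum.group[of UNIV UNIV f "\<lambda>j. norm (a j)"] by simp
  \<comment> \<open>Each vertex lies in exactly one fibre of \<open>f\<close>, so d - 1 times the
    total norm is at most the total norm, while d - 1 > 1.\<close>
  finally have "(real (d - 1) - 1) * (\<Sum>i\<in>UNIV. norm (a i)) \<le> 0"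
    by (simp add: algebra_simps)
  moreover have "real (d - 1) - 1 > 0" using assms(1) by simp
  ultimately have "(\<Sum>i\<in>UNIV. norm (a i)) \<le> 0"
    by (meson mult_le_0_iff not_less)
  moreover have "norm (a i) \<le> (\<Sum>i\<in>UNIV. norm (a i))" for i
    by (rule member_le_sum) auto
  ultimately have a0: "a i = 0" for i
    by (metis norm_le_zero_iff order.trans)
  have loop: "v $ j = 0" if "f j = j" for j
    using a0[of j] that by (auto simp: a_def)
  \<comment> \<open>For a non-loop \<open>j\<close> the derivative by x_(f j) reduces to v_j^(d-1):
    its first term vanishes together with \<open>a (f j)\<close>, and by tameness the other
    preimages of f j are loops, where \<open>v\<close> is already 0.\<close>
  have "v $ j = 0" for j
  proof (cases "f j = j")
    case False
    define i where "i = f j"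
    have other: "v $ j' = 0" if "f j' = i" "j' \<noteq> j" for j'
      using tame_onD[OF assms(2), of j' j] that False loop by (auto simp: i_def)
    have "(\<Sum>j' | f j' = i. (v $ j') ^ (d - 1)) = (\<Sum>j'\<in>{j}. (v $ j') ^ (d - 1))"
      by (rule sum.mono_neutral_right) (use other assms(1) in \<open>auto simp: i_def\<close>)
    moreover have "of_nat (d - 1) * (v $ i) ^ (d - 2) * v $ (f i) = 0"
      using a0[of i] assms(1) by (auto simp: a_def)
    ultimately have "(v $ j) ^ (d - 1) = 0"
      using g[rule_format, of i] by (simp only: grad_graph_poly) simp
    thus ?thesis using power_eq_0_iff by blast
  qed (rule loop)
  thus "v = 0" by (simp add: vec_eq_iff)
qed

lemma homogeneous_X_power_mult: "d > 0 \<Longrightarrow> homogeneous d (X i ^ (d - 1) * X j)"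
  using homogeneous_mult[OF homogeneous_power[OF homogeneous_X, of "d - 1" i] homogeneous_X[of j]] by simp

lemma simple_graph_poly:
  assumes "d \<ge> 3" "tame_on UNIV f"
  shows "simple_poly d (graph_poly d f)"
proof -
  let ?g = "\<lambda>x. X x ^ (d - 1) * X (f x)"
  obtain Ks Ts where dec: "[] \<notin> set (Ks @ Ts)" "distinct (concat (Ks @ Ts))" "set (concat (Ks @ Ts)) = UNIV"
    "\<forall>xs\<in>set Ks. cyclic_on f xs" "\<forall>xs\<in>set Ts. chain_on f xs"
    using tame_decomposition[OF _ assms(2)] by auto
  have concat: "(\<Sum>xs\<leftarrow>xss. \<Sum>x\<leftarrow>xs. h x) = (\<Sum>x\<leftarrow>concat xss. h x)" for xss and h :: "'a \<Rightarrow> 'a cpoly"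
    by (induction xss) simp_all
  have "(\<Sum>xs\<leftarrow>Ks. K_poly d xs) = (\<Sum>xs\<leftarrow>Ks. \<Sum>x\<leftarrow>xs. ?g x)"
    using dec(4) by (intro arg_cong[where f = sum_list] map_cong refl K_poly_cyclic) auto
  moreover have "(\<Sum>xs\<leftarrow>Ts. T_poly d xs) = (\<Sum>xs\<leftarrow>Ts. \<Sum>x\<leftarrow>xs. ?g x)"
    using dec(1,5) assms(1) by (intro arg_cong[where f = sum_list] map_cong refl T_poly_chain) auto
  ultimately have "(\<Sum>xs\<leftarrow>Ks. K_poly d xs) + (\<Sum>xs\<leftarrow>Ts. T_poly d xs) = (\<Sum>x\<leftarrow>concat (Ks @ Ts). ?g x)"
    by (simp add: concat)
  also have "\<dots> = (\<Sum>x\<in>set (concat (Ks @ Ts)). ?g x)"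
    by (rule sum_list_distinct_conv_sum_set[OF dec(2)])
  also have "\<dots> = graph_poly d f"
    by (simp only: dec(3) graph_poly_def)
  finally have eq: "graph_poly d f = (\<Sum>xs\<leftarrow>Ks. K_poly d xs) + (\<Sum>xs\<leftarrow>Ts. T_poly d xs)" ..
  moreover have "homogeneous d (graph_poly d f)"
    unfolding graph_poly_def using assms(1) by (intro homogeneous_sum homogeneous_X_power_mult) simp
  ultimately show ?thesis
    unfolding simple_poly_def using smooth_graph_poly[OF assms] dec(1-3) by blast
qed

text \<open>The exponent of x_i is at least d - 1 >= 2 in the monomial of index \<open>i\<close> and
  at most 1 in any other. So the sum over a set in \<open>simple_set\<close> merges none of the
  summands of \<open>graph_poly\<close>.\<close>

lemma inj_graph_monomials:
  assumes "d \<ge> 3"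
  shows "inj (\<lambda>i. X i ^ (d - 1) * X (f i) :: 'n cpoly)"
proof (rule injI)
  fix i j :: 'n
  let ?m = "\<lambda>i. Poly_Mapping.single i (d - 1) + Poly_Mapping.single (f i) 1"
  assume "X i ^ (d - 1) * X (f i) = (X j ^ (d - 1) * X (f j) :: 'n cpoly)"
  hence "Poly_Mapping.single (?m i) (1 :: complex) = Poly_Mapping.single (?m j) 1"
    unfolding X_power by (simp add: X_def mult_single)
  hence "Poly_Mapping.lookup (Poly_Mapping.single (?m i) (1 :: complex)) (?m i)
       = Poly_Mapping.lookup (Poly_Mapping.single (?m j) 1) (?m i)"
    by simp
  hence "?m i = ?m j" by (simp add: lookup_single when_def split: if_splits)
  hence "Poly_Mapping.lookup (?m i) i = Poly_Mapping.lookup (?m j) i" by simp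
  thus "i = j" using assms by (auto simp: lookup_add lookup_single when_def split: if_splits)
qed

lemma simple_set_tame:
  assumes "d \<ge> 3" "tame_on UNIV f" "\<And>i. X i ^ (d - 1) * X (f i) \<in> S"
  shows "simple_set d S"
proof -
  let ?M = "range (\<lambda>i. X i ^ (d - 1) * X (f i))"
  have "\<Sum>?M = graph_poly d f"
    unfolding graph_poly_def by (subst sum.reindex[OF inj_graph_monomials[OF assms(1)]]) simp
  hence "simple_poly d (\<Sum>?M)" using simple_graph_poly[OF assms(1,2)] by simp
  moreover have "?M \<subseteq> S" using assms(3) by auto
  ultimately show ?thesis unfolding simple_set_def by (intro exI[of _ ?M]) simp
qed

section \<open>Combinatorics of four characters\<close>

text \<open>Here \<open>u\<close> lists the characters in additive notation, normalised so that a monomial belongs to the set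
  iff the sum of its four entries lies in \<open>K\<close>. The rows \<open>{m. q i i i m}\<close> are pairwise equal or disjoint,
  and members of a common row are interchangeable.\<close>

lemma no_tame_graph_cases:
  fixes u :: "'i::finite \<Rightarrow> 'v::ab_group_add" and K :: "'v set"
  defines "q \<equiv> \<lambda>w x y z. u w + u x + u y + u z \<in> K"
  assumes diff: "\<And>x y. x \<in> K \<Longrightarrow> y \<in> K \<Longrightarrow> x - y \<in> K"
    and card: "CARD('i) = 4"
    and point: "\<And>i. \<exists>j. q i i i j"
    and line: "\<And>i j l. distinct [i, j, l] \<Longrightarrow>
      q i i i i \<or> q i i i j \<or> q i i j j \<or> q j j j i \<or> q j j j j \<or>
      q i i i l \<or> q i i j l \<or> q j j i l \<or> q j j j l"
    and no_tame: "\<And>f. tame_on UNIV f \<Longrightarrow> \<exists>i. \<not> q i i i (f i)"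
  obtains i j k l where "distinct [i, j, k, l]" "q i i i k" "q j j j k"
    "(q k k k k \<and> q i i j j \<and> q l l l i) \<or> (q k k k k \<and> q i i j j \<and> q l l l l) \<or>
     (q l l l l \<and> q k k k l \<and> q i i j l) \<or> (q k k k i \<and> q l l l i \<and> q i i j l) \<or>
     (q k k k j \<and> q l l l j \<and> q i i j l)"
proof -
  note found = that
  have add: "x + y \<in> K" if "x \<in> K" "y \<in> K" for x y
    using diff[OF that(1) diff[OF diff[OF that(2) that(2)] that(2)]] by simp
  have exh: "x = i \<or> x = j \<or> x = k \<or> x = l" if "distinct [i, j, k, l]" for i j k l x :: 'i
  proof -
    have "{i, j, k, l} = UNIV" using that card by (intro card_subset_eq) auto
    thus ?thesis by blast
  qed
  have fourth: "\<exists>l. distinct [i, j, k, l]" if "distinct [i, j, k]" for i j k :: 'i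
  proof -
    have "card {i, j, k} < CARD('i)" using that card by auto
    hence "{i, j, k} \<noteq> UNIV" by auto
    thus ?thesis using that by auto
  qed
  \<comment> \<open>x_j^3 x_m = x_i^3 x_m / (x_i^3 x_k) * x_j^3 x_k.\<close>
  have row: "q j j j m" if "q i i i k" "q j j j k" "q i i i m" for i j k m
  proof -
    note K = that[unfolded q_def]
    show ?thesis using add[OF diff[OF K(3,1)] K(2)] by (simp add: q_def algebra_simps)
  qed
  have col: "q p p p m" if "q i i i k" "q i i i m" "q p p p k" for i k m p
  proof -
    note K = that[unfolded q_def]
    show ?thesis using add[OF diff[OF K(2,1)] K(3)] by (simp add: q_def algebra_simps)
  qed
  \<comment> \<open>Two members \<open>k\<close>, \<open>m\<close> of one row have
    \<open>u\<close>-values differing by an element of \<open>K\<close>, so every partner of x_k^3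
    is a partner of x_m^3.\<close>
  have dup: "q m m m x" if "q i i i k" "q i i i m" "q k k k x" for i k m x
  proof -
    have "(u i + u i + u i + u m) - (u i + u i + u i + u k) \<in> K"
      using diff that(1,2) unfolding q_def by blast
    hence d: "u m - u k \<in> K" by (simp add: algebra_simps)
    show ?thesis
      using add[OF add[OF d d] add[OF d that(3)[unfolded q_def]]] by (simp add: q_def algebra_simps)
  qed
  \<comment> \<open>A situation is refuted by naming a target for each of the four coordinates; the
    six implications are tameness, pair by pair.\<close>
  have nt: False
    if "distinct [i, j, k, l]" "q i i i p" "q j j j r" "q k k k s" "q l l l t"
      "p = r \<longrightarrow> p = i \<or> r = j" "p = s \<longrightarrow> p = i \<or> s = k" "p = t \<longrightarrow> p = i \<or> t = l"
      "r = s \<longrightarrow> r = j \<or> s = k" "r = t \<longrightarrow> r = j \<or> t = l" "s = t \<longrightarrow> s = k \<or> t = l"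
    for i j k l p r s t
  proof -
    define f where "f = (\<lambda>x. if x = i then p else if x = j then r else if x = k then s else t)"
    have f: "f i = p" "f j = r" "f k = s" "f l = t" using that(1) by (auto simp: f_def)
    have "f a = a \<or> f b = b" if "a \<noteq> b" "f a = f b" for a b
      using exh[OF \<open>distinct [i, j, k, l]\<close>, of a] exh[OF \<open>distinct [i, j, k, l]\<close>, of b] that
        \<open>p = r \<longrightarrow> p = i \<or> r = j\<close> \<open>p = s \<longrightarrow> p = i \<or> s = k\<close> \<open>p = t \<longrightarrow> p = i \<or> t = l\<close>
        \<open>r = s \<longrightarrow> r = j \<or> s = k\<close> \<open>r = t \<longrightarrow> r = j \<or> t = l\<close> \<open>s = t \<longrightarrow> s = k \<or> t = l\<close>
      by (elim disjE) (simp_all add: f, (metis+)?)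
    hence "tame_on UNIV f" by (simp add: tame_on_def)
    then obtain x where "\<not> q x x x (f x)" using no_tame by blast
    thus False using exh[OF that(1), of x] f that(2-5) by auto
  qed
  \<comment> \<open>Loops at \<open>i\<close> and \<open>k\<close>, with \<open>j\<close> sent to
    \<open>i\<close> and \<open>l\<close> anywhere but \<open>i\<close>, would be tame. The target
    of \<open>l\<close> can avoid \<open>i\<close> because a row containing \<open>i\<close> also
    contains \<open>k\<close>.\<close>
  have loop: False if a: "distinct [i, j, k, l]" "q i i i k" "q j j j k" "q i i i i" for i j k l
  proof -
    have "q j j j i" using row a(2-4) by blast
    moreover have "q k k k k" using dup a(2,4) by blast
    moreover obtain p where p: "q l l l p" "p \<noteq> i"
      using point[of l] col[OF a(4,2)] a(1) by auto
    ultimately show False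
      using nt[OF a(1,4), of i k p] p(2) a(1) by auto
  qed
  \<comment> \<open>Here \<open>i\<close> to \<open>k\<close>, \<open>j\<close> to \<open>l\<close>,
    with loops at \<open>k\<close> and \<open>l\<close>, would be tame.\<close>
  have dbl: False
    if "distinct [i, j, k, l]" "q i i i k" "q j j j k" "q i i i l" "q j j j l" "q k k k k" for i j k l
  proof -
    have "q k k k l" using col that(2,4,6) by blast
    hence "q l l l l" using dup that(2,4) by blast
    thus False using nt[OF that(1,2,5,6)] that(1) by auto
  qed
  \<comment> \<open>A second member of the row of \<open>i\<close> can only be \<open>l\<close>.
    Then \<open>k\<close> and \<open>l\<close> are interchangeable and have a single common target,
    \<open>i\<close> or \<open>j\<close>, so the pair \<open>k\<close>, \<open>l\<close> takes over
    the role of \<open>i\<close>, \<open>j\<close>.\<close>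
  have pair: "\<exists>i j k. distinct [i, j, k] \<and> q i i i k \<and> q j j j k \<and> (\<forall>m. q i i i m \<longrightarrow> m = k)"
  proof -
    obtain f where f: "\<And>i. q i i i (f i)" using point by metis
    hence "\<not> tame_on UNIV f" using no_tame by blast
    then obtain i j where ij: "i \<noteq> j" "f i = f j" "f i \<noteq> i" "f j \<noteq> j"
      by (auto simp: tame_on_def)
    define k where "k = f i"
    have D: "q i i i k" "q j j j k" using f[of i] f[of j] ij by (auto simp: k_def)
    have d3: "distinct [i, j, k]" using ij by (auto simp: k_def)
    then obtain l where d: "distinct [i, j, k, l]" using fourth[OF d3] by blast
    show ?thesis
    proof (cases "\<forall>m. q i i i m \<longrightarrow> m = k")
      case True
      thus ?thesis using D d3 by blast
    next
      case False
      then obtain m where m: "q i i i m" "m \<noteq> k" by blast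
      have "m \<noteq> i" using loop[OF d D] m by blast
      moreover have "m \<noteq> j" using loop[of j i k l] d D row[OF D m(1)] by auto
      ultimately have il: "q i i i l" using m exh[OF d, of m] by auto
      hence jl: "q j j j l" using row[OF D] by blast
      have kl: "q l l l p" if "q k k k p" for p using dup[OF D(1) il that] .
      have nk: "\<not> q k k k k" using dbl[OF d D il jl] by blast
      have nl: "\<not> q k k k l" using dbl[OF d D il jl] col[OF il D(1)] by blast
      \<comment> \<open>Otherwise i, k, j, l form a cycle of length 4, in this order.\<close>
      have nij: "\<not> (q k k k i \<and> q k k k j)"
        using nt[OF d D(1) jl, of j i] kl d by auto
      obtain p where p: "q k k k p" using point by blast
      have "p = i \<or> p = j" using exh[OF d, of p] p nk nl by auto
      moreover have "\<forall>m. q k k k m \<longrightarrow> m = p" using exh[OF d] p nk nl nij by metis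
      moreover have "distinct [k, l, p]" using d calculation(1) by auto
      ultimately show ?thesis using p kl[OF p] by blast
    qed
  qed
  then obtain i0 j0 k where base: "distinct [i0, j0, k]" "q i0 i0 i0 k" "q j0 j0 j0 k"
    "\<And>m. q i0 i0 i0 m \<Longrightarrow> m = k"
    by blast
  obtain l where d0: "distinct [i0, j0, k, l]" using fourth[OF base(1)] by blast
  have uniq: "m = k" if "q x x x k" "q x x x m" for x m
    using base(4)[OF row[OF that(1) base(2) that(2)]] .
  \<comment> \<open>Every monomial of \<open>line\<close> that contains a cube would give
    \<open>i\<close> or \<open>j\<close> a target other than \<open>k\<close>, against
    \<open>uniq\<close>.\<close>
  have line': "q i i j j \<or> q i i j l \<or> q j j i l"
    if "distinct [i, j, k, l]" "q i i i k" "q j j j k" for i j l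
  proof -
    have "i \<noteq> k" "j \<noteq> k" "l \<noteq> k" "distinct [i, j, l]" using that(1) by auto
    thus ?thesis using line[of i j l] uniq[OF that(2)] uniq[OF that(3)] by metis
  qed
  have two_two: thesis if d: "distinct [i, j, k, l]" and D: "q i i i k" "q j j j k" and B: "q i i j j" for i j
  proof -
    note K = D[unfolded q_def] B[unfolded q_def]
    \<comment> \<open>x_k^4 = (x_i^3 x_k)^2 (x_j^3 x_k)^2 / (x_i^2 x_j^2)^3.\<close>
    have kk: "q k k k k"
      using diff[OF diff[OF add[OF add[OF K(1,1)] add[OF K(2,2)]] add[OF K(3,3)]] K(3)]
      by (simp add: q_def algebra_simps)
    obtain p where p: "q l l l p" using point by blast
    consider "p = i" | "p = j" | "p = l" | "p = k" using exh[OF d, of p] by blast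
    thus thesis
    proof cases
      case 1
      thus ?thesis using found[OF d D] kk B p by blast
    next
      case 2
      have "q j j i i" using B by (simp add: q_def ac_simps)
      thus ?thesis using found[of j i k l] d D kk p 2 by auto
    next
      case 3
      thus ?thesis using found[OF d D] kk B p by blast
    next
      case 4
      \<comment> \<open>Three coordinates now have the target \<open>k\<close>. The lines joining
        \<open>l\<close> to \<open>i\<close> and to \<open>j\<close> make the values of
        \<open>u\<close> at \<open>i\<close>, \<open>j\<close>, \<open>l\<close> agree modulo
        \<open>K\<close>, which puts x_j^4 into the set, against \<open>uniq\<close>.\<close>
      have L: "q l l l k" using p 4 by simp
      have no: "\<not> q l l i j"
      proof
        assume "q l l i j"
        hence "q l l l l"
          using diff[OF add K(3), of "u l + u l + u i + u j" "u l + u l + u i + u j"]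
          by (simp add: q_def algebra_simps)
        thus False using uniq[OF L] d by auto
      qed
      have near: "u l - u j \<in> K"
        if "q i i j j" "q j j j k" "q i i l l \<or> q i i l j" for i j
      proof (cases "q i i l j")
        case True
        thus ?thesis
          using diff[of "u i + u i + u l + u j" "u i + u i + u j + u j"] that(1)
          by (simp add: q_def algebra_simps)
      next
        case False
        \<comment> \<open>x_l / x_j is the quotient of x_l^3 x_k / (x_j^3 x_k) by x_i^2 x_l^2 /
          (x_i^2 x_j^2).\<close>
        hence "(u l + u l + u l + u k) - (u j + u j + u j + u k)
            - ((u i + u i + u l + u l) - (u i + u i + u j + u j)) \<in> K"
          using that L by (intro diff) (simp_all add: q_def)
        thus ?thesis by (simp add: algebra_simps)
      qed
      have "q i i l l \<or> q i i l j"
        using line'[of i l j] d D L no by auto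
      hence lj: "u l - u j \<in> K" using near[of i j] B D by blast
      have "q j j l l \<or> q j j l i"
        using line'[of j l i] d D L no by (auto simp: q_def ac_simps)
      hence li: "u l - u i \<in> K" using near[of j i] B D by (auto simp: q_def ac_simps)
      have "(u i + u i + u j + u j) + ((u l - u i) - (u l - u j)) + ((u l - u i) - (u l - u j)) \<in> K"
        by (intro add diff lj li K)
      hence "q j j j j" by (simp add: q_def algebra_simps)
      thus ?thesis using uniq[OF D(2)] d by auto
    qed
  qed
  have two_one: thesis if d: "distinct [i, j, k, l]" and D: "q i i i k" "q j j j k" and B: "q i i j l" for i j
  proof -
    note K = D[unfolded q_def] B[unfolded q_def]
    \<comment> \<open>x_l^3 x_p = (x_i^2 x_j x_l)^3 (x_k^3 x_p) / ((x_i^3 x_k)^2 (x_j^3 x_k)). So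
      \<open>l\<close> inherits every target of \<open>k\<close>, and only the target of
      \<open>k\<close> has to be distinguished.\<close>
    have kl: "q l l l p" if "q k k k p" for p
      using add[OF diff[OF diff[OF add[OF add[OF K(3,3)] K(3)] add[OF K(1,1)]] K(2)] that[unfolded q_def]]
      by (simp add: q_def algebra_simps)
    obtain p where p: "q k k k p" using point by blast
    consider "p = i" | "p = j" | "p = l" | "p = k" using exh[OF d, of p] by blast
    thus thesis
    proof cases
      case 4
      \<comment> \<open>The line joining \<open>j\<close> and \<open>l\<close> now produces x_i^4,
        x_l^4 or x_i^3 x_j, and each contradicts the uniqueness of the target
        \<open>k\<close>.\<close>
      have L: "q l l l k" using kl p 4 by simp
      consider "q j j l l" | "q j j l i" | "q l l j i"
        using line'[of j l i] d D L by auto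
      hence False
      proof cases
        case 1
        hence "q i i i i"
          using diff[OF add[OF K(3,3)], of "u j + u j + u l + u l"] by (simp add: q_def algebra_simps)
        thus False using uniq[OF D(1)] d by auto
      next
        case 2
        have "q l l l l"
          using diff[OF add[OF L[unfolded q_def] diff[OF K(3,1)]] diff[OF 2[unfolded q_def] K(3)]]
          by (simp add: q_def algebra_simps)
        thus False using uniq[OF L] d by auto
      next
        case 3
        hence "q i i i j"
          using diff[OF add[OF K(3,3)], of "u l + u l + u j + u i"] by (simp add: q_def algebra_simps)
        thus False using uniq[OF D(1)] d by auto
      qed
      thus ?thesis ..
    qed (use found[OF d D] B p kl in auto)
  qed
  have "distinct [j0, i0, k, l]" using d0 by auto
  thus thesis
    using line'[OF d0 base(2,3)] two_two[OF d0 base(2,3)] two_one[OF d0 base(2,3)]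
      two_one[of j0 i0] base(2,3) by blast
qed

section \<open>Monomials forced by smoothness\<close>

lemma grad_eq_sum:
  "grad j p v = (\<Sum>m\<in>Poly_Mapping.keys p. of_nat (Poly_Mapping.lookup m j) * Poly_Mapping.lookup p m *
     (\<Prod>k\<in>UNIV. (v $ k) ^ Poly_Mapping.lookup (m - Poly_Mapping.single j 1) k))"
  by (simp add: grad_def partial_deriv_def poly_eval_sum poly_eval_single)

text \<open>Every term of the derivative keeps a variable that vanishes on the coordinate subspace
  of \<open>J\<close>.\<close>

lemma grad_eq_0_on_subspace:
  assumes "\<And>k. k \<notin> J \<Longrightarrow> v $ k = 0"
    and "\<And>m. m \<in> Poly_Mapping.keys p \<Longrightarrow> Poly_Mapping.lookup m j > 0 \<Longrightarrow>
      \<exists>k. k \<notin> J \<and> Poly_Mapping.lookup (m - Poly_Mapping.single j 1) k > 0"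
  shows "grad j p v = 0"
  unfolding grad_eq_sum
proof (rule sum.neutral, rule ballI)
  fix m assume m: "m \<in> Poly_Mapping.keys p"
  show "of_nat (Poly_Mapping.lookup m j) * Poly_Mapping.lookup p m *
     (\<Prod>k\<in>UNIV. (v $ k) ^ Poly_Mapping.lookup (m - Poly_Mapping.single j 1) k) = 0"
  proof (cases "Poly_Mapping.lookup m j > 0")
    case True
    then obtain k where "k \<notin> J" "Poly_Mapping.lookup (m - Poly_Mapping.single j 1) k > 0"
      using assms(2) m by blast
    hence "(v $ k) ^ Poly_Mapping.lookup (m - Poly_Mapping.single j 1) k = 0"
      using assms(1) by simp
    hence "(\<Prod>k\<in>UNIV. (v $ k) ^ Poly_Mapping.lookup (m - Poly_Mapping.single j 1) k) = 0"
      by (meson UNIV_I finite prod_zero)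
    thus ?thesis by simp
  qed simp
qed

text \<open>Otherwise the whole gradient vanishes at the \<open>i\<close>-th coordinate point, where
  only the terms x_i^(d-1) of the derivatives survive.\<close>

lemma smooth_point_monomial:
  assumes "smooth_poly p" "homogeneous d p"
  obtains j where "Poly_Mapping.single i (d - 1) + Poly_Mapping.single j 1 \<in> Poly_Mapping.keys p"
proof (rule ccontr)
  assume "\<not> thesis"
  hence no: "Poly_Mapping.single i (d - 1) + Poly_Mapping.single j 1 \<notin> Poly_Mapping.keys p" for j
    using that by blast
  have "grad j p (axis i 1) = 0" for j
  proof (rule grad_eq_0_on_subspace[where J = "{i}"])
    fix m assume m: "m \<in> Poly_Mapping.keys p" "Poly_Mapping.lookup m j > 0"
    define m' where "m' = m - Poly_Mapping.single j 1"
    have mm': "m = m' + Poly_Mapping.single j 1"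
      using m(2) by (intro poly_mapping_eqI) (auto simp: m'_def lookup_add lookup_minus lookup_single when_def)
    show "\<exists>k. k \<notin> {i} \<and> Poly_Mapping.lookup (m - Poly_Mapping.single j 1) k > 0"
    proof (rule ccontr)
      assume "\<not> ?thesis"
      hence "m' = Poly_Mapping.single i (Poly_Mapping.lookup m' i)"
        by (intro poly_mapping_eqI) (auto simp: m'_def lookup_single when_def)
      then obtain c where c: "m' = Poly_Mapping.single i c" by blast
      have "(\<Sum>k\<in>UNIV. Poly_Mapping.lookup m k) = d"
        using assms(2) m(1) by (simp add: homogeneous_def)
      hence "c = d - 1"
        by (simp add: mm' c lookup_add sum.distrib lookup_single when_def)
      thus False using no[of j] m(1) mm' c by simp
    qed
  qed (auto simp: axis_def)
  hence "axis i (1 :: complex) = 0" using assms(1) unfolding smooth_poly_iff by blast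
  thus False by (simp add: axis_eq_0_iff)
qed

text \<open>Dehomogenise with y = 1. A nonconstant polynomial has a root by the fundamental theorem
  of algebra; if it is constant, the coefficient of x^e is 0 because e > 0, and (1, 0) is a
  zero.\<close>

lemma binary_form_root:
  fixes c :: "'a \<Rightarrow> complex"
  assumes "finite T" "e > 0" "\<And>m. m \<in> T \<Longrightarrow> a m \<le> e"
  obtains x y where "(x, y) \<noteq> (0, 0)" "(\<Sum>m\<in>T. c m * (x ^ a m * y ^ (e - a m))) = 0"
proof -
  define Q where "Q = (\<Sum>m\<in>T. monom (c m) (a m))"
  have Q: "poly Q x = (\<Sum>m\<in>T. c m * (x ^ a m * 1 ^ (e - a m)))" for x
    by (simp add: Q_def poly_sum poly_monom)
  show ?thesis
  proof (cases "degree Q = 0")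
    case True
    have "(\<Sum>m\<in>T. c m * (1 ^ a m * 0 ^ (e - a m))) = coeff Q e"
      unfolding Q_def coeff_sum using assms(3)
      by (intro sum.cong) (auto simp: power_0_left le_antisym)
    also have "\<dots> = 0" using True assms(2) by (intro coeff_eq_0) simp
    finally show ?thesis using that[of 1 0] by simp
  next
    case False
    then obtain x where "poly Q x = 0"
      using fundamental_theorem_of_algebra[of Q] constant_degree[of Q] by auto
    thus ?thesis using that[of x 1] Q by simp
  qed
qed

text \<open>If every monomial were divisible by x_k or by x_l^2, then on the line x_k = x_l = 0 only
  the derivative by x_k could be nonzero; it is a binary form of degree d - 1 there and has a zero,
  a singular point. Exchanging \<open>k\<close> and \<open>l\<close> treats the other normal
  direction.\<close>

lemma smooth_line_monomial:
  fixes p :: "('n::finite) cpoly"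
  assumes smooth: "smooth_poly p" and hom: "homogeneous d p" and d: "d \<ge> 2"
    and ijkl: "distinct [i, j, k, l]" "UNIV = {i, j, k, l}"
  obtains m where "m \<in> Poly_Mapping.keys p" "Poly_Mapping.lookup m k = 0" "Poly_Mapping.lookup m l \<le> 1"
proof (rule ccontr)
  assume "\<not> thesis"
  hence no: "Poly_Mapping.lookup m k > 0 \<or> Poly_Mapping.lookup m l > 1" if "m \<in> Poly_Mapping.keys p" for m
    using that \<open>\<And>m. m \<in> Poly_Mapping.keys p \<Longrightarrow> _ \<Longrightarrow> _ \<Longrightarrow> thesis\<close> by (meson not_gr_zero not_less)
  have d4: "i \<noteq> j" "k \<noteq> i" "k \<noteq> j" "l \<noteq> i" "l \<noteq> j" "l \<noteq> k" using ijkl(1) by auto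
  \<comment> \<open>The monomials that contribute to the derivative by x_k on the line.\<close>
  define T where "T = {m \<in> Poly_Mapping.keys p. Poly_Mapping.lookup m k = 1 \<and> Poly_Mapping.lookup m l = 0}"
  define a where "a m = Poly_Mapping.lookup m i" for m :: "'n \<Rightarrow>\<^sub>0 nat"
  have prod4: "(\<Prod>x\<in>UNIV. h x) = h i * h j * h k * h l" for h :: "'n \<Rightarrow> complex"
    using ijkl(1) by (subst ijkl(2)) (simp add: mult_ac)
  have sum4: "(\<Sum>x\<in>UNIV. h x) = h i + h j + h k + h l" for h :: "'n \<Rightarrow> nat"
    using ijkl(1) by (subst ijkl(2)) simp
  have deg: "Poly_Mapping.lookup m i + Poly_Mapping.lookup m j + Poly_Mapping.lookup m k + Poly_Mapping.lookup m l = d"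
    if "m \<in> Poly_Mapping.keys p" for m
    using hom that by (simp add: homogeneous_def flip: sum4)
  have "finite T" by (simp add: T_def)
  moreover have "a m \<le> d - 1" if "m \<in> T" for m
    using that deg[of m] by (simp add: T_def a_def)
  ultimately obtain x y where xy: "(x, y) \<noteq> (0, 0)"
    "(\<Sum>m\<in>T. Poly_Mapping.lookup p m * (x ^ a m * y ^ (d - 1 - a m))) = 0"
    using binary_form_root[of T "d - 1" a "Poly_Mapping.lookup p"] d by auto
  define v where "v = (\<chi> t. if t = i then x else if t = j then y else 0)"
  have v: "v $ i = x" "v $ j = y" "v $ k = 0" "v $ l = 0" using d4 by (simp_all add: v_def)
  have v0: "v $ t = 0" if "t \<notin> {i, j}" for t using that by (simp add: v_def)
  have "grad t p v = 0" if "t \<in> {i, j, l}" for t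
  proof (rule grad_eq_0_on_subspace[where J = "{i, j}"])
    fix m assume m: "m \<in> Poly_Mapping.keys p" "Poly_Mapping.lookup m t > 0"
    show "\<exists>k. k \<notin> {i, j} \<and> Poly_Mapping.lookup (m - Poly_Mapping.single t 1) k > 0"
    proof (cases "Poly_Mapping.lookup m k > 0")
      case True
      thus ?thesis using that d4 by (intro exI[of _ k]) (auto simp: lookup_minus lookup_single when_def)
    next
      case False
      thus ?thesis using no[OF m(1)] d4 by (intro exI[of _ l]) (auto simp: lookup_minus lookup_single when_def)
    qed
  qed (rule v0)
  moreover have "grad k p v = 0"
  proof -
    have "grad k p v = (\<Sum>m\<in>T. of_nat (Poly_Mapping.lookup m k) * Poly_Mapping.lookup p m *
       (\<Prod>t\<in>UNIV. (v $ t) ^ Poly_Mapping.lookup (m - Poly_Mapping.single k 1) t))"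
      unfolding grad_eq_sum
    proof (rule sum.mono_neutral_right)
      show "\<forall>m\<in>Poly_Mapping.keys p - T. of_nat (Poly_Mapping.lookup m k) * Poly_Mapping.lookup p m *
       (\<Prod>t\<in>UNIV. (v $ t) ^ Poly_Mapping.lookup (m - Poly_Mapping.single k 1) t) = 0"
        using d4 by (auto simp: T_def prod4 v lookup_minus lookup_single power_0_left)
    qed (auto simp: T_def)
    also have "\<dots> = (\<Sum>m\<in>T. Poly_Mapping.lookup p m * (x ^ a m * y ^ (d - 1 - a m)))"
    proof (rule sum.cong[OF refl])
      fix m assume m: "m \<in> T"
      have "Poly_Mapping.lookup m j = d - 1 - a m"
        using deg[of m] m by (simp add: T_def a_def)
      thus "of_nat (Poly_Mapping.lookup m k) * Poly_Mapping.lookup p m *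
          (\<Prod>t\<in>UNIV. (v $ t) ^ Poly_Mapping.lookup (m - Poly_Mapping.single k 1) t)
        = Poly_Mapping.lookup p m * (x ^ a m * y ^ (d - 1 - a m))"
        using d4 m by (simp add: T_def prod4 v lookup_minus lookup_single when_def a_def)
    qed
    finally show ?thesis using xy(2) by simp
  qed
  ultimately have "\<forall>t. grad t p v = 0"
    using ijkl(2) by (metis UNIV_I insertE insertI1 insertI2 singletonD)
  hence "v = 0" using smooth by (simp add: smooth_poly_iff)
  thus False using v xy(1) by simp
qed

text \<open>A word in four letters. Since letters may coincide, one lemma covers all shapes of
  quartic monomials; the same monomial has several spellings.\<close>

definition quad :: "'n \<Rightarrow> 'n \<Rightarrow> 'n \<Rightarrow> 'n \<Rightarrow> ('n \<Rightarrow>\<^sub>0 nat)" where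
  "quad w x y z = Poly_Mapping.single w 1 + Poly_Mapping.single x 1 + Poly_Mapping.single y 1 + Poly_Mapping.single z 1"

lemma lookup_quad:
  "Poly_Mapping.lookup (quad w x y z) t =
     of_bool (w = t) + of_bool (x = t) + of_bool (y = t) + of_bool (z = t)"
  by (simp add: quad_def lookup_add lookup_single when_def)

lemma monomial_quad: "X w * X x * X y * X z = Poly_Mapping.single (quad w x y z) 1"
  by (simp add: X_def quad_def mult_single)

lemma smooth_quartic_point:
  assumes "smooth_poly p" "homogeneous 4 p"
  obtains j where "quad i i i j \<in> Poly_Mapping.keys p"
proof -
  obtain j where "Poly_Mapping.single i (4 - 1) + Poly_Mapping.single j 1 \<in> Poly_Mapping.keys p"
    using smooth_point_monomial[OF assms] .
  moreover have "Poly_Mapping.single i (4 - 1) + Poly_Mapping.single j 1 = quad i i i j"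
    by (simp add: quad_def numeral_3_eq_3 flip: single_add)
  ultimately show ?thesis using that by metis
qed

lemma smooth_quartic_line:
  assumes "smooth_poly p" "homogeneous 4 p" "distinct [i, j, k, l]" "UNIV = {i, j, k, l}"
  shows "\<exists>m\<in>{quad i i i i, quad i i i j, quad i i j j, quad j j j i, quad j j j j,
      quad i i i l, quad i i j l, quad j j i l, quad j j j l}. m \<in> Poly_Mapping.keys p"
proof -
  obtain m where m: "m \<in> Poly_Mapping.keys p" "Poly_Mapping.lookup m k = 0" "Poly_Mapping.lookup m l \<le> 1"
    using smooth_line_monomial[OF assms(1,2) _ assms(3,4)] by auto
  let ?a = "Poly_Mapping.lookup m i" and ?b = "Poly_Mapping.lookup m j"
  have "(\<Sum>x\<in>UNIV. Poly_Mapping.lookup m x) = ?a + ?b + Poly_Mapping.lookup m k + Poly_Mapping.lookup m l"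
    using assms(3) by (subst assms(4)) simp
  hence deg: "?a + ?b + Poly_Mapping.lookup m l = 4"
    using assms(2) m by (simp add: homogeneous_def)
  have "(Poly_Mapping.lookup m l = 0 \<and> (?a, ?b) \<in> {(4,0), (3,1), (2,2), (1,3), (0,4)}) \<or>
        (Poly_Mapping.lookup m l = 1 \<and> (?a, ?b) \<in> {(3,0), (2,1), (1,2), (0,3)})"
    using deg m(3) by (simp, presburger)
  hence "\<exists>n\<in>{quad i i i i, quad i i i j, quad i i j j, quad j j j i, quad j j j j,
      quad i i i l, quad i i j l, quad j j i l, quad j j j l}.
      \<forall>t\<in>{i, j, k, l}. Poly_Mapping.lookup m t = Poly_Mapping.lookup n t"
    using assms(3) m(2) by (elim disjE conjE insertE) (auto simp: lookup_quad)
  then obtain n where n: "n \<in> {quad i i i i, quad i i i j, quad i i j j, quad j j j i, quad j j j j,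
      quad i i i l, quad i i j l, quad j j i l, quad j j j l}"
    and eq: "\<forall>t\<in>{i, j, k, l}. Poly_Mapping.lookup m t = Poly_Mapping.lookup n t"
    by blast
  have "m = n"
    using eq unfolding assms(4)[symmetric] by (intro poly_mapping_eqI) simp
  thus ?thesis using n m(1) by blast
qed

section \<open>Diagonal subgroups of the projective linear group\<close>

lemma mat_mult_mat: "mat c ** mat d = (mat (c * d) :: 'a::comm_semiring_1^'n^'n)"
  by (simp add: vec_eq_iff matrix_matrix_mult_def mat_def if_distrib[of "\<lambda>x. x * _"] if_distrib[of "\<lambda>x. _ * x"] sum.delta cong: if_cong)

lemma mat_mult_nth: "(mat c ** A) $ i $ j = c * (A :: 'a::comm_semiring_1^'n^'n) $ i $ j"
  by (simp add: matrix_matrix_mult_def mat_def if_distrib[of "\<lambda>x. x * _"] sum.delta cong: if_cong)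

lemma mat_mult_commute: "A ** mat c = mat c ** (A :: 'a::comm_semiring_1^'n^'n)"
  by (simp add: vec_eq_iff mat_mult_nth)
    (simp add: matrix_matrix_mult_def mat_def if_distrib[of "\<lambda>x. _ * x"] sum.delta' mult.commute cong: if_cong)

lemma mat_mult_vec: "(mat c ** A) *v v = c *s ((A :: 'a::comm_semiring_1^'n^'n) *v v)"
  by (simp add: vec_eq_iff matrix_vector_mult_def mat_mult_nth sum_distrib_left mult.assoc)

lemma invertible_mat: "c \<noteq> 0 \<Longrightarrow> invertible (mat c :: 'a::field^'n^'n)"
  unfolding invertible_def by (rule exI[of _ "mat (inverse c)"]) (simp add: mat_mult_mat)

lemma invertible_mat_1 [simp]: "invertible (mat 1 :: 'a::semiring_1^'n^'n)"
  unfolding invertible_def by (rule exI[of _ "mat 1"]) simp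

lemma matrix_inv_mult:
  assumes "invertible (A :: 'a::semiring_1^'n^'n)"
  shows "matrix_inv A ** A = mat 1" "A ** matrix_inv A = mat 1"
  using someI_ex[OF assms[unfolded invertible_def]] by (simp_all add: matrix_inv_def)

lemma invertible_matrix_inv: "invertible (A :: 'a::semiring_1^'n^'n) \<Longrightarrow> invertible (matrix_inv A)"
  unfolding invertible_def[of "matrix_inv A"] by (rule exI[of _ A]) (simp add: matrix_inv_mult)

lemma GL_simps [simp]: "carrier GL = {A. invertible A}" "mult GL = (**)" "one GL = mat 1"
  by (simp_all add: GL_def)

lemma group_GL: "group (GL :: (complex^'n^'n) monoid)"
proof (rule groupI)
  fix A :: "complex^'n^'n" assume "A \<in> carrier GL"
  thus "\<exists>B\<in>carrier GL. B \<otimes>\<^bsub>GL\<^esub> A = \<one>\<^bsub>GL\<^esub>"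
    using invertible_matrix_inv matrix_inv_mult by (intro bexI[of _ "matrix_inv A"]) auto
qed (auto simp: invertible_mult matrix_mul_assoc)

lemma subgroup_scalars: "subgroup scalars (GL :: (complex^'n^'n) monoid)"
proof (rule group.subgroupI[OF group_GL])
  show "scalars \<subseteq> carrier (GL :: (complex^'n^'n) monoid)"
    by (auto simp: scalars_def invertible_mat)
  show "scalars \<noteq> {}" by (auto simp: scalars_def intro: exI[of _ 1])
next
  fix A :: "complex^'n^'n" assume "A \<in> scalars"
  then obtain c where c: "A = mat c" "c \<noteq> 0" by (auto simp: scalars_def)
  have "inv\<^bsub>GL\<^esub> A = mat (inverse c)"
    using c by (intro group.inv_equality[OF group_GL]) (simp_all add: mat_mult_mat invertible_mat)
  thus "inv\<^bsub>GL\<^esub> A \<in> scalars" using c by (auto simp: scalars_def)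
next
  fix A B :: "complex^'n^'n" assume "A \<in> scalars" "B \<in> scalars"
  thus "A \<otimes>\<^bsub>GL\<^esub> B \<in> scalars" by (auto simp: scalars_def mat_mult_mat)
qed

lemma normal_scalars: "normal scalars (GL :: (complex^'n^'n) monoid)"
  by (rule group.normalI[OF group_GL subgroup_scalars])
    (auto simp: r_coset_def l_coset_def scalars_def mat_mult_commute)

lemma group_PGL: "group (PGL :: ('n::finite) pgl monoid)"
  unfolding PGL_def by (rule normal.factorgroup_is_group[OF normal_scalars])

lemma pgl_class_eq: "pgl_class A = {mat c ** A | c. c \<noteq> 0}"
  by (auto simp: pgl_class_def r_coset_def scalars_def)

lemma carrier_PGL: "carrier PGL = pgl_class ` {A. invertible A}"
  by (auto simp: PGL_def carrier_FactGroup pgl_class_def)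

lemma pgl_class_mult:
  "invertible A \<Longrightarrow> invertible B \<Longrightarrow> pgl_class A \<otimes>\<^bsub>PGL\<^esub> pgl_class B = pgl_class (A ** B)"
  unfolding PGL_def pgl_class_def using normal.rcos_sum[OF normal_scalars, of A B] by simp

lemma pgl_class_one: "\<one>\<^bsub>PGL\<^esub> = pgl_class (mat 1)"
  by (auto simp: PGL_def pgl_class_eq scalars_def)

lemma pgl_class_eq_iff: "pgl_class A = pgl_class B \<longleftrightarrow> (\<exists>c. c \<noteq> 0 \<and> A = mat c ** B)"
proof
  assume "pgl_class A = pgl_class B"
  moreover have "A \<in> pgl_class A" by (auto simp: pgl_class_eq intro: exI[of _ 1])
  ultimately show "\<exists>c. c \<noteq> 0 \<and> A = mat c ** B" by (auto simp: pgl_class_eq)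
next
  assume "\<exists>c. c \<noteq> 0 \<and> A = mat c ** B"
  then obtain c where c: "c \<noteq> 0" "A = mat c ** B" by blast
  have "mat x ** A = mat (x * c) ** B" "mat x ** B = mat (x / c) ** A" for x
    using c by (simp_all add: matrix_mul_assoc mat_mult_mat)
  thus "pgl_class A = pgl_class B"
    using c(1) unfolding pgl_class_eq by (auto; metis divide_eq_0_iff mult_eq_0_iff)
qed

lemma diag_mat_mult: "diag_mat s ** diag_mat t = diag_mat (s * t)"
  by (simp add: vec_eq_iff matrix_matrix_mult_def diag_mat_def if_distrib[of "\<lambda>x. x * _"]
      if_distrib[of "\<lambda>x. _ * x"] sum.delta cong: if_cong)

lemma diag_mat_1: "diag_mat 1 = mat 1"
  by (simp add: vec_eq_iff diag_mat_def mat_def)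

lemma mat_mult_diag_mat: "mat c ** diag_mat t = diag_mat (c *s t)"
  by (simp add: vec_eq_iff mat_mult_nth) (simp add: diag_mat_def)

lemma diag_mat_eq_iff: "diag_mat s = diag_mat t \<longleftrightarrow> s = t"
  by (auto simp: vec_eq_iff diag_mat_def)

lemma vec_mult_inverse: "(\<And>i. t $ i \<noteq> (0::complex)) \<Longrightarrow> t * (\<chi> i. inverse (t $ i)) = 1"
  by (simp add: vec_eq_iff)

lemma invertible_diag_mat:
  assumes "\<And>i. t $ i \<noteq> 0"
  shows "invertible (diag_mat t)"
  unfolding invertible_def
  using vec_mult_inverse[OF assms]
  by (intro exI[of _ "diag_mat (\<chi> i. inverse (t $ i))"]) (simp add: diag_mat_mult diag_mat_1 mult.commute)

text \<open>The columns of \<open>P\<close> are the diagonalizing basis, so this is the map with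
  matrix \<open>diag_mat t\<close> in the coordinates x, written in the standard
  coordinates.\<close>

definition conj_diag :: "complex^'n^'n \<Rightarrow> complex^'n \<Rightarrow> complex^'n^'n" where
  "conj_diag P t = P ** diag_mat t ** matrix_inv P"

lemma conj_diag_mult:
  assumes "invertible P"
  shows "conj_diag P s ** conj_diag P t = conj_diag P (s * t)"
proof -
  have "conj_diag P s ** conj_diag P t = P ** diag_mat s ** (matrix_inv P ** P) ** diag_mat t ** matrix_inv P"
    by (simp only: conj_diag_def matrix_mul_assoc)
  also have "\<dots> = P ** (diag_mat s ** diag_mat t) ** matrix_inv P"
    using assms by (simp add: matrix_inv_mult matrix_mul_assoc)
  finally show ?thesis by (simp add: diag_mat_mult conj_diag_def)
qed

lemma conj_diag_1: "invertible P \<Longrightarrow> conj_diag P 1 = mat 1"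
  by (simp add: conj_diag_def diag_mat_1 matrix_inv_mult)

lemma mat_mult_conj_diag: "mat c ** conj_diag P t = conj_diag P (c *s t)"
proof -
  have "mat c ** (P ** diag_mat t ** matrix_inv P) = P ** (mat c ** diag_mat t) ** matrix_inv P"
    by (metis mat_mult_commute matrix_mul_assoc)
  thus ?thesis by (simp add: conj_diag_def mat_mult_diag_mat)
qed

lemma unconj_conj_diag:
  assumes "invertible P"
  shows "matrix_inv P ** conj_diag P t ** P = diag_mat t"
proof -
  have "matrix_inv P ** conj_diag P t ** P = (matrix_inv P ** P) ** diag_mat t ** (matrix_inv P ** P)"
    by (simp only: conj_diag_def matrix_mul_assoc)
  thus ?thesis using assms by (simp add: matrix_inv_mult)
qed

lemma conj_diag_unconj:
  assumes "invertible P" "matrix_inv P ** A ** P = diag_mat t"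
  shows "A = conj_diag P t"
proof -
  have "conj_diag P t = (P ** matrix_inv P) ** A ** (P ** matrix_inv P)"
    unfolding conj_diag_def assms(2)[symmetric] by (simp only: matrix_mul_assoc)
  thus ?thesis using assms by (simp add: matrix_inv_mult)
qed

lemma conj_diag_eq_iff: "invertible P \<Longrightarrow> conj_diag P s = conj_diag P t \<longleftrightarrow> s = t"
  by (metis unconj_conj_diag diag_mat_eq_iff)

lemma invertible_conj_diag:
  "invertible P \<Longrightarrow> (\<And>i. t $ i \<noteq> 0) \<Longrightarrow> invertible (conj_diag P t)"
  unfolding conj_diag_def by (intro invertible_mult invertible_diag_mat invertible_matrix_inv)

definition torus_class :: "complex^'n^'n \<Rightarrow> complex^'n \<Rightarrow> ('n::finite) pgl" where
  "torus_class P t = pgl_class (conj_diag P t)"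

lemma torus_class_eq_iff:
  "invertible P \<Longrightarrow> torus_class P s = torus_class P t \<longleftrightarrow> (\<exists>c. c \<noteq> 0 \<and> s = c *s t)"
  by (simp add: torus_class_def pgl_class_eq_iff mat_mult_conj_diag conj_diag_eq_iff)

section \<open>The diagonal stabiliser of a polynomial\<close>

definition monomial_value :: "('n::finite \<Rightarrow>\<^sub>0 nat) \<Rightarrow> complex^'n \<Rightarrow> complex" where
  "monomial_value m t = (\<Prod>i\<in>UNIV. (t $ i) ^ Poly_Mapping.lookup m i)"

lemma monomial_value_mult: "monomial_value m (s * t) = monomial_value m s * monomial_value m t"
  by (simp add: monomial_value_def power_mult_distrib prod.distrib)

lemma monomial_value_1 [simp]: "monomial_value m 1 = 1"
  by (simp add: monomial_value_def)

lemma monomial_value_scale: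
  "monomial_value m (c *s t) = c ^ (\<Sum>i\<in>UNIV. Poly_Mapping.lookup m i) * monomial_value m t"
  by (simp add: monomial_value_def power_mult_distrib prod.distrib power_sum)

lemma monomial_value_nonzero: "(\<And>i. t $ i \<noteq> 0) \<Longrightarrow> monomial_value m t \<noteq> 0"
  by (simp add: monomial_value_def)

text \<open>By \<open>lookup_lin_subst_diag\<close> these are the invertible diagonal matrices for
  which \<open>p\<close> is an eigenvector; comparing monomials in pairs avoids naming the
  eigenvalue. For homogeneous \<open>p\<close> all nonzero scalar matrices are included, so
  finiteness can only be asked of the image in \<open>PGL\<close>.\<close>

definition eigen_torus :: "('n::finite) cpoly \<Rightarrow> (complex^'n) set" where
  "eigen_torus p = {t. (\<forall>i. t $ i \<noteq> 0) \<and>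
     (\<forall>m\<in>Poly_Mapping.keys p. \<forall>m'\<in>Poly_Mapping.keys p. monomial_value m t = monomial_value m' t)}"

lemma eigen_torusI:
  "(\<And>i. t $ i \<noteq> 0) \<Longrightarrow> (\<And>m. m \<in> Poly_Mapping.keys p \<Longrightarrow> monomial_value m t = \<mu>) \<Longrightarrow> t \<in> eigen_torus p"
  by (simp add: eigen_torus_def)

lemma eigen_torus_nonzero: "t \<in> eigen_torus p \<Longrightarrow> t $ i \<noteq> 0"
  by (simp add: eigen_torus_def)

lemma eigen_torusD:
  "t \<in> eigen_torus p \<Longrightarrow> m \<in> Poly_Mapping.keys p \<Longrightarrow> m' \<in> Poly_Mapping.keys p \<Longrightarrow>
    monomial_value m t = monomial_value m' t"
  unfolding eigen_torus_def by blast

lemma eigen_torus_mult: "s \<in> eigen_torus p \<Longrightarrow> t \<in> eigen_torus p \<Longrightarrow> s * t \<in> eigen_torus p"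
  unfolding eigen_torus_def mem_Collect_eq monomial_value_mult
  by (metis mult_eq_0_iff vector_mult_component)

lemma eigen_torus_1: "1 \<in> eigen_torus p"
  by (simp add: eigen_torus_def)

lemma eigen_torus_inverse:
  assumes "t \<in> eigen_torus p"
  shows "(\<chi> i. inverse (t $ i)) \<in> eigen_torus p"
proof -
  note nz = eigen_torus_nonzero[OF assms]
  have "monomial_value m t * monomial_value m (\<chi> i. inverse (t $ i)) = 1" for m
    using vec_mult_inverse[OF nz] by (metis monomial_value_mult monomial_value_1)
  hence inv: "monomial_value m (\<chi> i. inverse (t $ i)) = inverse (monomial_value m t)" for m
    by (metis inverse_unique)
  show ?thesis
    unfolding eigen_torus_def mem_Collect_eq inv
  proof (intro conjI ballI allI)
    show "(\<chi> i. inverse (t $ i)) $ i \<noteq> 0" for i using nz by simp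
    show "inverse (monomial_value m t) = inverse (monomial_value m' t)"
      if "m \<in> Poly_Mapping.keys p" "m' \<in> Poly_Mapping.keys p" for m m'
      using eigen_torusD[OF assms that] by simp
  qed
qed

lemma eigen_torus_scale:
  assumes "homogeneous d p" "t \<in> eigen_torus p" "c \<noteq> 0"
  shows "c *s t \<in> eigen_torus p"
proof -
  have scale: "monomial_value m (c *s t) = c ^ d * monomial_value m t" if "m \<in> Poly_Mapping.keys p" for m
    using assms(1) that by (simp add: monomial_value_scale homogeneous_def)
  show ?thesis
    unfolding eigen_torus_def mem_Collect_eq
  proof (intro conjI ballI allI)
    show "(c *s t) $ i \<noteq> 0" for i
      using eigen_torus_nonzero[OF assms(2)] assms(3) by simp
    show "monomial_value m (c *s t) = monomial_value m' (c *s t)"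
      if "m \<in> Poly_Mapping.keys p" "m' \<in> Poly_Mapping.keys p" for m m'
      using scale[OF that(1)] scale[OF that(2)] eigen_torusD[OF assms(2) that] by simp
  qed
qed

lemma subgroup_torus_class:
  assumes P: "invertible P"
  shows "subgroup (torus_class P ` eigen_torus p) PGL"
proof (rule group.subgroupI[OF group_PGL])
  have inv: "invertible (conj_diag P t)" if "t \<in> eigen_torus p" for t
    using P that by (intro invertible_conj_diag eigen_torus_nonzero)
  show sub: "torus_class P ` eigen_torus p \<subseteq> carrier PGL"
    using inv by (auto simp: carrier_PGL torus_class_def)
  show "torus_class P ` eigen_torus p \<noteq> {}" using eigen_torus_1 by blast
  have mult: "torus_class P s \<otimes>\<^bsub>PGL\<^esub> torus_class P t = torus_class P (s * t)"
    if "s \<in> eigen_torus p" "t \<in> eigen_torus p" for s t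
    using inv that P by (simp add: torus_class_def pgl_class_mult conj_diag_mult)
  show "a \<otimes>\<^bsub>PGL\<^esub> b \<in> torus_class P ` eigen_torus p"
    if "a \<in> torus_class P ` eigen_torus p" "b \<in> torus_class P ` eigen_torus p" for a b
    using that mult eigen_torus_mult by (auto intro!: imageI)
  show "inv\<^bsub>PGL\<^esub> a \<in> torus_class P ` eigen_torus p" if "a \<in> torus_class P ` eigen_torus p" for a
  proof -
    obtain t where t: "t \<in> eigen_torus p" "a = torus_class P t" using \<open>a \<in> _\<close> by blast
    let ?s = "\<chi> i. inverse (t $ i)"
    have s: "?s \<in> eigen_torus p" using t(1) by (rule eigen_torus_inverse)
    have "t * ?s = 1" using t(1) by (intro vec_mult_inverse eigen_torus_nonzero)
    hence "torus_class P ?s \<otimes>\<^bsub>PGL\<^esub> a = \<one>\<^bsub>PGL\<^esub>"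
      using mult[OF s t(1)] t P by (simp add: mult.commute pgl_class_one torus_class_def conj_diag_1)
    hence "inv\<^bsub>PGL\<^esub> a = torus_class P ?s"
      using sub s t by (intro group.inv_equality[OF group_PGL]) blast+
    thus ?thesis using s by blast
  qed
qed

lemma torus_class_mult:
  assumes "invertible P" "\<And>i. s $ i \<noteq> 0" "\<And>i. t $ i \<noteq> 0"
  shows "torus_class P s \<otimes>\<^bsub>PGL\<^esub> torus_class P t = torus_class P (s * t)"
  using assms by (simp add: torus_class_def pgl_class_mult conj_diag_mult invertible_conj_diag)

section \<open>Action on the points of a hypersurface\<close>

lemma pgl_act_span: "pgl_act (pgl_class A) (vec.span {v}) = vec.span {A *v v}"
proof -
  have "pgl_act (pgl_class A) (vec.span {v}) = {(mat c ** A) *v (k *s v) | c k. c \<noteq> 0}"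
    by (auto simp: pgl_act_def pgl_class_eq vec.span_singleton)
  also have "\<dots> = {(c * k) *s (A *v v) | c k. c \<noteq> 0}"
    by (simp add: mat_mult_vec vector_scalar_commute vector_smult_assoc mult.commute)
  also have "\<dots> = range (\<lambda>k. k *s (A *v v))"
  proof (intro equalityI subsetI)
    fix x assume "x \<in> range (\<lambda>k. k *s (A *v v))"
    then obtain k where "x = (1 * k) *s (A *v v)" by auto
    thus "x \<in> {(c * k) *s (A *v v) | c k. c \<noteq> 0}" using zero_neq_one[symmetric] by blast
  qed blast
  finally show ?thesis by (simp add: vec.span_singleton)
qed

lemma pgl_class_in_Lin:
  assumes A: "invertible A" and eig: "\<And>v. poly_eval p (A *v v) = 0 \<longleftrightarrow> poly_eval p v = 0"
  shows "pgl_class A \<in> Lin (hypersurface p)"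
proof -
  have nz: "A *v v = 0 \<longleftrightarrow> v = 0" for v
    using A by (metis invertible_def matrix_left_invertible_ker matrix_vector_mult_0_right)
  have sub: "pgl_act (pgl_class A) L \<in> hypersurface p" if L: "L \<in> hypersurface p" for L
  proof -
    obtain v where "L = vec.span {v}" "v \<noteq> 0" "poly_eval p v = 0"
      using L by (auto simp: hypersurface_def)
    thus ?thesis using eig nz by (auto simp: hypersurface_def pgl_act_span)
  qed
  have sur: "L \<in> pgl_act (pgl_class A) ` hypersurface p" if L: "L \<in> hypersurface p" for L
  proof -
    obtain v where v: "L = vec.span {v}" "v \<noteq> 0" "poly_eval p v = 0"
      using L by (auto simp: hypersurface_def)
    define w where "w = matrix_inv A *v v"
    have w: "A *v w = v"
      using A by (simp add: w_def matrix_vector_mul_assoc matrix_inv_mult)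
    hence "w \<noteq> 0" "poly_eval p w = 0" using v nz eig[of w] by auto
    moreover have "L = pgl_act (pgl_class A) (vec.span {w})" using w v by (simp add: pgl_act_span)
    ultimately show ?thesis by (auto simp: hypersurface_def)
  qed
  have "pgl_act (pgl_class A) ` hypersurface p = hypersurface p" using sub sur by blast
  thus ?thesis using A by (simp add: Lin_def carrier_PGL)
qed

section \<open>Maximal data\<close>

lemma characters_mult:
  "\<xi> \<in> characters G \<Longrightarrow> \<eta> \<in> characters G \<Longrightarrow> (\<lambda>g. \<xi> g * \<eta> g) \<in> characters G"
  by (simp add: characters_def hom_def Cstar_def Pi_iff mult_ac)

lemma characters_inverse: "\<xi> \<in> characters G \<Longrightarrow> (\<lambda>g. inverse (\<xi> g)) \<in> characters G"
  by (simp add: characters_def hom_def Cstar_def Pi_iff)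

lemma characters_nonzero: "\<xi> \<in> characters G \<Longrightarrow> g \<in> G \<Longrightarrow> \<xi> g \<noteq> 0"
  by (auto simp: characters_def hom_def Cstar_def Pi_iff)

text \<open>One inclusion holds for the twist by any character; the twist by the inverse character
  gives the other.\<close>

lemma data_class_eqI:
  assumes "grp J = grp I" and \<xi>: "\<xi> \<in> characters (grp I)"
    and "\<And>g i. g \<in> grp I \<Longrightarrow> chrs J i g = chrs I i g * \<xi> g"
    and "\<And>g. g \<in> grp I \<Longrightarrow> chr J g = chr I g * \<xi> g ^ d"
  shows "data_class d J = data_class d I"
proof -
  have sub: "data_class d B \<subseteq> data_class d A"
    if "grp B = grp A" "\<xi> \<in> characters (grp A)" "\<And>g i. g \<in> grp A \<Longrightarrow> chrs B i g = chrs A i g * \<xi> g"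
      "\<And>g. g \<in> grp A \<Longrightarrow> chr B g = chr A g * \<xi> g ^ d" for A B :: "'a datum" and \<xi>
  proof
    fix C assume "C \<in> data_class d B"
    then obtain \<eta> where \<eta>: "grp C = grp B" "\<eta> \<in> characters (grp B)"
      "\<And>g i. g \<in> grp B \<Longrightarrow> chrs C i g = chrs B i g * \<eta> g" "\<And>g. g \<in> grp B \<Longrightarrow> chr C g = chr B g * \<eta> g ^ d"
      by (auto simp: data_class_def data_equiv_def)
    show "C \<in> data_class d A"
      unfolding data_class_def data_equiv_def
      using \<eta> that characters_mult[of \<xi> "grp A" \<eta>]
      by (auto intro!: bexI[of _ "\<lambda>g. \<xi> g * \<eta> g"] simp: power_mult_distrib)
  qed
  have "data_class d J \<subseteq> data_class d I" using assms by (rule sub)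
  moreover have "data_class d I \<subseteq> data_class d J"
    using assms characters_nonzero[OF \<xi>] characters_inverse[OF \<xi>]
    by (intro sub[where \<xi> = "\<lambda>g. inverse (\<xi> g)"])
      (auto simp: field_simps)
  ultimately show ?thesis by blast
qed

text \<open>Scaling one coordinate to 1 selects exactly one representative of each class, and a
  product of normalised vectors is normalised. The selection is therefore a homomorphism, which
  makes diagonal stabilisers liftable.\<close>

definition torus_lift :: "'n \<Rightarrow> complex^'n^'n \<Rightarrow> ('n::finite) cpoly \<Rightarrow> 'n pgl \<Rightarrow> complex^'n" where
  "torus_lift z P p h = (SOME t. t \<in> eigen_torus p \<and> torus_class P t = h \<and> t $ z = 1)"

lemma torus_lift:
  assumes P: "invertible P" and hom: "homogeneous d p" and t: "t \<in> eigen_torus p"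
  shows "torus_lift z P p (torus_class P t) = inverse (t $ z) *s t"
  unfolding torus_lift_def
proof (rule some_equality)
  have nz: "t $ z \<noteq> 0" using t by (rule eigen_torus_nonzero)
  show "inverse (t $ z) *s t \<in> eigen_torus p \<and> torus_class P (inverse (t $ z) *s t) = torus_class P t \<and>
      (inverse (t $ z) *s t) $ z = 1"
    using eigen_torus_scale[OF hom t] nz P by (auto simp: torus_class_eq_iff intro: exI[of _ "inverse (t $ z)"])
  fix s assume s: "s \<in> eigen_torus p \<and> torus_class P s = torus_class P t \<and> s $ z = 1"
  then obtain c where "s = c *s t" using P by (auto simp: torus_class_eq_iff)
  thus "s = inverse (t $ z) *s t"
    using s nz by (metis inverse_unique mult.commute vector_smult_component)
qed

definition torus_datum :: "'n \<Rightarrow> complex^'n^'n \<Rightarrow> ('n::finite) cpoly \<Rightarrow> ('n \<Rightarrow>\<^sub>0 nat) \<Rightarrow> 'n datum" where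
  "torus_datum z P p m = \<lparr>grp = torus_class P ` eigen_torus p,
     chr = (\<lambda>h. monomial_value m (torus_lift z P p h)), chrs = (\<lambda>i h. torus_lift z P p h $ i)\<rparr>"

text \<open>This supplies the competitor for maximality: the full diagonal stabiliser of
  \<open>p\<close>, finite by assumption, commutative because diagonal, and liftable by
  \<open>torus_lift\<close>.\<close>

lemma data_class_torus_datum:
  fixes p :: "('n::finite) cpoly"
  assumes P: "invertible P" and hom: "homogeneous d p" and smooth: "smooth_poly p"
    and m: "m \<in> Poly_Mapping.keys p" and fin: "finite (torus_class P ` eigen_torus p)"
  shows "data_class d (torus_datum z P p m) \<in> data_poset d"
proof -
  let ?H = "torus_class P ` eigen_torus p" and ?J = "torus_datum z P p m" and ?lift = "torus_lift z P p"
  have sub: "subgroup ?H PGL" using P by (rule subgroup_torus_class)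
  have nz: "t $ i \<noteq> 0" if "t \<in> eigen_torus p" for t i using that by (rule eigen_torus_nonzero)
  have tm: "torus_class P s \<otimes>\<^bsub>PGL\<^esub> torus_class P t = torus_class P (s * t)"
    if "s \<in> eigen_torus p" "t \<in> eigen_torus p" for s t
    using P nz that by (intro torus_class_mult) auto
  have liftm: "?lift (g \<otimes>\<^bsub>PGL\<^esub> h) = ?lift g * ?lift h" if gh: "g \<in> ?H" "h \<in> ?H" for g h
  proof -
    obtain s t where st: "s \<in> eigen_torus p" "t \<in> eigen_torus p" "g = torus_class P s" "h = torus_class P t"
      using gh by blast
    show ?thesis
      using st by (simp add: tm torus_lift[OF P hom] eigen_torus_mult) (simp add: vec_eq_iff)
  qed
  have lift: "?lift h \<in> eigen_torus p" "torus_class P (?lift h) = h" if h: "h \<in> ?H" for h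
  proof -
    obtain t where t: "t \<in> eigen_torus p" "h = torus_class P t" using h by blast
    show "?lift h \<in> eigen_torus p" "torus_class P (?lift h) = h"
      using t nz[OF t(1), of z] eigen_torus_scale[OF hom t(1), of "inverse (t $ z)"] P
      by (auto simp: torus_lift[OF P hom] torus_class_eq_iff intro!: exI[of _ "inverse (t $ z)"])
  qed
  have comm: "comm_group (subgrp ?H)"
    by (rule group.group_comm_groupI[OF group.subgroup_imp_group[OF group_PGL sub]])
      (auto simp: tm mult.commute)
  have lifting: "is_lifting ?H (\<lambda>h. conj_diag P (?lift h))"
    unfolding is_lifting_def hom_def
    using lift nz[OF lift(1)] P
    by (auto simp: liftm conj_diag_mult invertible_conj_diag simp flip: torus_class_def)
  have eig: "lin_subst (diag_mat t) p = Const (monomial_value m t) * p" if t: "t \<in> eigen_torus p" for t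
  proof (rule poly_mapping_eqI)
    fix k
    show "Poly_Mapping.lookup (lin_subst (diag_mat t) p) k = Poly_Mapping.lookup (Const (monomial_value m t) * p) k"
      using eigen_torusD[OF t m, of k]
      by (cases "k \<in> Poly_Mapping.keys p") (auto simp: lookup_lin_subst_diag lookup_Const_mult monomial_value_def in_keys_iff)
  qed
  \<comment> \<open>\<open>p\<close> is an equation in the coordinates x, whereas the poset speaks
    of standard coordinates y = P x; there the equation is p(P^-1 y).\<close>
  let ?F = "lin_subst (matrix_inv P) p"
  have undo: "lin_subst P ?F = p"
    using P by (simp add: lin_subst_lin_subst matrix_inv_mult)
  have "associated_datum ?F P ?J"
    unfolding associated_datum_def undo
  proof (intro conjI allI ballI)
    show "invertible P" by (rule P)
    show "chr ?J \<in> characters (grp ?J)"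
      using lift nz[OF lift(1)]
      by (auto simp: torus_datum_def characters_def hom_def Cstar_def liftm monomial_value_mult monomial_value_nonzero)
    show "chrs ?J i \<in> characters (grp ?J)" for i
      using nz[OF lift(1)] by (auto simp: torus_datum_def characters_def hom_def Cstar_def liftm)
    show "\<exists>\<phi>. is_lifting (grp ?J) \<phi> \<and> (\<forall>g\<in>grp ?J. matrix_inv P ** \<phi> g ** P = diag_mat (\<chi> i. chrs ?J i g))"
      using lifting P by (intro exI[of _ "\<lambda>h. conj_diag P (?lift h)"]) (auto simp: torus_datum_def unconj_conj_diag)
    fix g assume "g \<in> grp ?J"
    thus "lin_subst (diag_mat (\<chi> i. chrs ?J i g)) p = Const (chr ?J g) * p"
      using eig[OF lift(1)[of g]] by (auto simp: torus_datum_def)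
  qed
  moreover have "?H \<subseteq> Lin (hypersurface ?F)"
  proof
    fix h assume "h \<in> ?H"
    then obtain t where t: "t \<in> eigen_torus p" "h = pgl_class (conj_diag P t)"
      by (auto simp: torus_class_def)
    have "poly_eval ?F (conj_diag P t *v v) = monomial_value m t * poly_eval ?F v" for v
    proof -
      have "matrix_inv P ** conj_diag P t = diag_mat t ** matrix_inv P"
        by (simp add: conj_diag_def matrix_mul_assoc matrix_inv_mult[OF P])
      hence "poly_eval ?F (conj_diag P t *v v) = poly_eval (lin_subst (diag_mat t) p) (matrix_inv P *v v)"
        by (simp add: poly_eval_lin_subst matrix_vector_mul_assoc)
      thus ?thesis by (simp add: eig[OF t(1)] poly_eval_mult poly_eval_lin_subst)
    qed
    thus "h \<in> Lin (hypersurface ?F)"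
      unfolding t(2) using nz[OF t(1)] P
      by (intro pgl_class_in_Lin invertible_conj_diag) (auto simp: monomial_value_nonzero)
  qed
  moreover have "homogeneous d ?F" "smooth_poly ?F"
    using hom smooth P by (simp_all add: homogeneous_lin_subst smooth_poly_lin_subst invertible_matrix_inv)
  moreover have "grp ?J = ?H" by (simp add: torus_datum_def)
  moreover have "liftable ?H" using lifting by (auto simp: liftable_def)
  ultimately show ?thesis
    unfolding data_poset_def using sub fin comm
    by (intro CollectI exI[of _ ?J] exI[of _ ?F] exI[of _ P]) simp
qed

lemma associated_datum_grp:
  assumes "associated_datum F P I" "g \<in> grp I"
  shows "g = torus_class P (\<chi> i. chrs I i g)"
proof -
  obtain \<phi> where "is_lifting (grp I) \<phi>" "matrix_inv P ** \<phi> g ** P = diag_mat (\<chi> i. chrs I i g)"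
    using assms by (auto simp: associated_datum_def)
  thus ?thesis
    using assms conj_diag_unconj[of P "\<phi> g"] by (auto simp: associated_datum_def is_lifting_def torus_class_def)
qed

lemma keys_smooth_poly:
  assumes "smooth_poly (p :: ('n::finite) cpoly)"
  shows "Poly_Mapping.keys p \<noteq> {}"
proof
  assume "Poly_Mapping.keys p = {}"
  hence "p = 0" by simp
  hence "axis undefined (1 :: complex) = (0 :: complex^'n)"
    using assms unfolding smooth_poly_iff by simp
  thus False by (simp add: axis_eq_0_iff)
qed

text \<open>By \<open>keys\<close> the monomials of \<open>p\<close> belong to \<open>I\<close>, so
  \<open>grp I\<close> acts on \<open>p\<close> by scalars and lies in the stabiliser of
  \<open>p\<close>, whether or not \<open>p\<close> comes from \<open>F\<close>. Restricted to
  \<open>grp I\<close>, the datum of the stabiliser differs from \<open>I\<close> only in the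
  lifting, so a proper inclusion would put the class of \<open>I\<close> strictly below a member of
  the poset.\<close>

lemma maximal_grp_eq_torus:
  fixes p :: "('n::finite) cpoly"
  assumes I: "associated_datum F P I" and G: "subgroup (grp I) PGL"
    and maximal: "maximal_class d (data_class d I)"
    and hom: "homogeneous d p" and smooth: "smooth_poly p"
    and fin: "finite (torus_class P ` eigen_torus p)"
    and keys: "\<And>m g. m \<in> Poly_Mapping.keys p \<Longrightarrow> g \<in> grp I \<Longrightarrow> monomial_value m (\<chi> i. chrs I i g) = chr I g"
  shows "g \<in> grp I \<Longrightarrow> (\<chi> i. chrs I i g) \<in> eigen_torus p"
    and "grp I = torus_class P ` eigen_torus p"
proof -
  have P: "invertible P" and chars: "\<And>i. chrs I i \<in> characters (grp I)"
    using I by (auto simp: associated_datum_def)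
  obtain m where m: "m \<in> Poly_Mapping.keys p" using keys_smooth_poly[OF smooth] by blast
  have mem: "(\<chi> i. chrs I i g) \<in> eigen_torus p" if "g \<in> grp I" for g
    using keys[OF _ that] characters_nonzero[OF chars that] by (intro eigen_torusI) auto
  show "g \<in> grp I \<Longrightarrow> (\<chi> i. chrs I i g) \<in> eigen_torus p" by (rule mem)
  define z where "z = (undefined :: 'n)"
  let ?J = "torus_datum z P p m"
  have sub: "grp I \<subseteq> torus_class P ` eigen_torus p"
    using associated_datum_grp[OF I] mem by blast
  \<comment> \<open>The two liftings differ by the character \<open>chrs I z\<close>, which the
    equivalence of data absorbs.\<close>
  have lift: "torus_lift z P p g = inverse (chrs I z g) *s (\<chi> i. chrs I i g)" if "g \<in> grp I" for g
    using torus_lift[OF P hom mem[OF that], of z] associated_datum_grp[OF I that] by simp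
  have "data_class d (restrict_datum (grp I) ?J) = data_class d I"
  proof (rule data_class_eqI)
    show "(\<lambda>g. inverse (chrs I z g)) \<in> characters (grp I)" using chars by (rule characters_inverse)
    fix g assume g: "g \<in> grp I"
    show "chrs (restrict_datum (grp I) ?J) i g = chrs I i g * inverse (chrs I z g)" for i
      using g by (simp add: restrict_datum_def torus_datum_def lift)
    show "chr (restrict_datum (grp I) ?J) g = chr I g * inverse (chrs I z g) ^ d"
      using g keys[OF m g] hom m
      by (simp add: restrict_datum_def torus_datum_def lift monomial_value_scale homogeneous_def)
  qed (simp add: restrict_datum_def)
  moreover have "subgroup (grp I) (subgrp (grp ?J))"
    using group.subgroup_incl[OF group_PGL G subgroup_torus_class[OF P] sub] by (simp add: torus_datum_def)
  ultimately have "grp I \<subset> grp ?J \<Longrightarrow> class_less d (data_class d I) (data_class d ?J)"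
    unfolding class_less_def by metis
  hence "\<not> grp I \<subset> grp ?J"
    using maximal data_class_torus_datum[OF P hom smooth m fin] by (auto simp: maximal_class_def)
  thus "grp I = torus_class P ` eigen_torus p" using sub by (auto simp: torus_datum_def)
qed

section \<open>The exceptional quartics\<close>

lemma keys_add_single:
  assumes "c \<noteq> 0" "m \<notin> Poly_Mapping.keys p"
  shows "Poly_Mapping.keys (p + Poly_Mapping.single m c) = insert m (Poly_Mapping.keys p)"
  using assms by (auto simp: in_keys_iff lookup_add lookup_single when_def split: if_splits)

lemma homogeneous_quad: "homogeneous 4 (X w * X x * X y * X z)"
  by (simp add: monomial_quad homogeneous_def lookup_quad sum.distrib of_bool_def)

lemma quad_eq_iff:
  assumes "UNIV = {i, j, k, l}"
  shows "quad w x y z = quad w' x' y' z' \<longleftrightarrow>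
    (\<forall>t\<in>{i, j, k, l}. of_bool (w = t) + of_bool (x = t) + of_bool (y = t) + of_bool (z = t) =
       of_bool (w' = t) + of_bool (x' = t) + of_bool (y' = t) + (of_bool (z' = t) :: nat))"
  unfolding assms[symmetric] poly_mapping_eq_iff fun_eq_iff lookup_quad by simp

lemma smooth_polyI4:
  fixes p :: "('n::finite) cpoly"
  assumes "distinct [i, j, k, l]" "UNIV = {i, j, k, l}"
    and "\<And>t. grad t p 0 = 0"
    and "\<And>v. grad i p v = 0 \<Longrightarrow> grad j p v = 0 \<Longrightarrow> grad k p v = 0 \<Longrightarrow> grad l p v = 0 \<Longrightarrow>
      v $ i = 0 \<and> v $ j = 0 \<and> v $ k = 0 \<and> v $ l = 0"
  shows "smooth_poly p"
  unfolding smooth_poly_iff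
proof (intro allI iffI)
  fix v assume "\<forall>t. grad t p v = 0"
  hence "\<forall>t\<in>{i, j, k, l}. v $ t = 0" using assms(4)[of v] by auto
  thus "v = 0" unfolding assms(2)[symmetric] by (simp add: vec_eq_iff)
qed (use assms(3) in auto)

text \<open>Smooth polynomials supported on the five exceptional sets, up to the order of the variables: the
  last summand of the first one is \<open>x\<^sub>l\<^sup>3x\<^sub>m\<close> with \<open>m = i\<close> or \<open>m = l\<close>, which gives (4) and (5); the
  others give (3), (2) and (1). Without the coefficients 3 the last polynomial would be singular.\<close>

definition conic_tail_poly :: "'n \<Rightarrow> 'n \<Rightarrow> 'n \<Rightarrow> 'n \<Rightarrow> 'n \<Rightarrow> 'n cpoly" where
  "conic_tail_poly m i j k l = X k * X k * X k * X k + X i * X i * X i * X k + X j * X j * X j * X k +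
     X i * X i * X j * X j + X l * X l * X l * X m"

definition chain_poly :: "'n \<Rightarrow> 'n \<Rightarrow> 'n \<Rightarrow> 'n \<Rightarrow> 'n cpoly" where
  "chain_poly i j k l = X l * X l * X l * X l + X i * X i * X i * X k + X j * X j * X j * X k +
     X k * X k * X k * X l + X i * X i * X j * X l"

definition inner_poly :: "'n \<Rightarrow> 'n \<Rightarrow> 'n \<Rightarrow> 'n \<Rightarrow> 'n cpoly" where
  "inner_poly i j k l = X i * X i * X i * X k + X j * X j * X j * X k + X k * X k * X k * X i +
     X l * X l * X l * X i + X i * X i * X j * X l + X k * X k * X j * X l"

definition outer_poly :: "'n \<Rightarrow> 'n \<Rightarrow> 'n \<Rightarrow> 'n \<Rightarrow> 'n cpoly" where
  "outer_poly i j k l = X i * X i * X i * X k + X j * X j * X j * X k + X k * X k * X k * X j +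
     X l * X l * X l * X j + Const 3 * (X i * X i * X j * X l) + Const 3 * (X l * X l * X i * X k)"

text \<open>Each derivative times its variable is a linear equation between values of monomials,
  which expresses all of them through \<open>B\<close>. The term \<open>e\<close> is what the
  monomial x_l^3 x_m adds to the derivative by x_i. \<open>chain_critical\<close> follows the same
  scheme.\<close>

lemma conic_tail_critical:
  fixes a b c e :: complex
  assumes i: "3 * a^2 * c + 2 * a * b^2 + e = 0" and e: "a * e = 0"
    and j: "3 * b^2 * c + 2 * a^2 * b = 0" and k: "4 * c^3 + a^3 + b^3 = 0"
  shows "a = 0 \<and> b = 0 \<and> c = 0"
proof -
  define B where "B = a^2 * b^2"
  have A1: "3 * (a^3 * c) = - 2 * B" using i e unfolding B_def by algebra
  have A2: "3 * (b^3 * c) = - 2 * B" using j unfolding B_def by algebra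
  have C: "3 * c^4 = B" using A1 A2 k by algebra
  \<comment> \<open>A multiplicative relation between the same monomials; the linear relations turn
    its sides into multiples of B^4 with different factors.\<close>
  have "B^3 * (3 * c^4) = 3 * (a^3 * c)^2 * (b^3 * c)^2" unfolding B_def by algebra
  hence "27 * B^4 = 16 * B^4" using A1 A2 C by algebra
  hence B: "B = 0" by simp
  hence c: "c = 0" using C by simp
  have "a * b = 0" using B by (auto simp: B_def)
  moreover have "a^3 + b^3 = 0" using k c by simp
  ultimately show ?thesis using c by auto
qed

lemma chain_critical:
  fixes a b c d :: complex
  assumes i: "3 * a^2 * c + 2 * a * b * d = 0" and j: "3 * b^2 * c + a^2 * d = 0"
    and k: "a^3 + b^3 + 3 * c^2 * d = 0" and l: "4 * d^3 + c^3 + a^2 * b = 0"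
  shows "a = 0 \<and> b = 0 \<and> c = 0 \<and> d = 0"
proof -
  define B where "B = a^2 * b * d"
  have A1: "3 * (a^3 * c) = - 2 * B" using i unfolding B_def by algebra
  have A2: "3 * (b^3 * c) = - B" using j unfolding B_def by algebra
  have A3: "3 * (c^3 * d) = B" using k A1 A2 by algebra
  have A4: "3 * d^4 = - B" using l A3 unfolding B_def by algebra
  \<comment> \<open>The multiplicative relation that \<open>A1\<close> to \<open>A4\<close>
    contradict unless \<open>B\<close> is 0.\<close>
  have "(a^3 * c)^2 * (b^3 * c) * d^4 = B^3 * (c^3 * d)" unfolding B_def by algebra
  hence "4 * B^4 = 27 * B^4" using A1 A2 A3 A4 by algebra
  hence B: "B = 0" by simp
  hence d: "d = 0" using A4 by simp
  have c: "c = 0"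
  proof (rule ccontr)
    assume "c \<noteq> 0"
    moreover have "a = 0" using A1 B calculation by simp
    ultimately show False using l d by simp
  qed
  have "a^2 * b = 0" "a^3 + b^3 = 0" using l k c d by simp_all
  thus ?thesis using c d by auto
qed

lemma inner_critical:
  fixes a b c d :: complex
  assumes i: "3 * a^2 * c + c^3 + d^3 + 2 * a * b * d = 0" and j: "3 * b^2 * c + a^2 * d + c^2 * d = 0"
    and k: "a^3 + b^3 + 3 * c^2 * a + 2 * c * b * d = 0" and l: "3 * d^2 * a + a^2 * b + c^2 * b = 0"
  shows "a = 0 \<and> b = 0 \<and> c = 0 \<and> d = 0"
proof -
  define B where "B = a^2 * b * d"
  define C where "C = c^2 * b * d"
  have A2: "3 * (b^3 * c) = - (B + C)" using j unfolding B_def C_def by algebra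
  have A4: "3 * (d^3 * a) = - (B + C)" using l unfolding B_def C_def by algebra
  have I: "3 * (a^3 * c) + c^3 * a + d^3 * a + 2 * B = 0" using i unfolding B_def by algebra
  have K: "a^3 * c + b^3 * c + 3 * (c^3 * a) + 2 * C = 0" using k unfolding C_def by algebra
  \<comment> \<open>Four linear equations for six monomial values leave two free ones,
    \<open>B\<close> and \<open>C\<close>; the proportion B : C = a^3 c : c^3 a then leaves only B =
    C or B = -C.\<close>
  have A1: "3 * (a^3 * c) = C - 2 * B" using I K A2 A4 by algebra
  have A3: "3 * (c^3 * a) = B - 2 * C" using I K A2 A4 by algebra
  have "B * (c^3 * a) = C * (a^3 * c)" unfolding B_def C_def by algebra
  hence "B^2 = C^2" using A1 A3 by algebra
  hence BC: "B = C \<or> B = - C" by (simp add: power2_eq_iff)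
  have ac: "a * c = 0"
  proof (rule ccontr)
    assume nz: "a * c \<noteq> 0"
    have "b * d \<noteq> 0"
    proof
      assume "b * d = 0"
      hence "B = 0" "C = 0" by (auto simp: B_def C_def)
      thus False using A1 nz by simp
    qed
    from BC show False
    proof
      assume eq: "B = C"
      hence sq: "a^2 = c^2" using \<open>b * d \<noteq> 0\<close> by (auto simp: B_def C_def)
      have "9 * ((b^3 * c) * (d^3 * a)) = 4 * B^2" using A2 A4 eq by algebra
      moreover have "a * c * B^3 = a^6 * ((b^3 * c) * (d^3 * a))" unfolding B_def by algebra
      moreover have "B = - 3 * (a^3 * c)" using A1 eq by algebra
      \<comment> \<open>Since a^2 = c^2, the last factor equals 31 a^2.\<close>
      ultimately have "(a * c) * (a * c)^3 * a^6 * (4 * a^2 + 27 * c^2) = 0" by algebra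
      hence "4 * a^2 + 27 * c^2 = 0" using nz by simp
      thus False using sq nz by simp
    next
      assume "B = - C"
      hence "b^3 * c = 0" using A2 by simp
      thus False using nz \<open>b * d \<noteq> 0\<close> by simp
    qed
  qed
  hence "a^3 * c = 0" "c^3 * a = 0" by auto
  hence "C = 2 * B" "B = 2 * C" using A1 A3 by algebra+
  hence "B = 0" "C = 0" by simp_all
  show ?thesis
  proof (cases "a = 0")
    case True
    have c: "c = 0"
    proof (rule ccontr)
      assume "c \<noteq> 0"
      moreover have "b = 0" using A2 \<open>B = 0\<close> \<open>C = 0\<close> calculation by simp
      moreover have "d = 0" using j True calculation by simp
      ultimately show False using i True by simp
    qed
    show ?thesis using i k True c by simp
  next
    case False
    hence "c = 0" using ac by simp
    moreover have "d = 0" using A4 \<open>B = 0\<close> \<open>C = 0\<close> False by simp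
    moreover have "b = 0" using l False calculation by simp
    ultimately show ?thesis using k False by simp
  qed
qed

lemma cubic_pair_zero:
  fixes a d :: complex
  assumes "d^3 + 3 * a^2 * d = 0" "a^3 + 3 * d^2 * a = 0"
  shows "a = 0 \<and> d = 0"
proof -
  have "8 * a^3 * d = 0" using assms by algebra
  thus ?thesis using assms by auto
qed

text \<open>The coefficients 3 make the derivatives by x_i and x_l, divided by 3, a symmetric linear
  system in c and b with entries a^2 + d^2 and 2ad, whose determinant is (a^2 - d^2)^2. Where it is
  nonzero, b = c = 0 and a pair of cubics in a and d remains. The case a^2 = d^2 is treated
  separately.\<close>

lemma outer_critical:
  fixes a b c d :: complex
  assumes i: "3 * a^2 * c + 6 * a * b * d + 3 * d^2 * c = 0" and j: "3 * b^2 * c + c^3 + d^3 + 3 * a^2 * d = 0"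
    and k: "a^3 + b^3 + 3 * c^2 * b + 3 * d^2 * a = 0" and l: "3 * d^2 * b + 3 * a^2 * b + 6 * d * a * c = 0"
  shows "a = 0 \<and> b = 0 \<and> c = 0 \<and> d = 0"
proof (cases "a^2 = d^2")
  case False
  have "c * (a^2 - d^2)^2 = 0" "b * (a^2 - d^2)^2 = 0" using i l by algebra+
  hence "b = 0" "c = 0" using False by simp_all
  thus ?thesis using cubic_pair_zero[of d a] j k by simp
next
  case True
  show ?thesis
  proof (cases "a = 0")
    case True
    hence "d = 0" using \<open>a^2 = d^2\<close> by simp
    thus ?thesis using cubic_pair_zero[of c b] j k True by (simp add: algebra_simps)
  next
    case False
    hence d: "d \<noteq> 0" using True by auto
    have "a * (a * c + b * d) = 0" using i True by algebra
    hence acbd: "a * c + b * d = 0" using False by simp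
    have "a^2 * (c^2 - b^2) = 0" using acbd True by algebra
    hence cb: "c^2 = b^2" using False by simp
    \<comment> \<open>With a^2 = d^2 and b^2 = c^2 the four terms of each remaining derivative merge
      in pairs, with common factor 4.\<close>
    have 1: "b^2 * c + a^2 * d = 0" using j True cb by algebra
    have 2: "b^3 + a^3 = 0" using k True cb by algebra
    have "b^3 * d = 0" using 1 2 acbd by algebra
    hence "b = 0" using d by simp
    thus ?thesis using 2 False by simp
  qed
qed

context
  fixes i j k l :: "'n::finite"
  assumes dist: "distinct [i, j, k, l]" and univ: "UNIV = {i, j, k, l}"
begin

lemma keys_special:
  "m \<in> {i, l} \<Longrightarrow> Poly_Mapping.keys (conic_tail_poly m i j k l) =
     {quad k k k k, quad i i i k, quad j j j k, quad i i j j, quad l l l m}"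
  "Poly_Mapping.keys (chain_poly i j k l) =
     {quad l l l l, quad i i i k, quad j j j k, quad k k k l, quad i i j l}"
  "Poly_Mapping.keys (inner_poly i j k l) =
     {quad i i i k, quad j j j k, quad k k k i, quad l l l i, quad i i j l, quad k k j l}"
  "Poly_Mapping.keys (outer_poly i j k l) =
     {quad i i i k, quad j j j k, quad k k k j, quad l l l j, quad i i j l, quad l l i k}"
  using dist
  by (auto simp: conic_tail_poly_def chain_poly_def inner_poly_def outer_poly_def monomial_quad Const_def
      mult_single keys_add_single quad_eq_iff[OF univ] simp del: single_numeral)

lemma homogeneous_special:
  "homogeneous 4 (conic_tail_poly m i j k l)" "homogeneous 4 (chain_poly i j k l)"
  "homogeneous 4 (inner_poly i j k l)" "homogeneous 4 (outer_poly i j k l)"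
  by (auto simp: conic_tail_poly_def chain_poly_def inner_poly_def outer_poly_def
      intro!: homogeneous_add homogeneous_Const_mult homogeneous_quad)

lemma smooth_conic_tail:
  assumes "m \<in> {i, l}"
  shows "smooth_poly (conic_tail_poly m i j k l)"
proof (rule smooth_polyI4[OF dist univ])
  have ne: "i \<noteq> j" "i \<noteq> k" "i \<noteq> l" "j \<noteq> k" "j \<noteq> l" "k \<noteq> l" using dist by auto
  fix v :: "complex^'n"
  let ?a = "v $ i" and ?b = "v $ j" and ?c = "v $ k" and ?d = "v $ l"
  assume g: "grad i (conic_tail_poly m i j k l) v = 0" "grad j (conic_tail_poly m i j k l) v = 0"
    "grad k (conic_tail_poly m i j k l) v = 0" "grad l (conic_tail_poly m i j k l) v = 0"
  have l: "?d^2 * v $ m = 0"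
    using g(4) assms ne by (auto simp: conic_tail_poly_def grad_add grad_mult grad_X poly_eval_mult power2_eq_square)
  \<comment> \<open>Only the tail x_l^3 x_i contributes to the derivative by x_i, and then the
    derivative by x_l makes a * e vanish.\<close>
  define e where "e = (if m = i then ?d^3 else 0)"
  have "3 * ?a^2 * ?c + 2 * ?a * ?b^2 + e = 0"
    using g(1) assms ne
    by (auto simp: conic_tail_poly_def grad_add grad_mult grad_X poly_eval_mult power2_eq_square power3_eq_cube e_def algebra_simps)
  moreover have "?a * e = 0" using l by (auto simp: e_def)
  moreover have "3 * ?b^2 * ?c + 2 * ?a^2 * ?b = 0"
    using g(2) assms ne
    by (auto simp: conic_tail_poly_def grad_add grad_mult grad_X poly_eval_mult power2_eq_square algebra_simps)
  moreover have "4 * ?c^3 + ?a^3 + ?b^3 = 0"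
    using g(3) assms ne
    by (auto simp: conic_tail_poly_def grad_add grad_mult grad_X poly_eval_mult power3_eq_cube algebra_simps)
  \<comment> \<open>The first equation is carried along: with a = b = c = 0 it says e = 0, which is
    what forces x_l = 0 for the tail x_l^3 x_i.\<close>
  ultimately have abc: "?a = 0" "?b = 0" "?c = 0" "3 * ?a^2 * ?c + 2 * ?a * ?b^2 + e = 0"
    using conic_tail_critical[of ?a ?c ?b e] by auto
  have "?d = 0" using l abc assms by (auto simp: e_def split: if_splits)
  thus "?a = 0 \<and> ?b = 0 \<and> ?c = 0 \<and> ?d = 0" using abc by simp
qed (simp add: conic_tail_poly_def grad_add grad_mult poly_eval_mult)

lemma smooth_chain: "smooth_poly (chain_poly i j k l)"
proof (rule smooth_polyI4[OF dist univ])
  have ne: "i \<noteq> j" "i \<noteq> k" "i \<noteq> l" "j \<noteq> k" "j \<noteq> l" "k \<noteq> l" using dist by auto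
  fix v :: "complex^'n"
  assume g: "grad i (chain_poly i j k l) v = 0" "grad j (chain_poly i j k l) v = 0"
    "grad k (chain_poly i j k l) v = 0" "grad l (chain_poly i j k l) v = 0"
  show "v $ i = 0 \<and> v $ j = 0 \<and> v $ k = 0 \<and> v $ l = 0"
    using g ne by (intro chain_critical)
      (simp_all add: chain_poly_def grad_add grad_mult grad_X poly_eval_mult power2_eq_square power3_eq_cube algebra_simps)
qed (simp add: chain_poly_def grad_add grad_mult poly_eval_mult)

lemma smooth_inner: "smooth_poly (inner_poly i j k l)"
proof (rule smooth_polyI4[OF dist univ])
  have ne: "i \<noteq> j" "i \<noteq> k" "i \<noteq> l" "j \<noteq> k" "j \<noteq> l" "k \<noteq> l" using dist by auto
  fix v :: "complex^'n"
  assume g: "grad i (inner_poly i j k l) v = 0" "grad j (inner_poly i j k l) v = 0"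
    "grad k (inner_poly i j k l) v = 0" "grad l (inner_poly i j k l) v = 0"
  show "v $ i = 0 \<and> v $ j = 0 \<and> v $ k = 0 \<and> v $ l = 0"
    using g ne by (intro inner_critical)
      (simp_all add: inner_poly_def grad_add grad_mult grad_X poly_eval_mult power2_eq_square power3_eq_cube algebra_simps)
qed (simp add: inner_poly_def grad_add grad_mult poly_eval_mult)

lemma smooth_outer: "smooth_poly (outer_poly i j k l)"
proof (rule smooth_polyI4[OF dist univ])
  have ne: "i \<noteq> j" "i \<noteq> k" "i \<noteq> l" "j \<noteq> k" "j \<noteq> l" "k \<noteq> l" using dist by auto
  fix v :: "complex^'n"
  assume g: "grad i (outer_poly i j k l) v = 0" "grad j (outer_poly i j k l) v = 0"
    "grad k (outer_poly i j k l) v = 0" "grad l (outer_poly i j k l) v = 0"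
  show "v $ i = 0 \<and> v $ j = 0 \<and> v $ k = 0 \<and> v $ l = 0"
    using g ne by (intro outer_critical)
      (simp_all add: outer_poly_def grad_add grad_mult grad_X poly_eval_mult power2_eq_square power3_eq_cube algebra_simps)
qed (simp add: outer_poly_def grad_add grad_mult poly_eval_mult)

end

section \<open>Cyclic diagonal groups\<close>

text \<open>A primitive root of unity detects exponents modulo \<open>n\<close>; this converts
  equality of characters into a congruence.\<close>

lemma roots_of_unity_power_eq_iff:
  assumes "n > 0"
  shows "(\<forall>\<omega>::complex. \<omega> ^ n = 1 \<longrightarrow> \<omega> ^ a = \<omega> ^ b) \<longleftrightarrow> a mod n = b mod n"
proof
  define \<zeta> where "\<zeta> = exp (2 * of_real pi * \<i> * of_nat 1 / of_nat n)"
  have pow: "\<zeta> ^ k = exp (2 * of_real pi * \<i> * of_nat k / of_nat n)" for k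
    by (simp add: \<zeta>_def mult_ac flip: exp_of_nat_mult)
  assume "\<forall>\<omega>::complex. \<omega> ^ n = 1 \<longrightarrow> \<omega> ^ a = \<omega> ^ b"
  moreover have "\<zeta> ^ n = 1" unfolding \<zeta>_def using assms by (intro complex_root_unity) simp
  ultimately have "\<zeta> ^ a = \<zeta> ^ b" by blast
  thus "a mod n = b mod n" using assms by (simp only: pow complex_root_unity_eq)
next
  have red: "\<omega> ^ k = \<omega> ^ (k mod n)" if "\<omega> ^ n = 1" for \<omega> :: complex and k
  proof -
    have "\<omega> ^ k = \<omega> ^ (n * (k div n) + k mod n)" by simp
    thus ?thesis using that by (simp only: power_add power_mult) simp
  qed
  assume "a mod n = b mod n"
  thus "\<forall>\<omega>::complex. \<omega> ^ n = 1 \<longrightarrow> \<omega> ^ a = \<omega> ^ b" using red by metis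
qed

definition cyclic_class :: "('n::finite \<Rightarrow> nat) \<Rightarrow> complex \<Rightarrow> 'n pgl" where
  "cyclic_class e \<omega> = pgl_class (diag_mat (\<chi> i. \<omega> ^ e i))"

lemma cyclic_class_mult:
  "\<omega> \<noteq> 0 \<Longrightarrow> \<omega>' \<noteq> 0 \<Longrightarrow> cyclic_class e \<omega> \<otimes>\<^bsub>PGL\<^esub> cyclic_class e \<omega>' = cyclic_class e (\<omega> * \<omega>')"
  by (simp add: cyclic_class_def pgl_class_mult invertible_diag_mat diag_mat_mult)
    (simp add: vec_eq_iff times_vec_def power_mult_distrib)

text \<open>The quotient of the coordinates \<open>j\<close> and \<open>k\<close> is
  \<open>\<omega>\<close> itself and is unaffected by scalars. This is why a pair of consecutive
  exponents is always asked for.\<close>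

lemma cyclic_class_inj:
  assumes "e j = Suc (e k)" "\<omega> \<noteq> 0" "cyclic_class e \<omega> = cyclic_class e \<omega>'"
  shows "\<omega> = \<omega>'"
proof -
  obtain c where c: "c \<noteq> 0" "(\<chi> i. \<omega> ^ e i) = c *s (\<chi> i. \<omega>' ^ e i)"
    using assms(3) by (auto simp: cyclic_class_def pgl_class_eq_iff mat_mult_diag_mat diag_mat_eq_iff)
  hence eq: "\<omega> ^ e i = c * \<omega>' ^ e i" for i
    by (simp add: vec_eq_iff)
  have "\<omega> * \<omega> ^ e k = \<omega>' * \<omega> ^ e k"
    using eq[of j] eq[of k] assms(1) by (simp add: mult_ac)
  thus ?thesis using assms(2) by simp
qed

lemma cyclic_class_iso:
  fixes e :: "'n::finite \<Rightarrow> nat"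
  assumes n: "n > 0" and e: "e j = Suc (e k)"
  shows "subgrp {cyclic_class e \<omega> | \<omega>. \<omega> ^ n = 1} \<cong> integer_mod_group n"
proof -
  define \<zeta> where "\<zeta> x = cis (2 * pi * real_of_int x / real n)" for x
  have nz: "\<zeta> x \<noteq> 0" for x by (simp add: \<zeta>_def)
  have add: "\<zeta> (x + y) = \<zeta> x * \<zeta> y" for x y
    by (simp add: \<zeta>_def cis_mult add_divide_distrib distrib_left)
  have mult_n: "\<zeta> (int n * x) = 1" for x
    using n cis_multiple_2pi[of "of_int x"] by (simp add: \<zeta>_def mult_ac)
  have mod: "\<zeta> (x mod int n) = \<zeta> x" for x
    using add[of "int n * (x div int n)" "x mod int n"] by (simp add: mult_n)
  have bij: "bij_betw (\<lambda>k. \<zeta> (int k)) {..<n} {\<omega>. \<omega> ^ n = 1}"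
    using Complex.bij_betw_roots_unity[OF n] by (simp add: \<zeta>_def)
  have img: "\<zeta> ` {0..<int n} = {\<omega>. \<omega> ^ n = 1}"
  proof -
    have "{0..<int n} = int ` {..<n}"
      by (simp add: image_int_atLeastLessThan lessThan_atLeast0)
    thus ?thesis using bij by (simp add: bij_betw_def image_image)
  qed
  have inj: "inj_on \<zeta> {0..<int n}"
  proof (rule inj_onI)
    fix x y assume "x \<in> {0..<int n}" "y \<in> {0..<int n}" "\<zeta> x = \<zeta> y"
    hence "nat x = nat y"
      using bij by (intro inj_onD[of "\<lambda>k. \<zeta> (int k)" "{..<n}"]) (auto simp: bij_betw_def nat_less_iff)
    thus "x = y" using \<open>x \<in> _\<close> \<open>y \<in> _\<close> eq_nat_nat_iff[of x y] by auto
  qed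
  let ?h = "\<lambda>x. cyclic_class e (\<zeta> x)" and ?D = "{cyclic_class e \<omega> | \<omega>. \<omega> ^ n = 1}"
  have "?D = cyclic_class e ` \<zeta> ` {0..<int n}" unfolding img by blast
  hence "?D = ?h ` {0..<int n}" by (simp add: image_image)
  moreover have "inj_on ?h {0..<int n}"
    using cyclic_class_inj[OF e nz] inj by (auto simp: inj_on_def)
  ultimately have "?h \<in> iso (integer_mod_group n) (subgrp ?D)"
    using n by (auto simp: iso_def hom_def bij_betw_def carrier_integer_mod_group cyclic_class_mult nz mod simp flip: add)
  hence "integer_mod_group n \<cong> subgrp ?D" by (rule is_isoI)
  thus ?thesis by (rule group.iso_sym[OF group_integer_mod_group])
qed

text \<open>In the reordered coordinates each group element acts as a scalar c times powers of some
  \<open>\<omega>\<close>, and by maximality every n-th root of unity occurs. A monomial of degree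
  \<open>d\<close> takes the value c^d times a power of \<open>\<omega>\<close>, so membership in S
  is a congruence between its weighted degree and that of \<open>m\<close>.\<close>

lemma maximal_cyclic_torus:
  fixes p :: "('n::finite) cpoly" and e :: "'n \<Rightarrow> nat"
  assumes I: "associated_datum F P I" and G: "subgroup (grp I) PGL"
    and maximal: "maximal_class d (data_class d I)"
    and hom: "homogeneous d p" and smooth: "smooth_poly p"
    and keys: "\<And>m g. m \<in> Poly_Mapping.keys p \<Longrightarrow> g \<in> grp I \<Longrightarrow> monomial_value m (\<chi> i. chrs I i g) = chr I g"
    and n: "n > 0" and \<sigma>: "\<sigma> permutes UNIV"
    and torus: "\<And>t. t \<in> eigen_torus p \<longleftrightarrow> (\<exists>c \<omega>. c \<noteq> 0 \<and> \<omega> ^ n = 1 \<and> (\<forall>i. t $ \<sigma> i = c * \<omega> ^ e i))"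
    and m: "m \<in> Poly_Mapping.keys p"
  shows "diag_group (permute_datum \<sigma> I) = {cyclic_class e \<omega> | \<omega>. \<omega> ^ n = 1}"
    and "S_of d (permute_datum \<sigma> I) = {\<Prod>i\<in>UNIV. X i ^ \<alpha> i | \<alpha>. (\<Sum>i\<in>UNIV. \<alpha> i) = d \<and>
      (\<Sum>i\<in>UNIV. e i * \<alpha> i) mod n = (\<Sum>i\<in>UNIV. e i * Poly_Mapping.lookup m (\<sigma> i)) mod n}"
proof -
  have P: "invertible P" using I by (simp add: associated_datum_def)
  \<comment> \<open>The weights \<open>e\<close> are indexed by the reordered coordinates, the
    entries of torus vectors by the original ones; hence the inverse permutation.\<close>
  define ev where "ev \<omega> = (\<chi> i. \<omega> ^ e (inv_into UNIV \<sigma> i))" for \<omega> :: complex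
  have ev: "ev \<omega> $ \<sigma> i = \<omega> ^ e i" for \<omega> i
    using permutes_inverses[OF \<sigma>] by (simp add: ev_def)
  have eqI: "s = t" if "\<And>i. s $ \<sigma> i = t $ \<sigma> i" for s t :: "complex^'n"
    using that permutes_surj[OF \<sigma>] by (metis surjD vec_eq_iff)
  have "torus_class P ` eigen_torus p \<subseteq> (\<lambda>\<omega>. torus_class P (ev \<omega>)) ` {\<omega>. \<omega> ^ n = 1}"
  proof
    fix h assume "h \<in> torus_class P ` eigen_torus p"
    then obtain t c \<omega> where t: "h = torus_class P t" "c \<noteq> 0" "\<omega> ^ n = 1" "\<And>i. t $ \<sigma> i = c * \<omega> ^ e i"
      using torus by blast
    hence "t = c *s ev \<omega>" by (intro eqI) (simp add: ev)
    hence "h = torus_class P (ev \<omega>)"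
      using t(2) unfolding t(1) torus_class_eq_iff[OF P] by blast
    thus "h \<in> (\<lambda>\<omega>. torus_class P (ev \<omega>)) ` {\<omega>. \<omega> ^ n = 1}" using t(3) by blast
  qed
  hence fin: "finite (torus_class P ` eigen_torus p)"
    by (rule finite_subset) (intro finite_imageI finite_roots_unity, use n in simp)
  note max = maximal_grp_eq_torus[OF I G maximal hom smooth fin keys]
  have ofg: "\<exists>c \<omega>. c \<noteq> 0 \<and> \<omega> ^ n = 1 \<and> (\<forall>i. chrs I (\<sigma> i) g = c * \<omega> ^ e i)" if "g \<in> grp I" for g
    using max(1)[OF _ _ that] torus by simp
  have of\<omega>: "\<exists>g\<in>grp I. \<exists>c. c \<noteq> 0 \<and> (\<forall>i. chrs I (\<sigma> i) g = c * \<omega> ^ e i)" if "\<omega> ^ n = 1" for \<omega>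
  proof -
    have "ev \<omega> \<in> eigen_torus p"
      unfolding torus using that ev by (intro exI[of _ 1] exI[of _ \<omega>]) simp
    hence g: "torus_class P (ev \<omega>) \<in> grp I" using max(2) by simp
    have "torus_class P (\<chi> i. chrs I i (torus_class P (ev \<omega>))) = torus_class P (ev \<omega>)"
      using associated_datum_grp[OF I g] by simp
    then obtain c where "c \<noteq> 0" "(\<chi> i. chrs I i (torus_class P (ev \<omega>))) = c *s ev \<omega>"
      using P by (auto simp: torus_class_eq_iff)
    hence "c \<noteq> 0 \<and> (\<forall>i. chrs I (\<sigma> i) (torus_class P (ev \<omega>)) = c * \<omega> ^ e i)"
      by (simp add: vec_eq_iff flip: ev)
    thus ?thesis using g by blast
  qed
  have same: "pgl_class (diag_mat (\<chi> i. chrs I (\<sigma> i) g)) = cyclic_class e \<omega>"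
    if "c \<noteq> 0" "\<forall>i. chrs I (\<sigma> i) g = c * \<omega> ^ e i" for g c \<omega>
  proof -
    have "(\<chi> i. chrs I (\<sigma> i) g) = c *s (\<chi> i. \<omega> ^ e i)"
      using that(2) by (simp add: vec_eq_iff)
    thus ?thesis
      using that(1) unfolding cyclic_class_def pgl_class_eq_iff mat_mult_diag_mat by metis
  qed
  show "diag_group (permute_datum \<sigma> I) = {cyclic_class e \<omega> | \<omega>. \<omega> ^ n = 1}"
  proof (intro equalityI subsetI)
    fix h assume "h \<in> diag_group (permute_datum \<sigma> I)"
    then obtain g where "g \<in> grp I" "h = pgl_class (diag_mat (\<chi> i. chrs I (\<sigma> i) g))"
      by (auto simp: diag_group_def permute_datum_def)
    thus "h \<in> {cyclic_class e \<omega> | \<omega>. \<omega> ^ n = 1}" using ofg same by blast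
  next
    fix h assume "h \<in> {cyclic_class e \<omega> | \<omega>. \<omega> ^ n = 1}"
    then obtain \<omega> where \<omega>: "h = cyclic_class e \<omega>" "\<omega> ^ n = 1" by blast
    obtain g c where g: "g \<in> grp I" "c \<noteq> 0" "\<forall>i. chrs I (\<sigma> i) g = c * \<omega> ^ e i"
      using of\<omega>[OF \<omega>(2)] by blast
    have "h = pgl_class (diag_mat (\<chi> i. chrs I (\<sigma> i) g))" using same[OF g(2,3)] \<omega>(1) by simp
    thus "h \<in> diag_group (permute_datum \<sigma> I)"
      using g(1) unfolding diag_group_def permute_datum_def by auto
  qed
  have deg: "(\<Sum>i\<in>UNIV. Poly_Mapping.lookup m (\<sigma> i)) = d"
    using hom m sum.reindex_bij_betw[OF permutes_imp_bij[OF \<sigma>], of "Poly_Mapping.lookup m"]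
    by (simp add: homogeneous_def)
  have val: "chr I g = c ^ d * \<omega> ^ (\<Sum>i\<in>UNIV. e i * Poly_Mapping.lookup m (\<sigma> i))"
    if "g \<in> grp I" "\<forall>i. chrs I (\<sigma> i) g = c * \<omega> ^ e i" for g c \<omega>
  proof -
    have "chr I g = (\<Prod>i\<in>UNIV. chrs I i g ^ Poly_Mapping.lookup m i)"
      using keys[OF m that(1)] by (simp add: monomial_value_def)
    also have "\<dots> = (\<Prod>i\<in>UNIV. chrs I (\<sigma> i) g ^ Poly_Mapping.lookup m (\<sigma> i))"
      by (rule prod.reindex_bij_betw[OF permutes_imp_bij[OF \<sigma>], symmetric])
    finally show ?thesis
      using that(2) by (simp add: power_mult_distrib prod.distrib power_sum deg flip: power_mult)
        (simp flip: deg add: power_sum)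
  qed
  have val2: "(\<Prod>i\<in>UNIV. chrs I (\<sigma> i) g ^ \<alpha> i) = c ^ (\<Sum>i\<in>UNIV. \<alpha> i) * \<omega> ^ (\<Sum>i\<in>UNIV. e i * \<alpha> i)"
    if "\<forall>i. chrs I (\<sigma> i) g = c * \<omega> ^ e i" for g c \<omega> \<alpha>
    using that by (simp add: power_mult_distrib prod.distrib power_sum flip: power_mult)
  have "(\<forall>g\<in>grp I. chr I g = (\<Prod>i\<in>UNIV. chrs I (\<sigma> i) g ^ \<alpha> i)) \<longleftrightarrow>
      (\<Sum>i\<in>UNIV. e i * \<alpha> i) mod n = (\<Sum>i\<in>UNIV. e i * Poly_Mapping.lookup m (\<sigma> i)) mod n" (is "?L \<longleftrightarrow> ?R")
    if \<alpha>: "(\<Sum>i\<in>UNIV. \<alpha> i) = d" for \<alpha>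
  proof
    assume L: ?L
    have "\<omega> ^ (\<Sum>i\<in>UNIV. e i * \<alpha> i) = \<omega> ^ (\<Sum>i\<in>UNIV. e i * Poly_Mapping.lookup m (\<sigma> i))" if "\<omega> ^ n = 1" for \<omega> :: complex
    proof -
      obtain g c where g: "g \<in> grp I" "c \<noteq> 0" "\<forall>i. chrs I (\<sigma> i) g = c * \<omega> ^ e i" using of\<omega>[OF \<open>\<omega> ^ n = 1\<close>] by blast
      thus ?thesis using L val[OF g(1,3)] val2[OF g(3), of \<alpha>] \<alpha> by simp
    qed
    thus ?R unfolding roots_of_unity_power_eq_iff[OF n, symmetric] by blast
  next
    assume R: ?R
    show ?L
    proof
      fix g assume g: "g \<in> grp I"
      obtain c \<omega> where c: "c \<noteq> 0" "\<omega> ^ n = 1" "\<forall>i. chrs I (\<sigma> i) g = c * \<omega> ^ e i" using ofg[OF g] by blast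
      thus "chr I g = (\<Prod>i\<in>UNIV. chrs I (\<sigma> i) g ^ \<alpha> i)"
        using R val[OF g c(3)] val2[OF c(3), of \<alpha>] \<alpha> unfolding roots_of_unity_power_eq_iff[OF n, symmetric] by simp
    qed
  qed
  thus "S_of d (permute_datum \<sigma> I) = {\<Prod>i\<in>UNIV. X i ^ \<alpha> i | \<alpha>. (\<Sum>i\<in>UNIV. \<alpha> i) = d \<and>
      (\<Sum>i\<in>UNIV. e i * \<alpha> i) mod n = (\<Sum>i\<in>UNIV. e i * Poly_Mapping.lookup m (\<sigma> i)) mod n}"
    unfolding S_of_def by (intro Collect_cong) (auto simp: permute_datum_def)
qed

section \<open>Quartic monomials in four variables\<close>

lemma monomial_value_quad: "monomial_value (quad w x y z) t = t $ w * t $ x * t $ y * t $ z"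
proof -
  have "monomial_value (quad w x y z) t = poly_eval (X w * X x * X y * X z) t"
    unfolding monomial_quad by (simp add: poly_eval_single monomial_value_def)
  thus ?thesis by (simp add: poly_eval_mult)
qed

lemma vector_4 [simp]:
  "(vector [w, x, y, z] :: ('a::zero)^4) $ 1 = w"
  "(vector [w, x, y, z] :: ('a::zero)^4) $ 2 = x"
  "(vector [w, x, y, z] :: ('a::zero)^4) $ 3 = y"
  "(vector [w, x, y, z] :: ('a::zero)^4) $ 4 = z"
  unfolding vector_def by simp_all

text \<open>A list, so that the 35 exponent vectors can be filtered by evaluation.\<close>

definition quartic_exponents :: "(nat \<times> nat \<times> nat \<times> nat) list" where
  "quartic_exponents = [(a, b, c, 4 - a - b - c). a \<leftarrow> [0..<5], b \<leftarrow> [0..<5 - a], c \<leftarrow> [0..<5 - a - b]]"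

lemma set_quartic_exponents: "set quartic_exponents = {(a, b, c, d). a + b + c + d = 4}"
proof -
  have "\<exists>x\<in>{0..<5}. \<exists>y\<in>{0..<5 - x}. (a, b, c, d) \<in> (\<lambda>z. (x, y, z, 4 - x - y - z)) ` {0..<5 - x - y}"
    if "a + b + c + d = 4" for a b c d :: nat
    using that by (intro bexI[of _ a] bexI[of _ b] image_eqI[of _ _ c]) auto
  thus ?thesis unfolding quartic_exponents_def by (auto simp: image_iff)
qed

lemma prod_UNIV_4: "(\<Prod>i\<in>UNIV. f (i :: 4)) = f 1 * f 2 * f 3 * (f 4 :: 'a::comm_monoid_mult)"
  unfolding UNIV_4 by (simp add: mult.assoc)

lemma quartic_monomials:
  "{\<Prod>i\<in>UNIV. X i ^ \<alpha> i | \<alpha> :: 4 \<Rightarrow> nat. (\<Sum>i\<in>UNIV. \<alpha> i) = 4 \<and> Q (\<alpha> 1) (\<alpha> 2) (\<alpha> 3) (\<alpha> 4)} =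
   (\<lambda>(a, b, c, d). X 1 ^ a * X 2 ^ b * X 3 ^ c * X 4 ^ d) ` set (filter (\<lambda>(a, b, c, d). Q a b c d) quartic_exponents)"
  (is "?L = ?R")
proof (intro equalityI subsetI)
  fix q assume "q \<in> ?L"
  then obtain \<alpha> :: "4 \<Rightarrow> nat" where "q = (\<Prod>i\<in>UNIV. X i ^ \<alpha> i)" "(\<Sum>i\<in>UNIV. \<alpha> i) = 4" "Q (\<alpha> 1) (\<alpha> 2) (\<alpha> 3) (\<alpha> 4)"
    by blast
  thus "q \<in> ?R"
    by (intro image_eqI[of _ _ "(\<alpha> 1, \<alpha> 2, \<alpha> 3, \<alpha> 4)"]) (auto simp: prod_UNIV_4 set_quartic_exponents sum_4)
next
  fix q assume "q \<in> ?R"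
  then obtain a b c d where q: "q = X 1 ^ a * X 2 ^ b * X 3 ^ c * X 4 ^ d" "a + b + c + d = 4" "Q a b c d"
    by (auto simp: set_quartic_exponents)
  let ?\<alpha> = "($) (vector [a, b, c, d] :: nat^4)"
  have "q = (\<Prod>i\<in>UNIV. X i ^ ?\<alpha> i)" "(\<Sum>i\<in>UNIV. ?\<alpha> i) = 4" "Q (?\<alpha> 1) (?\<alpha> 2) (?\<alpha> 3) (?\<alpha> 4)"
    unfolding prod_UNIV_4 using q by (simp_all add: sum_4)
  thus "q \<in> ?L" by blast
qed

lemma distinct4_UNIV: "distinct [p, q, r, s] \<Longrightarrow> (UNIV :: 4 set) = {p, q, r, s}"
  by (rule card_subset_eq[symmetric]) auto

lemma permutation4_exists:
  assumes "distinct [p, q, r, s :: 4]"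
  obtains \<sigma> where "\<sigma> permutes UNIV" "\<sigma> 1 = p" "\<sigma> 2 = q" "\<sigma> 3 = r" "\<sigma> 4 = s"
proof -
  let ?\<sigma> = "($) (vector [p, q, r, s] :: 4^4)"
  have "surj ?\<sigma>"
  unfolding surj_def
  proof
    fix y :: 4
    have "y \<in> {p, q, r, s}" using distinct4_UNIV[OF assms] by auto
    thus "\<exists>x. y = ?\<sigma> x" by (metis empty_iff insert_iff vector_4)
  qed
  hence "bij ?\<sigma>" by (simp add: bij_def finite_UNIV_surj_inj)
  hence "?\<sigma> permutes UNIV" by (rule bij_imp_permutes) simp
  thus ?thesis by (rule that) simp_all
qed

text \<open>By homogeneity the torus equations need to be solved only for vectors with one
  coordinate equal to 1 (\<open>param\<close>), in accordance with \<open>e $ z = 0\<close>. The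
  converse \<open>member\<close> is a comparison of weights modulo \<open>n\<close>.\<close>

lemma maximal_quartic_torus:
  fixes p :: "4 cpoly" and e :: "nat^4"
  assumes I: "associated_datum F P I" and G: "subgroup (grp I) PGL"
    and maximal: "maximal_class 4 (data_class 4 I)"
    and hom: "homogeneous 4 p" and smooth: "smooth_poly p"
    and keys: "\<And>m g. m \<in> Poly_Mapping.keys p \<Longrightarrow> g \<in> grp I \<Longrightarrow> monomial_value m (\<chi> i. chrs I i g) = chr I g"
    and n: "n > 0" and \<sigma>: "\<sigma> permutes UNIV" and e: "e $ z = 0" "e $ j = Suc (e $ k)"
    and param: "\<forall>t. (\<forall>i. t $ i \<noteq> 0) \<and> t $ \<sigma> z = 1 \<and>
      (\<forall>m\<in>Poly_Mapping.keys p. \<forall>m'\<in>Poly_Mapping.keys p. monomial_value m t = monomial_value m' t) \<longrightarrow>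
      (\<exists>\<omega>. \<omega> ^ n = 1 \<and> (\<forall>i. t $ \<sigma> i = \<omega> ^ (e $ i)))"
    and member: "\<forall>t \<omega>. \<omega> ^ n = 1 \<and> (\<forall>i. t $ \<sigma> i = \<omega> ^ (e $ i)) \<longrightarrow>
      (\<forall>m\<in>Poly_Mapping.keys p. monomial_value m t = \<omega> ^ r)"
    and r: "base \<in> Poly_Mapping.keys p" "(\<Sum>i\<in>UNIV. e $ i * Poly_Mapping.lookup base (\<sigma> i)) = r"
  shows "diag_group (permute_datum \<sigma> I) = {cyclic_class (($) e) \<omega> | \<omega>. \<omega> ^ n = 1}"
    and "subgrp (diag_group (permute_datum \<sigma> I)) \<cong> integer_mod_group n"
    and "S_of 4 (permute_datum \<sigma> I) = (\<lambda>(a, b, c, d). X 1 ^ a * X 2 ^ b * X 3 ^ c * X 4 ^ d) `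
      set (filter (\<lambda>(a, b, c, d). (e $ 1 * a + e $ 2 * b + e $ 3 * c + e $ 4 * d) mod n = r mod n) quartic_exponents)"
proof -
  have torus: "t \<in> eigen_torus p \<longleftrightarrow> (\<exists>c \<omega>. c \<noteq> 0 \<and> \<omega> ^ n = 1 \<and> (\<forall>i. t $ \<sigma> i = c * \<omega> ^ (e $ i)))" for t
  proof
    assume t: "t \<in> eigen_torus p"
    have nz: "t $ \<sigma> z \<noteq> 0" using t by (rule eigen_torus_nonzero)
    define s where "s = inverse (t $ \<sigma> z) *s t"
    have s: "s \<in> eigen_torus p" unfolding s_def using eigen_torus_scale[OF hom t] nz by simp
    have "\<exists>\<omega>. \<omega> ^ n = 1 \<and> (\<forall>i. s $ \<sigma> i = \<omega> ^ (e $ i))"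
    proof (rule param[rule_format], intro conjI allI ballI)
      show "s $ \<sigma> z = 1" using nz by (simp add: s_def)
    qed (erule eigen_torusD[OF s] | rule eigen_torus_nonzero[OF s])+
    then obtain \<omega> where "\<omega> ^ n = 1" "\<And>i. s $ \<sigma> i = \<omega> ^ (e $ i)" by blast
    moreover have "t $ i = t $ \<sigma> z * s $ i" for i using nz by (simp add: s_def)
    ultimately show "\<exists>c \<omega>. c \<noteq> 0 \<and> \<omega> ^ n = 1 \<and> (\<forall>i. t $ \<sigma> i = c * \<omega> ^ (e $ i))"
      using nz by metis
  next
    assume "\<exists>c \<omega>. c \<noteq> 0 \<and> \<omega> ^ n = 1 \<and> (\<forall>i. t $ \<sigma> i = c * \<omega> ^ (e $ i))"
    then obtain c \<omega> where c: "c \<noteq> 0" "\<omega> ^ n = 1" "\<And>i. t $ \<sigma> i = c * \<omega> ^ (e $ i)" by blast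
    define s where "s = inverse c *s t"
    have s: "s $ \<sigma> i = \<omega> ^ (e $ i)" for i using c by (simp add: s_def)
    have "\<omega> \<noteq> 0" using c(2) n by (metis zero_power zero_neq_one)
    moreover have "\<exists>i'. i = \<sigma> i'" for i using permutes_surj[OF \<sigma>] by (metis surjD)
    ultimately have "s $ i \<noteq> 0" for i using s by (metis power_not_zero)
    hence "s \<in> eigen_torus p" using member c(2) s by (intro eigen_torusI) blast+
    hence "c *s s \<in> eigen_torus p" using c(1) by (intro eigen_torus_scale[OF hom])
    thus "t \<in> eigen_torus p" using c(1) by (simp add: s_def vector_smult_assoc)
  qed
  note res = maximal_cyclic_torus[OF I G maximal hom smooth keys n \<sigma> torus r(1)]
  show D: "diag_group (permute_datum \<sigma> I) = {cyclic_class (($) e) \<omega> | \<omega>. \<omega> ^ n = 1}" using res(1) .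
  show "subgrp (diag_group (permute_datum \<sigma> I)) \<cong> integer_mod_group n"
    unfolding D using cyclic_class_iso[OF n e(2)] .
  show "S_of 4 (permute_datum \<sigma> I) = (\<lambda>(a, b, c, d). X 1 ^ a * X 2 ^ b * X 3 ^ c * X 4 ^ d) `
      set (filter (\<lambda>(a, b, c, d). (e $ 1 * a + e $ 2 * b + e $ 3 * c + e $ 4 * d) mod n = r mod n) quartic_exponents)"
    using quartic_monomials[of "\<lambda>a b c d. (e $ 1 * a + e $ 2 * b + e $ 3 * c + e $ 4 * d) mod n = r mod n"]
      res(2)[unfolded r(2)] by (simp only: sum_4)
qed

lemma eq_one_of_square_cube: "u^2 = 1 \<Longrightarrow> u^3 = 1 \<Longrightarrow> u = (1 :: 'a::monoid_mult)"
  by (simp add: power2_eq_square power3_eq_cube)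

text \<open>Here and in the next four lemmas the variables are the coordinates of a torus vector
  whose remaining coordinate is 1, and the hypotheses equate the monomials of an exceptional
  quartic. In this case they amount to w^2 = 1, z = yw and y^2 z = 1.\<close>

lemma root6_outer:
  fixes y z w :: complex
  assumes "y \<noteq> 0" "z * w = y" "w^2 * y = y" "y^3 * z = y"
  shows "y^6 = 1 \<and> z = y^4 \<and> w = y^3"
proof -
  have w: "w^2 = 1" using assms(1,3) by simp
  have "y * (y^2 * z - 1) = 0" using assms(4) by (simp add: algebra_simps power2_eq_square power3_eq_cube)
  hence yz: "y^2 * z = 1" using assms(1) by simp
  have "z * w^2 = y * w" using assms(2) by (simp add: power2_eq_square flip: mult.assoc)
  hence z: "z = y * w" using w by simp
  have "y^3 * w = 1" using yz z by (simp add: power3_eq_cube power2_eq_square mult_ac)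
  moreover have "y^3 * w^2 = (y^3 * w) * w" by (simp add: power2_eq_square mult.assoc)
  ultimately have wy: "w = y^3" using w by simp
  have "y^6 = (y^3)^2" "y^4 = y * y^3" by (simp_all flip: power_mult power_Suc)
  thus ?thesis using w z wy by simp
qed

text \<open>w is inverse to y and z = w^2, after which z^2 w = y says w^6 = 1.\<close>

lemma root6_inner:
  fixes y z w :: complex
  assumes "y \<noteq> 0" "y^2 * w = y" "z^2 * w = y" "y^3 * z = y"
  shows "y^6 = 1 \<and> z = y^4 \<and> w = y^5"
proof -
  have "y * (y * w - 1) = 0" using assms(2) by (simp add: algebra_simps power2_eq_square)
  hence yw: "y * w = 1" using assms(1) by simp
  have "y * (y^2 * z - 1) = 0" using assms(4) by (simp add: algebra_simps power2_eq_square power3_eq_cube)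
  hence yz: "y^2 * z = 1" using assms(1) by simp
  have "(y^2 * z) * w^2 = z * (y * w)^2" by (simp add: power_mult_distrib mult_ac)
  hence z: "z = w^2" using yw yz by simp
  have y: "y = w^5" using assms(3) z by (simp flip: power_mult power_Suc2)
  have w6: "w^6 = 1" using yw y by (simp flip: power_Suc2)
  have "y^6 = (w^6)^5" "y^4 = (w^6)^3 * w^2" "y^5 = (w^6)^4 * w"
    unfolding y by (simp_all flip: power_mult power_add power_Suc2)
  thus ?thesis using w6 z by simp
qed

lemma root9_chain:
  fixes x y w :: complex
  assumes "w^3 * y = 1" "x^3 * y = 1" "y^3 = 1" "w^2 * x = 1"
  shows "x^9 = 1 \<and> y = x^6 \<and> w = x^4"
proof -
  have "(x^3 * y)^3 = x^9 * y^3" "x^6 * (x^3 * y) = x^9 * y" "x^4 = x^3 * x"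
    by (simp_all add: power_mult_distrib flip: power_mult power_add power_Suc2 mult.assoc)
  moreover have "w^3 * (x^3 * y) = x^3 * (w^3 * y)" "w * (w^2 * x) = w^3 * x"
    by (simp_all add: power3_eq_cube power2_eq_square mult_ac)
  ultimately show ?thesis using assms by simp
qed

text \<open>Both the square and the cube of yw are 1, so w is inverse to y, as is x^3.\<close>

lemma root9_tail:
  fixes x y w :: complex
  assumes "x^3 * y = 1" "y^3 = 1" "w^3 = 1" "y^2 * w^2 = 1"
  shows "x^9 = 1 \<and> y = x^6 \<and> w = x^3"
proof -
  have "(y * w)^2 = 1" using assms(4) by (simp add: power_mult_distrib)
  moreover have "(y * w)^3 = 1" using assms(2,3) by (simp add: power_mult_distrib)
  ultimately have "y * w = 1" by (rule eq_one_of_square_cube)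
  moreover have "w * (x^3 * y) = x^3 * (y * w)" by (simp add: mult_ac)
  ultimately have w: "w = x^3" using assms(1) by simp
  have "(x^3 * y)^3 = x^9 * y^3" by (simp add: power_mult_distrib flip: power_mult)
  hence x: "x^9 = 1" using assms(1,2) by simp
  have "x^6 * (x^3 * y) = x^9 * y" by (simp flip: power_add mult.assoc)
  hence "y = x^6" using assms(1) x by simp
  thus ?thesis using w x by simp
qed

text \<open>x is a cube root of unity and w a fourth root. The generator is \<open>x * w^3\<close>,
  since its fourth power is x^4 w^12 = x and its cube is x^3 w^9 = w; moreover z is inverse to
  x.\<close>

lemma root12:
  fixes x z w :: complex
  assumes "x^3 = 1" "z^3 = 1" "x^2 * z^2 = 1" "w^4 = 1"
  shows "(x * w^3)^12 = 1 \<and> x = (x * w^3)^4 \<and> z = (x * w^3)^8 \<and> w = (x * w^3)^3"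
proof -
  have "(x * z)^2 = 1" using assms(3) by (simp add: power_mult_distrib)
  moreover have "(x * z)^3 = 1" using assms(1,2) by (simp add: power_mult_distrib)
  ultimately have "x * z = 1" by (rule eq_one_of_square_cube)
  moreover have "z * x^3 = x^2 * (x * z)" by (simp add: power3_eq_cube power2_eq_square mult_ac)
  ultimately have z: "z = x^2" using assms(1) by simp
  have "x^12 = (x^3)^4" "x^4 = x^3 * x" "x^8 = (x^3)^2 * x^2"
    "w^36 = (w^4)^9" "w^12 = (w^4)^3" "w^24 = (w^4)^6" "w^9 = (w^4)^2 * w"
    by (simp_all flip: power_mult power_add power_Suc2)
  moreover have "(x * w^3)^k = x^k * w^(3 * k)" for k
    by (simp add: power_mult_distrib power_mult)
  ultimately show ?thesis using assms(1,4) z by simp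
qed

lemma cyclic_class_4:
  "cyclic_class (($) (vector [a, b, c, d] :: nat^4)) \<omega> = pgl_class (diag_mat (vector [\<omega>^a, \<omega>^b, \<omega>^c, \<omega>^d]))"
  unfolding cyclic_class_def by (rule arg_cong[of _ _ "\<lambda>v. pgl_class (diag_mat v)"]) (simp add: vec_eq_iff forall_4)

section \<open>The five exceptional cases\<close>

locale maximal_quartic_datum =
  fixes F :: "4 cpoly" and P and I :: "4 datum" and \<sigma> :: "4 \<Rightarrow> 4"
  assumes assoc: "associated_datum F P I" and sub: "subgroup (grp I) PGL"
    and maximal: "maximal_class 4 (data_class 4 I)" and perm: "\<sigma> permutes UNIV"
begin

definition eigen_monomial :: "4 \<times> 4 \<times> 4 \<times> 4 \<Rightarrow> bool" where
  "eigen_monomial = (\<lambda>(w, x, y, z). \<forall>g\<in>grp I.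
     chrs I (\<sigma> w) g * chrs I (\<sigma> x) g * chrs I (\<sigma> y) g * chrs I (\<sigma> z) g = chr I g)"

abbreviation D :: "4 pgl set" where "D \<equiv> diag_group (permute_datum \<sigma> I)"

lemma \<sigma>_inj: "\<sigma> x = \<sigma> y \<longleftrightarrow> x = y"
  using permutes_inj[OF perm] by (simp add: inj_eq)

text \<open>Removes \<open>\<sigma>\<close> from the computation: \<open>Q\<close> lists the support
  of \<open>p\<close> by positions in the reordered coordinates, so the weights, the torus equations
  and the final list concern fixed numerals and can be checked by simplification or
  evaluation.\<close>

lemma exceptional:
  fixes e :: "nat^4"
  assumes hom: "homogeneous 4 p" and smooth: "smooth_poly p"
    and keys: "Poly_Mapping.keys p = (\<lambda>(w, x, y, z). quad (\<sigma> w) (\<sigma> x) (\<sigma> y) (\<sigma> z)) ` Q"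
    and eigen: "\<forall>m\<in>Q. eigen_monomial m"
    and n: "n > 0" and e: "e $ h = 0" "e $ j = Suc (e $ k)"
    and base: "(w', x', y', z') \<in> Q" "r = e $ w' + e $ x' + e $ y' + e $ z'"
    and weight: "\<forall>(w, x, y, z)\<in>Q. (e $ w + e $ x + e $ y + e $ z) mod n = r mod n"
    and param: "\<forall>s :: complex^4. (\<forall>i. s $ i \<noteq> 0) \<and> s $ h = 1 \<and>
      (\<forall>(w, x, y, z)\<in>Q. s $ w * s $ x * s $ y * s $ z = s $ w' * s $ x' * s $ y' * s $ z') \<longrightarrow>
      (\<exists>\<omega>. \<omega> ^ n = 1 \<and> (\<forall>i. s $ i = \<omega> ^ (e $ i)))"
    and filt: "filter (\<lambda>(a, b, c, d). (e $ 1 * a + e $ 2 * b + e $ 3 * c + e $ 4 * d) mod n = r mod n) quartic_exponents = E"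
  shows "D = {cyclic_class (($) e) \<omega> | \<omega>. \<omega> ^ n = 1}" "subgrp D \<cong> integer_mod_group n"
    "S_of 4 (permute_datum \<sigma> I) = (\<lambda>(a, b, c, d). X 1 ^ a * X 2 ^ b * X 3 ^ c * X 4 ^ d) ` set E"
proof -
  let ?q = "\<lambda>w x y z. quad (\<sigma> w) (\<sigma> x) (\<sigma> y) (\<sigma> z)"
  have key: "monomial_value m (\<chi> i. chrs I i g) = chr I g" if "m \<in> Poly_Mapping.keys p" "g \<in> grp I" for m g
    using that eigen unfolding keys eigen_monomial_def by (auto simp: monomial_value_quad)
  have param': "\<forall>t. (\<forall>i. t $ i \<noteq> 0) \<and> t $ \<sigma> h = 1 \<and>
      (\<forall>m\<in>Poly_Mapping.keys p. \<forall>m'\<in>Poly_Mapping.keys p. monomial_value m t = monomial_value m' t) \<longrightarrow>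
      (\<exists>\<omega>. \<omega> ^ n = 1 \<and> (\<forall>i. t $ \<sigma> i = \<omega> ^ (e $ i)))"
  proof (intro allI impI, elim conjE)
    fix t :: "complex^4"
    assume nz: "\<forall>i. t $ i \<noteq> 0" and one: "t $ \<sigma> h = 1"
      and eq: "\<forall>m\<in>Poly_Mapping.keys p. \<forall>m'\<in>Poly_Mapping.keys p. monomial_value m t = monomial_value m' t"
    define s where "s = (\<chi> i. t $ \<sigma> i)"
    have "s $ w * s $ x * s $ y * s $ z = s $ w' * s $ x' * s $ y' * s $ z'"
      if "(w, x, y, z) \<in> Q" for w x y z
    proof -
      have "?q w x y z \<in> Poly_Mapping.keys p" "?q w' x' y' z' \<in> Poly_Mapping.keys p"
        unfolding keys using that base(1) by force+
      hence "monomial_value (?q w x y z) t = monomial_value (?q w' x' y' z') t" using eq by blast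
      thus ?thesis by (simp add: monomial_value_quad s_def)
    qed
    hence "\<exists>\<omega>. \<omega> ^ n = 1 \<and> (\<forall>i. s $ i = \<omega> ^ (e $ i))"
      using nz one by (intro param[rule_format]) (auto simp: s_def)
    thus "\<exists>\<omega>. \<omega> ^ n = 1 \<and> (\<forall>i. t $ \<sigma> i = \<omega> ^ (e $ i))" by (simp add: s_def)
  qed
  have member: "\<forall>t \<omega>. \<omega> ^ n = 1 \<and> (\<forall>i. t $ \<sigma> i = \<omega> ^ (e $ i)) \<longrightarrow>
      (\<forall>m\<in>Poly_Mapping.keys p. monomial_value m t = \<omega> ^ r)"
  proof (intro allI impI ballI, elim conjE)
    fix t :: "complex^4" and \<omega> m assume \<omega>: "\<omega> ^ n = 1" and t: "\<forall>i. t $ \<sigma> i = \<omega> ^ (e $ i)" and m: "m \<in> Poly_Mapping.keys p"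
    obtain w x y z where q: "(w, x, y, z) \<in> Q" "m = ?q w x y z" using m unfolding keys by auto
    have "monomial_value m t = \<omega> ^ (e $ w + e $ x + e $ y + e $ z)"
      unfolding q(2) by (simp add: monomial_value_quad t power_add)
    moreover have "(e $ w + e $ x + e $ y + e $ z) mod n = r mod n" using weight q(1) by blast
    hence "\<omega> ^ (e $ w + e $ x + e $ y + e $ z) = \<omega> ^ r"
      using \<omega> unfolding roots_of_unity_power_eq_iff[OF n, symmetric] by blast
    ultimately show "monomial_value m t = \<omega> ^ r" by simp
  qed
  have base': "?q w' x' y' z' \<in> Poly_Mapping.keys p" unfolding keys using base(1) by force
  have r: "(\<Sum>i\<in>UNIV. e $ i * Poly_Mapping.lookup (?q w' x' y' z') (\<sigma> i)) = r"
    by (simp add: lookup_quad \<sigma>_inj distrib_left sum.distrib base(2) of_bool_def if_distrib[of "(*) _"] sum.delta cong: if_cong)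
  note res = maximal_quartic_torus[where e = e and r = r and base = "?q w' x' y' z'", OF assoc sub maximal hom smooth key n perm e param' member base' r]
  show "D = {cyclic_class (($) e) \<omega> | \<omega>. \<omega> ^ n = 1}" "subgrp D \<cong> integer_mod_group n"
    using res(1,2) by auto
  show "S_of 4 (permute_datum \<sigma> I) = (\<lambda>(a, b, c, d). X 1 ^ a * X 2 ^ b * X 3 ^ c * X 4 ^ d) ` set E"
    using res(3) filt by simp
qed

lemma \<sigma>_distinct: "distinct [\<sigma> 1, \<sigma> 2, \<sigma> 3, \<sigma> 4]"
  by (simp add: \<sigma>_inj)

text \<open>Closure under the combination a + b - c of exponents: the identity for all
  \<open>f\<close> says that monomials d and c have the same product as a and b, and
  \<open>chr I g\<close> can be cancelled because it is nonzero.\<close>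

lemma eigen_monomial_exchange:
  assumes "eigen_monomial (a1, a2, a3, a4)" "eigen_monomial (b1, b2, b3, b4)" "eigen_monomial (c1, c2, c3, c4)"
    and "\<And>f :: 4 \<Rightarrow> complex. f d1 * f d2 * f d3 * f d4 * (f c1 * f c2 * f c3 * f c4) =
      f a1 * f a2 * f a3 * f a4 * (f b1 * f b2 * f b3 * f b4)"
  shows "eigen_monomial (d1, d2, d3, d4)"
  unfolding eigen_monomial_def prod.case
proof
  fix g assume g: "g \<in> grp I"
  have "chr I g \<noteq> 0" using assoc g characters_nonzero unfolding associated_datum_def by blast
  moreover have "chrs I (\<sigma> d1) g * chrs I (\<sigma> d2) g * chrs I (\<sigma> d3) g * chrs I (\<sigma> d4) g * chr I g = chr I g * chr I g"
    using assms(1-3) assms(4)[of "\<lambda>i. chrs I (\<sigma> i) g"] g by (simp add: eigen_monomial_def)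
  ultimately show "chrs I (\<sigma> d1) g * chrs I (\<sigma> d2) g * chrs I (\<sigma> d3) g * chrs I (\<sigma> d4) g = chr I g"
    by simp
qed

lemma exceptional1:
  assumes "eigen_monomial (1, 1, 1, 2)" "eigen_monomial (3, 3, 3, 2)" "eigen_monomial (2, 2, 2, 3)"
    "eigen_monomial (4, 4, 4, 3)" "eigen_monomial (1, 1, 3, 4)"
  shows "D = {pgl_class (diag_mat (vector [1, \<omega>, \<omega>^4, \<omega>^3])) | \<omega>. \<omega>^6 = 1}"
    "subgrp D \<cong> integer_mod_group 6"
    "S_of 4 (permute_datum \<sigma> I) = {X 1^3 * X 2, X 1^2 * X 3 * X 4, X 1 * X 2 * X 4^2,
       X 2^3 * X 3, X 3^3 * X 2, X 4^3 * X 3}"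
proof -
  let ?Q = "{(1, 1, 1, 2), (3, 3, 3, 2), (2, 2, 2, 3), (4, 4, 4, 3), (1, 1, 3, 4), (4, 4, 1, 2)} :: (4 \<times> 4 \<times> 4 \<times> 4) set"
  let ?e = "vector [0, 1, 4, 3] :: nat^4"
  have d: "distinct [\<sigma> 1, \<sigma> 3, \<sigma> 2, \<sigma> 4]" using \<sigma>_distinct by auto
  note u = distinct4_UNIV[OF d]
  have keys: "Poly_Mapping.keys (outer_poly (\<sigma> 1) (\<sigma> 3) (\<sigma> 2) (\<sigma> 4)) =
      (\<lambda>(w, x, y, z). quad (\<sigma> w) (\<sigma> x) (\<sigma> y) (\<sigma> z)) ` ?Q"
    unfolding keys_special(4)[OF d u] by simp
  \<comment> \<open>The sixth monomial of \<open>outer_poly\<close>: x_4^2 x_1 x_2 = (x_4^3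
    x_3)(x_1^3 x_2) / (x_1^2 x_3 x_4).\<close>
  have "eigen_monomial (4, 4, 1, 2)"
    using assms(4,1,5) by (rule eigen_monomial_exchange) (simp add: mult_ac)
  hence eigen: "\<forall>m\<in>?Q. eigen_monomial m" using assms by simp
  \<comment> \<open>The common weight 1 modulo 6 is read off from x_1^3 x_2, the base
    monomial.\<close>
  have weight: "\<forall>(w, x, y, z)\<in>?Q. (?e $ w + ?e $ x + ?e $ y + ?e $ z) mod 6 = 1 mod 6" by simp
  have param: "\<forall>s :: complex^4. (\<forall>i. s $ i \<noteq> 0) \<and> s $ 1 = 1 \<and>
      (\<forall>(w, x, y, z)\<in>?Q. s $ w * s $ x * s $ y * s $ z = s $ 1 * s $ 1 * s $ 1 * s $ 2) \<longrightarrow>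
      (\<exists>\<omega>. \<omega> ^ 6 = 1 \<and> (\<forall>i. s $ i = \<omega> ^ (?e $ i)))"
  proof (intro allI impI, elim conjE)
    fix s :: "complex^4"
    assume s: "\<forall>i. s $ i \<noteq> 0" "s $ 1 = 1"
      "\<forall>(w, x, y, z)\<in>?Q. s $ w * s $ x * s $ y * s $ z = s $ 1 * s $ 1 * s $ 1 * s $ 2"
    have "s $ 3 * s $ 4 = s $ 2" "(s $ 4)^2 * s $ 2 = s $ 2" "(s $ 2)^3 * s $ 3 = s $ 2"
      using s(2,3) by (simp_all add: power2_eq_square power3_eq_cube mult_ac)
    thus "\<exists>\<omega>. \<omega> ^ 6 = 1 \<and> (\<forall>i. s $ i = \<omega> ^ (?e $ i))"
      using root6_outer[of "s $ 2" "s $ 3" "s $ 4"] s(1,2) by (intro exI[of _ "s $ 2"]) (simp add: forall_4)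
  qed
  have filt: "filter (\<lambda>(a, b, c, d). (?e $ 1 * a + ?e $ 2 * b + ?e $ 3 * c + ?e $ 4 * d) mod 6 = 1 mod 6) quartic_exponents =
     [(0, 0, 1, 3), (0, 1, 3, 0), (0, 3, 1, 0), (1, 1, 0, 2), (2, 0, 1, 1), (3, 1, 0, 0)]"
    unfolding quartic_exponents_def vector_4 by code_simp
  note res = exceptional[where w' = 1 and x' = 1 and y' = 1 and z' = 2 and j = 2 and k = 1,
      OF homogeneous_special(4)[OF d u] smooth_outer[OF d u] keys eigen _ _ _ _ _ weight param filt]
  show "D = {pgl_class (diag_mat (vector [1, \<omega>, \<omega>^4, \<omega>^3])) | \<omega>. \<omega>^6 = 1}"
    using res(1) by (simp add: cyclic_class_4)
  show "subgrp D \<cong> integer_mod_group 6"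
    using res(2) by simp
  show "S_of 4 (permute_datum \<sigma> I) = {X 1^3 * X 2, X 1^2 * X 3 * X 4, X 1 * X 2 * X 4^2,
       X 2^3 * X 3, X 3^3 * X 2, X 4^3 * X 3}"
    using res(3) by (simp add: insert_commute mult_ac)
qed

lemma exceptional2:
  assumes "eigen_monomial (3, 3, 3, 2)" "eigen_monomial (1, 1, 1, 2)" "eigen_monomial (2, 2, 2, 3)"
    "eigen_monomial (4, 4, 4, 3)" "eigen_monomial (3, 3, 1, 4)"
  shows "D = {pgl_class (diag_mat (vector [1, \<omega>, \<omega>^4, \<omega>^5])) | \<omega>. \<omega>^6 = 1}"
    "subgrp D \<cong> integer_mod_group 6"
    "S_of 4 (permute_datum \<sigma> I) = {X 1^3 * X 2, X 1 * X 2^2 * X 4, X 1 * X 3^2 * X 4,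
       X 2^3 * X 3, X 3^3 * X 2, X 4^3 * X 3}"
proof -
  let ?Q = "{(3, 3, 3, 2), (1, 1, 1, 2), (2, 2, 2, 3), (4, 4, 4, 3), (3, 3, 1, 4), (2, 2, 1, 4)} :: (4 \<times> 4 \<times> 4 \<times> 4) set"
  let ?e = "vector [0, 1, 4, 5] :: nat^4"
  have d: "distinct [\<sigma> 3, \<sigma> 1, \<sigma> 2, \<sigma> 4]" using \<sigma>_distinct by auto
  note u = distinct4_UNIV[OF d]
  have keys: "Poly_Mapping.keys (inner_poly (\<sigma> 3) (\<sigma> 1) (\<sigma> 2) (\<sigma> 4)) =
      (\<lambda>(w, x, y, z). quad (\<sigma> w) (\<sigma> x) (\<sigma> y) (\<sigma> z)) ` ?Q"
    unfolding keys_special(3)[OF d u] by simp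
  \<comment> \<open>The sixth monomial of \<open>inner_poly\<close>: x_2^2 x_1 x_4 = (x_2^3
    x_3)(x_3^2 x_1 x_4) / (x_3^3 x_2).\<close>
  have "eigen_monomial (2, 2, 1, 4)"
    using assms(3,5,1) by (rule eigen_monomial_exchange) (simp add: mult_ac)
  hence eigen: "\<forall>m\<in>?Q. eigen_monomial m" using assms by simp
  have weight: "\<forall>(w, x, y, z)\<in>?Q. (?e $ w + ?e $ x + ?e $ y + ?e $ z) mod 6 = 1 mod 6" by simp
  have param: "\<forall>s :: complex^4. (\<forall>i. s $ i \<noteq> 0) \<and> s $ 1 = 1 \<and>
      (\<forall>(w, x, y, z)\<in>?Q. s $ w * s $ x * s $ y * s $ z = s $ 1 * s $ 1 * s $ 1 * s $ 2) \<longrightarrow>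
      (\<exists>\<omega>. \<omega> ^ 6 = 1 \<and> (\<forall>i. s $ i = \<omega> ^ (?e $ i)))"
  proof (intro allI impI, elim conjE)
    fix s :: "complex^4"
    assume s: "\<forall>i. s $ i \<noteq> 0" "s $ 1 = 1"
      "\<forall>(w, x, y, z)\<in>?Q. s $ w * s $ x * s $ y * s $ z = s $ 1 * s $ 1 * s $ 1 * s $ 2"
    have "(s $ 2)^2 * s $ 4 = s $ 2" "(s $ 3)^2 * s $ 4 = s $ 2" "(s $ 2)^3 * s $ 3 = s $ 2"
      using s(2,3) by (simp_all add: power2_eq_square power3_eq_cube mult_ac)
    thus "\<exists>\<omega>. \<omega> ^ 6 = 1 \<and> (\<forall>i. s $ i = \<omega> ^ (?e $ i))"
      using root6_inner[of "s $ 2" "s $ 4" "s $ 3"] s(1,2) by (intro exI[of _ "s $ 2"]) (simp add: forall_4)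
  qed
  have filt: "filter (\<lambda>(a, b, c, d). (?e $ 1 * a + ?e $ 2 * b + ?e $ 3 * c + ?e $ 4 * d) mod 6 = 1 mod 6) quartic_exponents =
     [(0, 0, 1, 3), (0, 1, 3, 0), (0, 3, 1, 0), (1, 0, 2, 1), (1, 2, 0, 1), (3, 1, 0, 0)]"
    unfolding quartic_exponents_def vector_4 by code_simp
  note res = exceptional[where w' = 1 and x' = 1 and y' = 1 and z' = 2 and j = 2 and k = 1,
      OF homogeneous_special(3)[OF d u] smooth_inner[OF d u] keys eigen _ _ _ _ _ weight param filt]
  show "D = {pgl_class (diag_mat (vector [1, \<omega>, \<omega>^4, \<omega>^5])) | \<omega>. \<omega>^6 = 1}"
    using res(1) by (simp add: cyclic_class_4)
  show "subgrp D \<cong> integer_mod_group 6"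
    using res(2) by simp
  show "S_of 4 (permute_datum \<sigma> I) = {X 1^3 * X 2, X 1 * X 2^2 * X 4, X 1 * X 3^2 * X 4,
       X 2^3 * X 3, X 3^3 * X 2, X 4^3 * X 3}"
    using res(3) by (simp add: insert_commute mult_ac)
qed

lemma exceptional3:
  assumes "eigen_monomial (3, 3, 3, 3)" "eigen_monomial (4, 4, 4, 2)" "eigen_monomial (1, 1, 1, 2)"
    "eigen_monomial (2, 2, 2, 3)" "eigen_monomial (4, 4, 1, 3)"
  shows "D = {pgl_class (diag_mat (vector [\<omega>, \<omega>^6, 1, \<omega>^4])) | \<omega>. \<omega>^9 = 1}"
    "subgrp D \<cong> integer_mod_group 9"
    "S_of 4 (permute_datum \<sigma> I) = {X 1^3 * X 2, X 2^3 * X 3, X 3^4, X 4^3 * X 2, X 1 * X 3 * X 4^2}"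
proof -
  let ?Q = "{(3, 3, 3, 3), (4, 4, 4, 2), (1, 1, 1, 2), (2, 2, 2, 3), (4, 4, 1, 3)} :: (4 \<times> 4 \<times> 4 \<times> 4) set"
  let ?e = "vector [1, 6, 0, 4] :: nat^4"
  have d: "distinct [\<sigma> 4, \<sigma> 1, \<sigma> 2, \<sigma> 3]" using \<sigma>_distinct by auto
  note u = distinct4_UNIV[OF d]
  have keys: "Poly_Mapping.keys (chain_poly (\<sigma> 4) (\<sigma> 1) (\<sigma> 2) (\<sigma> 3)) =
      (\<lambda>(w, x, y, z). quad (\<sigma> w) (\<sigma> x) (\<sigma> y) (\<sigma> z)) ` ?Q"
    unfolding keys_special(2)[OF d u] by simp
  have eigen: "\<forall>m\<in>?Q. eigen_monomial m" using assms by simp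
  have weight: "\<forall>(w, x, y, z)\<in>?Q. (?e $ w + ?e $ x + ?e $ y + ?e $ z) mod 9 = 0 mod 9" by simp
  have param: "\<forall>s :: complex^4. (\<forall>i. s $ i \<noteq> 0) \<and> s $ 3 = 1 \<and>
      (\<forall>(w, x, y, z)\<in>?Q. s $ w * s $ x * s $ y * s $ z = s $ 3 * s $ 3 * s $ 3 * s $ 3) \<longrightarrow>
      (\<exists>\<omega>. \<omega> ^ 9 = 1 \<and> (\<forall>i. s $ i = \<omega> ^ (?e $ i)))"
  proof (intro allI impI, elim conjE)
    fix s :: "complex^4"
    assume s: "\<forall>i. s $ i \<noteq> 0" "s $ 3 = 1"
      "\<forall>(w, x, y, z)\<in>?Q. s $ w * s $ x * s $ y * s $ z = s $ 3 * s $ 3 * s $ 3 * s $ 3"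
    have "(s $ 4)^3 * s $ 2 = 1" "(s $ 1)^3 * s $ 2 = 1" "(s $ 2)^3 = 1" "(s $ 4)^2 * s $ 1 = 1"
      using s(2,3) by (simp_all add: power2_eq_square power3_eq_cube mult_ac)
    thus "\<exists>\<omega>. \<omega> ^ 9 = 1 \<and> (\<forall>i. s $ i = \<omega> ^ (?e $ i))"
      using root9_chain[of "s $ 4" "s $ 2" "s $ 1"] s(1,2) by (intro exI[of _ "s $ 1"]) (simp add: forall_4)
  qed
  have filt: "filter (\<lambda>(a, b, c, d). (?e $ 1 * a + ?e $ 2 * b + ?e $ 3 * c + ?e $ 4 * d) mod 9 = 0 mod 9) quartic_exponents =
     [(0, 0, 4, 0), (0, 1, 0, 3), (0, 3, 1, 0), (1, 0, 1, 2), (3, 1, 0, 0)]"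
    unfolding quartic_exponents_def vector_4 by code_simp
  note res = exceptional[where w' = 3 and x' = 3 and y' = 3 and z' = 3 and j = 1 and k = 3,
      OF homogeneous_special(2)[OF d u] smooth_chain[OF d u] keys eigen _ _ _ _ _ weight param filt]
  show "D = {pgl_class (diag_mat (vector [\<omega>, \<omega>^6, 1, \<omega>^4])) | \<omega>. \<omega>^9 = 1}"
    using res(1) by (simp add: cyclic_class_4)
  show "subgrp D \<cong> integer_mod_group 9"
    using res(2) by simp
  show "S_of 4 (permute_datum \<sigma> I) = {X 1^3 * X 2, X 2^3 * X 3, X 3^4, X 4^3 * X 2, X 1 * X 3 * X 4^2}"
    using res(3) by (simp add: insert_commute mult_ac)
qed

lemma exceptional4:
  assumes "eigen_monomial (3, 3, 3, 3)" "eigen_monomial (2, 2, 2, 3)" "eigen_monomial (4, 4, 4, 3)"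
    "eigen_monomial (2, 2, 4, 4)" "eigen_monomial (1, 1, 1, 2)"
  shows "D = {pgl_class (diag_mat (vector [\<omega>, \<omega>^6, 1, \<omega>^3])) | \<omega>. \<omega>^9 = 1}"
    "subgrp D \<cong> integer_mod_group 9"
    "S_of 4 (permute_datum \<sigma> I) = {X 1^3 * X 2, X 2^3 * X 3, X 3^4, X 4^3 * X 3, X 2^2 * X 4^2, X 2 * X 3^2 * X 4}"
proof -
  let ?Q = "{(3, 3, 3, 3), (2, 2, 2, 3), (4, 4, 4, 3), (2, 2, 4, 4), (1, 1, 1, 2)} :: (4 \<times> 4 \<times> 4 \<times> 4) set"
  let ?e = "vector [1, 6, 0, 3] :: nat^4"
  have d: "distinct [\<sigma> 2, \<sigma> 4, \<sigma> 3, \<sigma> 1]" using \<sigma>_distinct by auto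
  note u = distinct4_UNIV[OF d]
  have keys: "Poly_Mapping.keys (conic_tail_poly (\<sigma> 2) (\<sigma> 2) (\<sigma> 4) (\<sigma> 3) (\<sigma> 1)) =
      (\<lambda>(w, x, y, z). quad (\<sigma> w) (\<sigma> x) (\<sigma> y) (\<sigma> z)) ` ?Q"
    unfolding keys_special(1)[OF d u, of "\<sigma> 2", simplified] by simp
  have eigen: "\<forall>m\<in>?Q. eigen_monomial m" using assms by simp
  have weight: "\<forall>(w, x, y, z)\<in>?Q. (?e $ w + ?e $ x + ?e $ y + ?e $ z) mod 9 = 0 mod 9" by simp
  have param: "\<forall>s :: complex^4. (\<forall>i. s $ i \<noteq> 0) \<and> s $ 3 = 1 \<and>
      (\<forall>(w, x, y, z)\<in>?Q. s $ w * s $ x * s $ y * s $ z = s $ 3 * s $ 3 * s $ 3 * s $ 3) \<longrightarrow>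
      (\<exists>\<omega>. \<omega> ^ 9 = 1 \<and> (\<forall>i. s $ i = \<omega> ^ (?e $ i)))"
  proof (intro allI impI, elim conjE)
    fix s :: "complex^4"
    assume s: "\<forall>i. s $ i \<noteq> 0" "s $ 3 = 1"
      "\<forall>(w, x, y, z)\<in>?Q. s $ w * s $ x * s $ y * s $ z = s $ 3 * s $ 3 * s $ 3 * s $ 3"
    have "(s $ 1)^3 * s $ 2 = 1" "(s $ 2)^3 = 1" "(s $ 4)^3 = 1" "(s $ 2)^2 * (s $ 4)^2 = 1"
      using s(2,3) by (simp_all add: power2_eq_square power3_eq_cube mult_ac)
    thus "\<exists>\<omega>. \<omega> ^ 9 = 1 \<and> (\<forall>i. s $ i = \<omega> ^ (?e $ i))"
      using root9_tail[of "s $ 1" "s $ 2" "s $ 4"] s(1,2) by (intro exI[of _ "s $ 1"]) (simp add: forall_4)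
  qed
  have filt: "filter (\<lambda>(a, b, c, d). (?e $ 1 * a + ?e $ 2 * b + ?e $ 3 * c + ?e $ 4 * d) mod 9 = 0 mod 9) quartic_exponents =
     [(0, 0, 1, 3), (0, 0, 4, 0), (0, 1, 2, 1), (0, 2, 0, 2), (0, 3, 1, 0), (3, 1, 0, 0)]"
    unfolding quartic_exponents_def vector_4 by code_simp
  note res = exceptional[where w' = 3 and x' = 3 and y' = 3 and z' = 3 and j = 1 and k = 3,
      OF homogeneous_special(1)[OF d u] smooth_conic_tail[OF d u, of "\<sigma> 2", simplified] keys eigen _ _ _ _ _ weight param filt]
  show "D = {pgl_class (diag_mat (vector [\<omega>, \<omega>^6, 1, \<omega>^3])) | \<omega>. \<omega>^9 = 1}"
    using res(1) by (simp add: cyclic_class_4)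
  show "subgrp D \<cong> integer_mod_group 9"
    using res(2) by simp
  show "S_of 4 (permute_datum \<sigma> I) = {X 1^3 * X 2, X 2^3 * X 3, X 3^4, X 4^3 * X 3, X 2^2 * X 4^2, X 2 * X 3^2 * X 4}"
    using res(3) by (simp add: insert_commute mult_ac)
qed

lemma exceptional5:
  assumes "eigen_monomial (2, 2, 2, 2)" "eigen_monomial (1, 1, 1, 2)" "eigen_monomial (3, 3, 3, 2)"
    "eigen_monomial (1, 1, 3, 3)" "eigen_monomial (4, 4, 4, 4)"
  shows "D = {pgl_class (diag_mat (vector [\<omega>^4, 1, \<omega>^8, \<omega>^3])) | \<omega>. \<omega>^12 = 1}"
    "subgrp D \<cong> integer_mod_group 12"
    "S_of 4 (permute_datum \<sigma> I) = {X 1^3 * X 2, X 1^2 * X 3^2, X 1 * X 2^2 * X 3, X 2^4, X 3^3 * X 2, X 4^4}"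
proof -
  let ?Q = "{(2, 2, 2, 2), (1, 1, 1, 2), (3, 3, 3, 2), (1, 1, 3, 3), (4, 4, 4, 4)} :: (4 \<times> 4 \<times> 4 \<times> 4) set"
  let ?e = "vector [4, 0, 8, 3] :: nat^4"
  have d: "distinct [\<sigma> 1, \<sigma> 3, \<sigma> 2, \<sigma> 4]" using \<sigma>_distinct by auto
  note u = distinct4_UNIV[OF d]
  have keys: "Poly_Mapping.keys (conic_tail_poly (\<sigma> 4) (\<sigma> 1) (\<sigma> 3) (\<sigma> 2) (\<sigma> 4)) =
      (\<lambda>(w, x, y, z). quad (\<sigma> w) (\<sigma> x) (\<sigma> y) (\<sigma> z)) ` ?Q"
    unfolding keys_special(1)[OF d u, of "\<sigma> 4", simplified] by simp
  have eigen: "\<forall>m\<in>?Q. eigen_monomial m" using assms by simp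
  have weight: "\<forall>(w, x, y, z)\<in>?Q. (?e $ w + ?e $ x + ?e $ y + ?e $ z) mod 12 = 0 mod 12" by simp
  have param: "\<forall>s :: complex^4. (\<forall>i. s $ i \<noteq> 0) \<and> s $ 2 = 1 \<and>
      (\<forall>(w, x, y, z)\<in>?Q. s $ w * s $ x * s $ y * s $ z = s $ 2 * s $ 2 * s $ 2 * s $ 2) \<longrightarrow>
      (\<exists>\<omega>. \<omega> ^ 12 = 1 \<and> (\<forall>i. s $ i = \<omega> ^ (?e $ i)))"
  proof (intro allI impI, elim conjE)
    fix s :: "complex^4"
    assume s: "\<forall>i. s $ i \<noteq> 0" "s $ 2 = 1"
      "\<forall>(w, x, y, z)\<in>?Q. s $ w * s $ x * s $ y * s $ z = s $ 2 * s $ 2 * s $ 2 * s $ 2"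
    have "(s $ 1)^3 = 1" "(s $ 3)^3 = 1" "(s $ 1)^2 * (s $ 3)^2 = 1" "(s $ 4)^4 = 1"
      using s(2,3) by (simp_all add: power2_eq_square power3_eq_cube power4_eq_xxxx mult_ac)
    thus "\<exists>\<omega>. \<omega> ^ 12 = 1 \<and> (\<forall>i. s $ i = \<omega> ^ (?e $ i))"
      using root12[of "s $ 1" "s $ 3" "s $ 4"] s(1,2) by (intro exI[of _ "s $ 1 * (s $ 4)^3"]) (simp add: forall_4)
  qed
  have filt: "filter (\<lambda>(a, b, c, d). (?e $ 1 * a + ?e $ 2 * b + ?e $ 3 * c + ?e $ 4 * d) mod 12 = 0 mod 12) quartic_exponents =
     [(0, 0, 0, 4), (0, 1, 3, 0), (0, 4, 0, 0), (1, 2, 1, 0), (2, 0, 2, 0), (3, 1, 0, 0)]"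
    unfolding quartic_exponents_def vector_4 by code_simp
  note res = exceptional[where w' = 2 and x' = 2 and y' = 2 and z' = 2 and j = 1 and k = 4,
      OF homogeneous_special(1)[OF d u] smooth_conic_tail[OF d u, of "\<sigma> 4", simplified] keys eigen _ _ _ _ _ weight param filt]
  show "D = {pgl_class (diag_mat (vector [\<omega>^4, 1, \<omega>^8, \<omega>^3])) | \<omega>. \<omega>^12 = 1}"
    using res(1) by (simp add: cyclic_class_4)
  show "subgrp D \<cong> integer_mod_group 12"
    using res(2) by simp
  show "S_of 4 (permute_datum \<sigma> I) = {X 1^3 * X 2, X 1^2 * X 3^2, X 1 * X 2^2 * X 3, X 2^4, X 3^3 * X 2, X 4^4}"
    using res(3) by (simp add: insert_commute mult_ac)
qed

end

section \<open>Logarithms of characters and the final case distinction\<close>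

lemma exp_2pi_i_eq_1_iff: "exp (2 * of_real pi * \<i> * s) = 1 \<longleftrightarrow> s \<in> \<int>"
proof
  assume "exp (2 * of_real pi * \<i> * s) = 1"
  then obtain n :: int where "2 * of_real pi * \<i> * s = (of_int (2 * n) * pi) * \<i>"
    using exp_eq[of "2 * of_real pi * \<i> * s" 0] by auto
  hence "(2 * of_real pi * \<i>) * s = (2 * of_real pi * \<i>) * of_int n" by (simp add: mult_ac)
  hence "s = of_int n" by (subst (asm) mult_cancel_left) simp
  thus "s \<in> \<int>" by simp
next
  assume "s \<in> \<int>"
  then obtain n :: int where "s = of_int n" by (auto elim: Ints_cases)
  thus "exp (2 * of_real pi * \<i> * s) = 1" using exp_eq[of "2 * of_real pi * \<i> * s" 0] by (auto simp: mult_ac)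
qed

theorem theorem5p1:
  fixes F :: "4 cpoly" and G :: "4 pgl set" and P :: "complex^4^4" and I :: "4 datum"
  assumes "homogeneous 4 F" and "smooth_poly F"
    and "subgroup G PGL" and "G \<subseteq> Lin (hypersurface F)"
    and "comm_group (subgrp G)" and "liftable G"
    and "associated_datum F P I" and "grp I = G"
    and "maximal_class 4 (data_class 4 I)"
  shows "simple_set 4 (S_of 4 I) \<or>
    (\<exists>\<sigma>. \<sigma> permutes UNIV \<and>
      (let G' = diag_group (permute_datum \<sigma> I); S = S_of 4 (permute_datum \<sigma> I) in
        (G' = {pgl_class (diag_mat (vector [1, \<omega>, \<omega>^4, \<omega>^3])) | \<omega>. \<omega>^6 = 1} \<and>
         subgrp G' \<cong> integer_mod_group 6 \<and>
         S = {X 1^3 * X 2, X 1^2 * X 3 * X 4, X 1 * X 2 * X 4^2,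
              X 2^3 * X 3, X 3^3 * X 2, X 4^3 * X 3}) \<or>
        (G' = {pgl_class (diag_mat (vector [1, \<omega>, \<omega>^4, \<omega>^5])) | \<omega>. \<omega>^6 = 1} \<and>
         subgrp G' \<cong> integer_mod_group 6 \<and>
         S = {X 1^3 * X 2, X 1 * X 2^2 * X 4, X 1 * X 3^2 * X 4,
              X 2^3 * X 3, X 3^3 * X 2, X 4^3 * X 3}) \<or>
        (G' = {pgl_class (diag_mat (vector [\<omega>, \<omega>^6, 1, \<omega>^4])) | \<omega>. \<omega>^9 = 1} \<and>
         subgrp G' \<cong> integer_mod_group 9 \<and>
         S = {X 1^3 * X 2, X 2^3 * X 3, X 3^4, X 4^3 * X 2, X 1 * X 3 * X 4^2}) \<or>
        (G' = {pgl_class (diag_mat (vector [\<omega>, \<omega>^6, 1, \<omega>^3])) | \<omega>. \<omega>^9 = 1} \<and>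
         subgrp G' \<cong> integer_mod_group 9 \<and>
         S = {X 1^3 * X 2, X 2^3 * X 3, X 3^4, X 4^3 * X 3, X 2^2 * X 4^2, X 2 * X 3^2 * X 4}) \<or>
        (G' = {pgl_class (diag_mat (vector [\<omega>^4, 1, \<omega>^8, \<omega>^3])) | \<omega>. \<omega>^12 = 1} \<and>
         subgrp G' \<cong> integer_mod_group 12 \<and>
         S = {X 1^3 * X 2, X 1^2 * X 3^2, X 1 * X 2^2 * X 3, X 2^4, X 3^3 * X 2, X 4^4})))"
proof -
  note datum = assms(7)[unfolded associated_datum_def]
  have P: "invertible P" and chr: "chr I g \<noteq> 0" and chrs: "chrs I i g \<noteq> 0" if "g \<in> grp I" for g i
    using datum characters_nonzero that by blast+
  let ?p = "lin_subst P F"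
  have hom: "homogeneous 4 ?p" using assms(1) by (rule homogeneous_lin_subst)
  have smooth: "smooth_poly ?p"
    using datum assms(2) by (intro smooth_poly_lin_subst) auto
  \<comment> \<open>After division by 2 pi i, logarithms matter only modulo integers: membership in
    \<open>K\<close> expresses equality of character values on the whole group.\<close>
  define K where "K = {v :: 4 pgl \<Rightarrow> complex. \<forall>g\<in>grp I. v g \<in> \<int>}"
  \<comment> \<open>The quarter of \<open>chr\<close> is subtracted so that all four factors of a monomial are treated alike.\<close>
  define u where "u i g = (Ln (chrs I i g) - Ln (chr I g) / 4) / (2 * of_real pi * \<i>)" for i g
  define q where "q w x y z \<longleftrightarrow> u w + u x + u y + u z \<in> K" for w x y z
  have q_iff: "q w x y z \<longleftrightarrow> (\<forall>g\<in>grp I. chrs I w g * chrs I x g * chrs I y g * chrs I z g = chr I g)" for w x y z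
  proof -
    have "(u w + u x + u y + u z) g \<in> \<int> \<longleftrightarrow> chrs I w g * chrs I x g * chrs I y g * chrs I z g = chr I g"
      if g: "g \<in> grp I" for g
    proof -
      have "2 * of_real pi * \<i> * (u w + u x + u y + u z) g =
          Ln (chrs I w g) + Ln (chrs I x g) + Ln (chrs I y g) + Ln (chrs I z g) - Ln (chr I g)"
        by (simp add: u_def field_simps)
      hence "exp (2 * of_real pi * \<i> * (u w + u x + u y + u z) g) =
          chrs I w g * chrs I x g * chrs I y g * chrs I z g / chr I g"
        using chr[OF g] chrs[OF g] by (simp add: exp_add exp_diff)
      thus ?thesis using chr[OF g] unfolding exp_2pi_i_eq_1_iff[symmetric] by (simp add: divide_eq_1_iff)
    qed
    thus ?thesis by (simp add: q_def K_def)
  qed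
  \<comment> \<open>Comparing coefficients in the eigenvector equation: every monomial of
    \<open>F\<close> in the coordinates x belongs to S.\<close>
  have key_value: "monomial_value m (\<chi> i. chrs I i g) = chr I g"
    if m: "m \<in> Poly_Mapping.keys ?p" and g: "g \<in> grp I" for m g
  proof -
    have "lin_subst (diag_mat (\<chi> i. chrs I i g)) ?p = Const (chr I g) * ?p" using datum g by blast
    hence "monomial_value m (\<chi> i. chrs I i g) * Poly_Mapping.lookup ?p m = chr I g * Poly_Mapping.lookup ?p m"
      by (metis lookup_lin_subst_diag lookup_Const_mult monomial_value_def)
    thus ?thesis using m by (simp add: in_keys_iff)
  qed
  have key_q: "q w x y z" if "quad w x y z \<in> Poly_Mapping.keys ?p" for w x y z
    using key_value[OF that] by (simp add: q_iff monomial_value_quad)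
  have q_S: "X w * X x * X y * X z \<in> S_of 4 I" if "q w x y z" for w x y z
  proof -
    have "X w * X x * X y * X z = (\<Prod>i\<in>UNIV. X i ^ Poly_Mapping.lookup (quad w x y z) i)"
      by (simp add: monomial_quad prod_X_power)
    moreover have "(\<Sum>i\<in>UNIV. Poly_Mapping.lookup (quad w x y z) i) = 4"
      by (simp add: lookup_quad sum.distrib of_bool_def)
    moreover have "\<forall>g\<in>grp I. chr I g = (\<Prod>i\<in>UNIV. chrs I i g ^ Poly_Mapping.lookup (quad w x y z) i)"
      using that monomial_value_quad[of w x y z "\<chi> i. chrs I i _"] by (simp add: q_iff monomial_value_def)
    ultimately show ?thesis unfolding S_of_def by blast
  qed
  show ?thesis
  proof (cases "\<exists>f. tame_on UNIV f \<and> (\<forall>i. q i i i (f i))")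
    case True
    then obtain f where f: "tame_on UNIV f" "\<And>i. q i i i (f i)" by blast
    have "X i ^ (4 - 1) * X (f i) \<in> S_of 4 I" for i
      using q_S[OF f(2)] by (simp add: power3_eq_cube)
    thus ?thesis using simple_set_tame[of 4 f] f(1) by simp
  next
    case False
    obtain a b c d where abcd: "distinct [a, b, c, d]" "q a a a c" "q b b b c"
      "(q c c c c \<and> q a a b b \<and> q d d d a) \<or> (q c c c c \<and> q a a b b \<and> q d d d d) \<or>
       (q d d d d \<and> q c c c d \<and> q a a b d) \<or> (q c c c a \<and> q d d d a \<and> q a a b d) \<or>
       (q c c c b \<and> q d d d b \<and> q a a b d)"
    proof (rule no_tame_graph_cases[where u = u and K = K, folded q_def])
      show "x - y \<in> K" if "x \<in> K" "y \<in> K" for x y using that by (simp add: K_def)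
      show "CARD(4) = 4" by simp
      show "\<exists>j. q i i i j" for i using smooth_quartic_point[OF smooth hom] key_q by metis
      show "q i i i i \<or> q i i i j \<or> q i i j j \<or> q j j j i \<or> q j j j j \<or>
          q i i i l \<or> q i i j l \<or> q j j i l \<or> q j j j l" if ijl: "distinct [i, j, l]" for i j l
      proof -
        have "card {i, j, l} < CARD(4)" using ijl by simp
        hence "{i, j, l} \<noteq> UNIV" by auto
        then obtain k where "k \<notin> {i, j, l}" by blast
        hence ijkl: "distinct [i, j, k, l]" using ijl by auto
        show ?thesis
          using smooth_quartic_line[OF smooth hom ijkl distinct4_UNIV[OF ijkl]] key_q by blast
      qed
      show "\<exists>i. \<not> q i i i (f i)" if "tame_on UNIV f" for f using False that by blast
    qed
    have special: "\<exists>\<sigma>. maximal_quartic_datum F P I \<sigma> \<and> \<sigma> 1 = w \<and> \<sigma> 2 = x \<and> \<sigma> 3 = y \<and> \<sigma> 4 = z"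
      if "distinct [w, x, y, z]" for w x y z
      using permutation4_exists[OF that] assms(3,7-9) by (metis maximal_quartic_datum.intro)
    have mono: "maximal_quartic_datum.eigen_monomial I \<sigma> (w, x, y, z)"
      if "maximal_quartic_datum F P I \<sigma>" "q (\<sigma> w) (\<sigma> x) (\<sigma> y) (\<sigma> z)" for \<sigma> w x y z
      using that by (simp add: maximal_quartic_datum.eigen_monomial_def[OF that(1)] q_iff)
    note perm = maximal_quartic_datum.perm
    \<comment> \<open>In each case \<open>\<sigma>\<close> lists a, b, c, d in the order of the
      variables in the statement. In the first case, for example, the tail \<open>d\<close> becomes
      x_1, its target \<open>a\<close> becomes x_2 and the loop \<open>c\<close> becomes
      x_3.\<close>
    from abcd(4) show ?thesis
    proof (elim disjE conjE)
      assume "q c c c c" "q a a b b" "q d d d a"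
      moreover obtain \<sigma> where \<sigma>: "maximal_quartic_datum F P I \<sigma>" "\<sigma> 1 = d" "\<sigma> 2 = a" "\<sigma> 3 = c" "\<sigma> 4 = b"
        using special[of d a c b] abcd(1) by auto
      ultimately show ?thesis
        using maximal_quartic_datum.exceptional4[OF \<sigma>(1)] mono[OF \<sigma>(1)] abcd(2,3) perm[OF \<sigma>(1)]
        by (intro disjI2 exI[of _ \<sigma>]) (simp add: Let_def)
    next
      assume "q c c c c" "q a a b b" "q d d d d"
      moreover obtain \<sigma> where \<sigma>: "maximal_quartic_datum F P I \<sigma>" "\<sigma> 1 = a" "\<sigma> 2 = c" "\<sigma> 3 = b" "\<sigma> 4 = d"
        using special[of a c b d] abcd(1) by auto
      ultimately show ?thesis
        using maximal_quartic_datum.exceptional5[OF \<sigma>(1)] mono[OF \<sigma>(1)] abcd(2,3) perm[OF \<sigma>(1)]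
        by (intro disjI2 exI[of _ \<sigma>]) (simp add: Let_def)
    next
      assume "q d d d d" "q c c c d" "q a a b d"
      moreover obtain \<sigma> where \<sigma>: "maximal_quartic_datum F P I \<sigma>" "\<sigma> 1 = b" "\<sigma> 2 = c" "\<sigma> 3 = d" "\<sigma> 4 = a"
        using special[of b c d a] abcd(1) by auto
      ultimately show ?thesis
        using maximal_quartic_datum.exceptional3[OF \<sigma>(1)] mono[OF \<sigma>(1)] abcd(2,3) perm[OF \<sigma>(1)]
        by (intro disjI2 exI[of _ \<sigma>]) (simp add: Let_def)
    next
      assume "q c c c a" "q d d d a" "q a a b d"
      moreover obtain \<sigma> where \<sigma>: "maximal_quartic_datum F P I \<sigma>" "\<sigma> 1 = b" "\<sigma> 2 = c" "\<sigma> 3 = a" "\<sigma> 4 = d"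
        using special[of b c a d] abcd(1) by auto
      ultimately show ?thesis
        using maximal_quartic_datum.exceptional2[OF \<sigma>(1)] mono[OF \<sigma>(1)] abcd(2,3) perm[OF \<sigma>(1)]
        by (intro disjI2 exI[of _ \<sigma>]) (simp add: Let_def)
    next
      assume "q c c c b" "q d d d b" "q a a b d"
      moreover obtain \<sigma> where \<sigma>: "maximal_quartic_datum F P I \<sigma>" "\<sigma> 1 = a" "\<sigma> 2 = c" "\<sigma> 3 = b" "\<sigma> 4 = d"
        using special[of a c b d] abcd(1) by auto
      ultimately show ?thesis
        using maximal_quartic_datum.exceptional1[OF \<sigma>(1)] mono[OF \<sigma>(1)] abcd(2,3) perm[OF \<sigma>(1)]
        by (intro disjI2 exI[of _ \<sigma>]) (simp add: Let_def)
    qed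
  qed
qed

end
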